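(* The gauge action of $N^{\hat\varsigma}(\mathcal M)$ on $\mathrm{op}^\Gamma_{\mathfrak g}(\mathbb P^1)$ (resp. of $N(\mathcal M)$ on $\mathrm{op}_{\mathfrak g}(\mathbb P^1)$) is free. Moreover, every cyclotomic $\mathfrak g$-oper $[\nabla]_\Gamma\in\mathrm{Op}^\Gamma_{\mathfrak g}(\mathbb P^1)$ (resp. $\mathfrak g$-oper $[\nabla]\in\mathrm{Op}_{\mathfrak g}(\mathbb P^1)$) has a unique representative of the form $d+p_{-1}dt+c$ with $c\in\Omega^{\hat\varsigma}(\mathfrak a)$ (resp. $c\in\Omega(\mathfrak a)$).
   Context: $\mathfrak g$ is a finite-dimensional complex semisimple Lie algebra with Cartan subalgebra $\mathfrak h$, simple roots $\alpha_i$ ($i\in I$), Chevalley-Serre generators $E_i,\check\alpha_i,F_i$, and $\mathfrak g=\mathfrak n_-\oplus\mathfrak h\oplus\mathfrak n$, $\mathfrak b=\mathfrak h\oplus\mathfrak n$. $G$ is the adjoint group, $N\subset G$ the unipotent subgroup with Lie algebra $\mathfrak n$. $\check\rho\in\mathfrak h$ is defined by $\langle\alpha_i,\check\rho\rangle=1$ for all $i$; $p_{-1}=\sum_iF_i$; $2\check\rho=\sum_ic_i\check\alpha_i$, $p_1=\sum_ic_iE_i$, $\mathfrak a=\ker(\operatorname{ad}_{p_1})\subset\mathfrak n$. $\nu:I\to I$ is a permutation preserving the Cartan matrix, $T\ge1$ a multiple of its order, $\omega$ a primitive $T$-th root of unity, $\Gamma=\langle\omega\rangle$. $\mathcal M$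 is the algebra of meromorphic (rational) functions on $\mathbb P^1$ (coordinate $t$), $\Omega(\mathfrak p)=\mathfrak p\otimes\mathcal M\,dt$ for $\mathfrak p\subset\mathfrak g$. $\varsigma\in\operatorname{Aut}\mathfrak g$ is defined by $\varsigma(E_i)=\omega^{-1}E_{\nu(i)}$, $\varsigma(\check\alpha_i)=\check\alpha_{\nu(i)}$, $\varsigma(F_i)=\omega F_{\nu(i)}$, and is lifted to $G$ by conjugation. $\hat\varsigma$ acts on $G(\mathcal M)$ by $(\hat\varsigma g)(t)=\varsigma(g(\omega^{-1}t))$ and on $\Omega(\mathfrak g)$ by $\hat\varsigma(X\otimes\varpi)=\varsigma(X)\otimes\mu_{\omega^{-1}}^*\varpi$ with $\mu_{\omega^{-1}}(t)=\omega^{-1}t$; superscript $\hat\varsigma$ denotes invariants. $G(\mathcal M)$ acts on connections $d+A$, $A\in\Omega(\mathfrak g)$, by gauge transformations $g(d+A)g^{-1}=d-dg\,g^{-1}+\operatorname{Ad}_gA$. Define $\mathrm{op}_{\mathfrak g}(\mathbb P^1)=\{d+p_{-1}dt+v: v\in\Omega(\mathfrak b)\}$, $\mathrm{op}^\Gamma_{\mathfrak g}(\mathbb P^1)=\{d+p_{-1}dt+v: v\in\Omega^{\hat\varsigma}(\mathfrak b)\}$, $\mathrm{Op}_{\mathfrak g}(\mathbb P^1)=\mathrm{op}_{\mathfrak g}(\mathbb P^1)/N(\mathcal M)$ and $\mathrm{Op}^\Gamma_{\mathfrak g}(\mathbb P^1)=\mathrm{op}^\Gamma_{\mathfrak g}(\mathbb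 P^1)/N^{\hat\varsigma}(\mathcal M)$; classes are denoted $[\nabla]$ and $[\nabla]_\Gamma$. *)

theory Defs
  imports
    "HOL-Computational_Algebra.Polynomial_Factorial"
    "HOL-Computational_Algebra.Normalized_Fraction"
    "HOL-Computational_Algebra.Field_as_Ring"
    "HOL-Combinatorics.Permutations"
begin

section \<open>Rational functions on the projective line\<close>

type_synonym ratfun = "complex poly fract"

abbreviation ratnum :: "ratfun \<Rightarrow> complex poly" where
  "ratnum f \<equiv> fst (quot_of_fract f)"

abbreviation ratden :: "ratfun \<Rightarrow> complex poly" where
  "ratden f \<equiv> snd (quot_of_fract f)"

definition ratconst :: "complex \<Rightarrow> ratfun" where
  "ratconst c = Fract [:c:] 1"

text \<open>\<^term>\<open>quot_of_fract\<close> is the reduced fraction, so the poles of \<open>f\<close> in \<open>\<complex>\<close> are exactly the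
  zeros of \<^term>\<open>ratden f\<close>.\<close>

definition rat_regular :: "ratfun \<Rightarrow> complex \<Rightarrow> bool" where
  "rat_regular f z \<longleftrightarrow> poly (ratden f) z \<noteq> 0"

definition rat_eval :: "complex \<Rightarrow> ratfun \<Rightarrow> complex" where
  "rat_eval z f = poly (ratnum f) z / poly (ratden f) z"

definition rat_deriv :: "ratfun \<Rightarrow> ratfun" where
  "rat_deriv f = Fract (pderiv (ratnum f) * ratden f - ratnum f * pderiv (ratden f))
                       (ratden f * ratden f)"

text \<open>\<open>f(t) \<mapsto> f(a t)\<close>, intended for \<open>a \<noteq> 0\<close>.\<close>

definition rat_dilate :: "complex \<Rightarrow> ratfun \<Rightarrow> ratfun" where
  "rat_dilate a f = Fract (pcompose (ratnum f) [:0, a:]) (pcompose (ratden f) [:0, a:])"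

text \<open>The pullback of the one-form \<open>f dt\<close> along \<open>t \<mapsto> a t\<close> is \<open>a f(a t) dt\<close>. One-forms are
  identified with their coefficient with respect to \<open>dt\<close> throughout.\<close>

definition form_pullback :: "complex \<Rightarrow> ratfun \<Rightarrow> ratfun" where
  "form_pullback a f = ratconst a * rat_dilate a f"

lemma Fract_quot: "Fract (ratnum f) (ratden f) = (f :: ratfun)" "ratden f \<noteq> 0"
  using quot_to_fract_quot_of_fract[of f] snd_quot_of_fract_nonzero[of f]
  by (simp_all add: quot_to_fract_def case_prod_beta)

lemma rat_deriv_Fract:
  assumes "q \<noteq> 0"
  shows "rat_deriv (Fract p q) = Fract (pderiv p * q - p * pderiv q) (q * q)"
proof -
  define r s where "r = ratnum (Fract p q)" and "s = ratden (Fract p q)"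
  have s: "s \<noteq> 0" and "Fract r s = Fract p q"
    using Fract_quot[of "Fract p q"] by (auto simp: r_def s_def)
  then have e: "r * q = p * s" using assms by (simp add: eq_fract)
  then have "pderiv (r * q) = pderiv (p * s)" by simp
  then have d: "r * pderiv q + q * pderiv r = p * pderiv s + s * pderiv p"
    by (simp add: pderiv_mult)
  have "(pderiv r * s - r * pderiv s) * (q * q) - (pderiv p * q - p * pderiv q) * (s * s)
      = s * q * ((r * pderiv q + q * pderiv r) - (p * pderiv s + s * pderiv p))
        - (q * pderiv s + s * pderiv q) * (r * q - p * s)"
    by (simp add: algebra_simps)
  also have "\<dots> = 0" using d e by simp
  finally have "(pderiv r * s - r * pderiv s) * (q * q) = (pderiv p * q - p * pderiv q) * (s * s)"
    by simp
  then show ?thesis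
    using s assms by (simp add: rat_deriv_def r_def s_def eq_fract)
qed

lemma rat_dilate_Fract:
  assumes "q \<noteq> 0" "a \<noteq> 0"
  shows "rat_dilate a (Fract p q) = Fract (pcompose p [:0, a:]) (pcompose q [:0, a:])"
proof -
  define r s where "r = ratnum (Fract p q)" and "s = ratden (Fract p q)"
  have s: "s \<noteq> 0" and "Fract r s = Fract p q"
    using Fract_quot[of "Fract p q"] by (auto simp: r_def s_def)
  then have "r * q = p * s" using assms by (simp add: eq_fract)
  then have "pcompose (r * q) [:0, a:] = pcompose (p * s) [:0, a:]" by simp
  then have "pcompose r [:0, a:] * pcompose q [:0, a:] = pcompose p [:0, a:] * pcompose s [:0, a:]"
    by (simp add: pcompose_mult)
  moreover have "pcompose q [:0, a:] \<noteq> 0" "pcompose s [:0, a:] \<noteq> 0"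
    using s assms by (auto simp: pcompose_eq_0_iff)
  ultimately show ?thesis
    by (simp add: rat_dilate_def r_def s_def eq_fract)
qed

lemma ratconst_simps [simp]:
  "ratconst 0 = 0" "ratconst 1 = 1"
  "ratconst (a + b) = ratconst a + ratconst b"
  "ratconst (a * b) = ratconst a * ratconst b"
  by (simp_all add: ratconst_def Zero_fract_def One_fract_def one_pCons mult.commute)


section \<open>Finite-dimensional complex Lie algebras\<close>

class complex_lie_algebra = ab_group_add +
  fixes scaleC :: "complex \<Rightarrow> 'a \<Rightarrow> 'a" (infixr "*\<^sub>C" 75)
    and bracket :: "'a \<Rightarrow> 'a \<Rightarrow> 'a"
  assumes scaleC_add_right: "a *\<^sub>C (x + y) = a *\<^sub>C x + a *\<^sub>C y"
    and scaleC_add_left: "(a + b) *\<^sub>C x = a *\<^sub>C x + b *\<^sub>C x"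
    and scaleC_scaleC: "a *\<^sub>C b *\<^sub>C x = (a * b) *\<^sub>C x"
    and scaleC_one: "1 *\<^sub>C x = x"
    and bracket_add_left: "bracket (x + y) z = bracket x z + bracket y z"
    and bracket_add_right: "bracket x (y + z) = bracket x y + bracket x z"
    and bracket_scaleC_left: "bracket (a *\<^sub>C x) y = a *\<^sub>C bracket x y"
    and bracket_scaleC_right: "bracket x (a *\<^sub>C y) = a *\<^sub>C bracket x y"
    and bracket_self: "bracket x x = 0"
    and jacobi: "bracket x (bracket y z) + bracket y (bracket z x) + bracket z (bracket x y) = 0"
    and finite_dimensional: "\<exists>B. finite B \<and> (\<forall>x. \<exists>k. x = (\<Sum>b\<in>B. k b *\<^sub>C b))"

global_interpretation cvec: vector_space "scaleC :: complex \<Rightarrow> 'g \<Rightarrow> 'g::complex_lie_algebra"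
  by unfold_locales (rule scaleC_add_right scaleC_add_left scaleC_scaleC scaleC_one)+

definition lie_subalgebra :: "'g::complex_lie_algebra set \<Rightarrow> bool" where
  "lie_subalgebra S \<longleftrightarrow> cvec.subspace S \<and> (\<forall>x\<in>S. \<forall>y\<in>S. bracket x y \<in> S)"

definition lie_ideal :: "'g::complex_lie_algebra set \<Rightarrow> bool" where
  "lie_ideal S \<longleftrightarrow> cvec.subspace S \<and> (\<forall>x. \<forall>y\<in>S. bracket x y \<in> S)"

definition lie_generated :: "'g::complex_lie_algebra set \<Rightarrow> 'g set" where
  "lie_generated X = \<Inter> {S. lie_subalgebra S \<and> X \<subseteq> S}"

definition bracket_space :: "'g::complex_lie_algebra set \<Rightarrow> 'g set \<Rightarrow> 'g set" where
  "bracket_space S S' = cvec.span {bracket x y | x y. x \<in> S \<and> y \<in> S'}"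

definition lie_solvable :: "'g::complex_lie_algebra set \<Rightarrow> bool" where
  "lie_solvable S \<longleftrightarrow> (\<exists>k. ((\<lambda>D. bracket_space D D) ^^ k) S = {0})"

definition lie_nilpotent :: "'g::complex_lie_algebra set \<Rightarrow> bool" where
  "lie_nilpotent S \<longleftrightarrow> (\<exists>k. (bracket_space S ^^ k) S = {0})"

definition semisimple :: "'g::complex_lie_algebra itself \<Rightarrow> bool" where
  "semisimple _ \<longleftrightarrow> (\<forall>S :: 'g set. lie_ideal S \<and> lie_solvable S \<longrightarrow> S = {0})"

definition cartan_subalgebra :: "'g::complex_lie_algebra set \<Rightarrow> bool" where
  "cartan_subalgebra \<hh> \<longleftrightarrow> lie_subalgebra \<hh> \<and> lie_nilpotent \<hh> \<and>
     {x. \<forall>y\<in>\<hh>. bracket x y \<in> \<hh>} = \<hh>"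

definition lie_automorphism :: "('g::complex_lie_algebra \<Rightarrow> 'g) \<Rightarrow> bool" where
  "lie_automorphism \<phi> \<longleftrightarrow> Vector_Spaces.linear scaleC scaleC \<phi> \<and> bij \<phi> \<and>
     (\<forall>x y. \<phi> (bracket x y) = bracket (\<phi> x) (\<phi> y))"


section \<open>Roots and Chevalley-Serre generators\<close>

text \<open>Elements of the dual of \<open>\<hh>\<close> are represented by functions on the whole Lie algebra of which
  only the values on \<open>\<hh>\<close> matter.\<close>

definition root_space ::
    "'g::complex_lie_algebra set \<Rightarrow> ('g \<Rightarrow> complex) \<Rightarrow> 'g set" where
  "root_space \<hh> \<beta> = {x. \<forall>y\<in>\<hh>. bracket y x = \<beta> y *\<^sub>C x}"

definition is_root :: "'g::complex_lie_algebra set \<Rightarrow> ('g \<Rightarrow> complex) \<Rightarrow> bool" where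
  "is_root \<hh> \<beta> \<longleftrightarrow>
     (\<forall>x\<in>\<hh>. \<forall>y\<in>\<hh>. \<beta> (x + y) = \<beta> x + \<beta> y) \<and> (\<forall>k. \<forall>x\<in>\<hh>. \<beta> (k *\<^sub>C x) = k * \<beta> x) \<and>
     (\<exists>x\<in>\<hh>. \<beta> x \<noteq> 0) \<and> root_space \<hh> \<beta> \<noteq> {0}"

definition simple_roots ::
    "'g::complex_lie_algebra set \<Rightarrow> 'i set \<Rightarrow> ('i \<Rightarrow> 'g \<Rightarrow> complex) \<Rightarrow> bool" where
  "simple_roots \<hh> I \<alpha> \<longleftrightarrow>
     finite I \<and> (\<forall>i\<in>I. is_root \<hh> (\<alpha> i)) \<and>
     (\<forall>k. (\<forall>x\<in>\<hh>. (\<Sum>i\<in>I. k i * \<alpha> i x) = 0) \<longrightarrow> (\<forall>i\<in>I. k i = 0)) \<and>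
     (\<forall>\<beta>. is_root \<hh> \<beta> \<longrightarrow> (\<exists>m :: 'i \<Rightarrow> nat.
        (\<forall>x\<in>\<hh>. \<beta> x = (\<Sum>i\<in>I. of_nat (m i) * \<alpha> i x)) \<or>
        (\<forall>x\<in>\<hh>. \<beta> x = - (\<Sum>i\<in>I. of_nat (m i) * \<alpha> i x))))"

text \<open>\<open>A\<close> is the Cartan matrix, \<open>A i j = \<langle>\<alpha>\<^sub>j, H\<^sub>i\<rangle>\<close>, where \<open>H\<^sub>i\<close> is the simple coroot.\<close>

definition chevalley_serre_generators ::
    "'g::complex_lie_algebra set \<Rightarrow> 'i set \<Rightarrow> ('i \<Rightarrow> 'g \<Rightarrow> complex) \<Rightarrow> ('i \<Rightarrow> 'i \<Rightarrow> int) \<Rightarrow>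
     ('i \<Rightarrow> 'g) \<Rightarrow> ('i \<Rightarrow> 'g) \<Rightarrow> ('i \<Rightarrow> 'g) \<Rightarrow> bool" where
  "chevalley_serre_generators \<hh> I \<alpha> A E H F \<longleftrightarrow>
     simple_roots \<hh> I \<alpha> \<and>
     (\<forall>i\<in>I. H i \<in> \<hh> \<and> E i \<in> root_space \<hh> (\<alpha> i) \<and> F i \<in> root_space \<hh> (\<lambda>x. - \<alpha> i x)) \<and>
     (\<forall>i\<in>I. \<forall>j\<in>I. \<alpha> j (H i) = of_int (A i j)) \<and>
     (\<forall>i\<in>I. A i i = 2) \<and>
     (\<forall>i\<in>I. \<forall>j\<in>I. bracket (H i) (H j) = 0) \<and>
     (\<forall>i\<in>I. \<forall>j\<in>I. bracket (E i) (F j) = (if i = j then H i else 0)) \<and>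
     (\<forall>i\<in>I. \<forall>j\<in>I. i \<noteq> j \<longrightarrow> (bracket (E i) ^^ nat (1 - A i j)) (E j) = 0) \<and>
     (\<forall>i\<in>I. \<forall>j\<in>I. i \<noteq> j \<longrightarrow> (bracket (F i) ^^ nat (1 - A i j)) (F j) = 0) \<and>
     lie_generated (E ` I \<union> H ` I \<union> F ` I) = UNIV"

definition primitive_root_of_unity :: "nat \<Rightarrow> complex \<Rightarrow> bool" where
  "primitive_root_of_unity T \<omega> \<longleftrightarrow> \<omega> ^ T = 1 \<and> (\<forall>k. 0 < k \<and> k < T \<longrightarrow> \<omega> ^ k \<noteq> 1)"


section \<open>Extension of scalars to rational functions\<close>

definition lie_basis :: "'g::complex_lie_algebra set" where
  "lie_basis = (SOME B. finite B \<and> cvec.independent B \<and> cvec.span B = UNIV)"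

lemma lie_basis:
  "finite (lie_basis :: 'g::complex_lie_algebra set)"
  "cvec.independent (lie_basis :: 'g set)" "cvec.span (lie_basis :: 'g set) = UNIV"
proof -
  obtain B :: "'g set" where B: "finite B" "\<And>x. \<exists>k. x = (\<Sum>b\<in>B. k b *\<^sub>C b)"
    using finite_dimensional by blast
  have "x \<in> cvec.span B" for x
    using B(2)[of x] by (auto intro!: cvec.span_sum cvec.span_scale intro: cvec.span_base)
  moreover obtain C where C: "C \<subseteq> B" "cvec.independent C" "B \<subseteq> cvec.span C"
    using cvec.maximal_independent_subset[of B] by blast
  ultimately have "cvec.span C = UNIV"
    using cvec.span_minimal[OF C(3) cvec.subspace_span] by auto
  then have "\<exists>B :: 'g set. finite B \<and> cvec.independent B \<and> cvec.span B = UNIV"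
    using C B(1) finite_subset by blast
  from someI_ex[OF this] show
    "finite (lie_basis :: 'g set)"
    "cvec.independent (lie_basis :: 'g set)" "cvec.span (lie_basis :: 'g set) = UNIV"
    unfolding lie_basis_def by auto
qed

text \<open>The type \<open>'g mer\<close> is the tensor product over \<open>\<complex>\<close> of the Lie algebra \<open>'g\<close> with the field of
  rational functions; its elements are given by their coordinates with respect to \<open>lie_basis\<close>.
  It serves both for \<open>'g\<close>-valued rational functions and, as coefficient of \<open>dt\<close>, for
  \<open>'g\<close>-valued one-forms.\<close>

typedef (overloaded) 'g mer =
    "{u :: 'g::complex_lie_algebra \<Rightarrow> ratfun. \<forall>b. b \<notin> lie_basis \<longrightarrow> u b = 0}"
  morphisms coord Mer
  by (rule exI[of _ "\<lambda>_. 0"]) simp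

lemma coord_outside: "b \<notin> lie_basis \<Longrightarrow> coord u b = 0"
  using coord[of u] by simp

lemma coord_Mer: "(\<And>b. b \<notin> lie_basis \<Longrightarrow> f b = 0) \<Longrightarrow> coord (Mer f) = f"
  by (simp add: Mer_inverse)

lemma mer_eqI: "(\<And>b. coord u b = coord v b) \<Longrightarrow> u = v"
  by (meson coord_inject ext)

instantiation mer :: (complex_lie_algebra) ab_group_add
begin

definition "0 = Mer (\<lambda>_. 0)"
definition "u + v = Mer (\<lambda>b. coord u b + coord v b)"
definition "- u = Mer (\<lambda>b. - coord u b)"
definition "u - v = Mer (\<lambda>b. coord u b - coord v b)"

lemma coord_simps [simp]:
  "coord (0 :: 'a mer) b = 0" "coord (u + v :: 'a mer) b = coord u b + coord v b"
  "coord (- u :: 'a mer) b = - coord u b" "coord (u - v :: 'a mer) b = coord u b - coord v b"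
  by (simp_all add: zero_mer_def plus_mer_def uminus_mer_def minus_mer_def coord_Mer coord_outside)

instance
  by standard (auto intro!: mer_eqI)

end

definition scaleM :: "ratfun \<Rightarrow> 'g mer \<Rightarrow> 'g::complex_lie_algebra mer" where
  "scaleM f u = Mer (\<lambda>b. f * coord u b)"

lemma coord_scaleM [simp]: "coord (scaleM f u) b = f * coord u b"
  by (simp add: scaleM_def coord_Mer coord_outside)

global_interpretation mvec: vector_space "scaleM :: ratfun \<Rightarrow> 'g mer \<Rightarrow> 'g::complex_lie_algebra mer"
  by unfold_locales (auto intro!: mer_eqI simp: algebra_simps)

definition tensor :: "'g::complex_lie_algebra \<Rightarrow> ratfun \<Rightarrow> 'g mer" (infixr "\<otimes>" 76) where
  "x \<otimes> f = Mer (\<lambda>b. ratconst (cvec.representation lie_basis x b) * f)"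

text \<open>The map \<open>\<phi> \<otimes> \<theta>\<close> for \<open>\<complex>\<close>-linear \<open>\<phi>\<close> and \<open>\<theta>\<close>.\<close>

definition tensor_map ::
    "('g::complex_lie_algebra \<Rightarrow> 'g) \<Rightarrow> (ratfun \<Rightarrow> ratfun) \<Rightarrow> 'g mer \<Rightarrow> 'g mer" where
  "tensor_map \<phi> \<theta> u = (\<Sum>b\<in>lie_basis. \<phi> b \<otimes> \<theta> (coord u b))"

definition bracketM :: "'g mer \<Rightarrow> 'g mer \<Rightarrow> 'g::complex_lie_algebra mer" where
  "bracketM u v = (\<Sum>b\<in>lie_basis. \<Sum>b'\<in>lie_basis. bracket b b' \<otimes> (coord u b * coord v b'))"

text \<open>\<open>\<pp> \<otimes> \<M>\<close> for a subspace \<open>\<pp>\<close>; equivalently, the space \<open>\<Omega>(\<pp>)\<close> of one-forms.\<close>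

definition mer_of :: "'g::complex_lie_algebra set \<Rightarrow> 'g mer set" where
  "mer_of \<pp> = mvec.span ((\<lambda>x. x \<otimes> 1) ` \<pp>)"

definition mer_regular :: "'g::complex_lie_algebra mer \<Rightarrow> complex \<Rightarrow> bool" where
  "mer_regular u z \<longleftrightarrow> (\<forall>b\<in>lie_basis. rat_regular (coord u b) z)"

definition mer_eval :: "complex \<Rightarrow> 'g mer \<Rightarrow> 'g::complex_lie_algebra" where
  "mer_eval z u = (\<Sum>b\<in>lie_basis. rat_eval z (coord u b) *\<^sub>C b)"


section \<open>Groups of rational functions\<close>

definition ad_nilpotent :: "'g::complex_lie_algebra \<Rightarrow> bool" where
  "ad_nilpotent x \<longleftrightarrow> (\<exists>k. bracket x ^^ k = (\<lambda>_. 0))"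

text \<open>The exponential of \<open>ad x\<close> for ad-nilpotent \<open>x\<close>: only finitely many terms are non-zero.\<close>

definition exp_ad :: "'g::complex_lie_algebra \<Rightarrow> 'g \<Rightarrow> 'g" where
  "exp_ad x y = (\<Sum>k | bracket x ^^ k \<noteq> (\<lambda>_. 0). (1 / fact k) *\<^sub>C (bracket x ^^ k) y)"

text \<open>The subgroup of the automorphism group generated by the \<open>exp (ad x)\<close> for ad-nilpotent
  \<open>x \<in> S\<close>, where \<open>S\<close> is a subspace (so that no inverses need to be added, the inverse of
  \<open>exp (ad x)\<close> being \<open>exp (ad (- x))\<close>). For \<open>S = UNIV\<close> and a semisimple Lie algebra this is the
  adjoint group \<open>G\<close>; for \<open>S = \<nn>\<close> it is the unipotent subgroup \<open>N\<close> of \<open>G\<close> with Lie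
  algebra \<open>\<nn>\<close>.\<close>

inductive_set exp_group ::
    "'g::complex_lie_algebra set \<Rightarrow> ('g \<Rightarrow> 'g) set" for S where
  id: "id \<in> exp_group S"
| exp: "x \<in> S \<Longrightarrow> ad_nilpotent x \<Longrightarrow> g \<in> exp_group S \<Longrightarrow> exp_ad x \<circ> g \<in> exp_group S"

text \<open>A rational function with values in the endomorphisms of the Lie algebra is represented by
  the \<open>\<complex>\<close>-linear map sending \<open>x\<close> to the rational function \<open>t \<mapsto> g(t) x\<close>. The following are the
  rational functions with values in the group \<open>K\<close>.\<close>

definition group_mer ::
    "('g::complex_lie_algebra \<Rightarrow> 'g) set \<Rightarrow> ('g \<Rightarrow> 'g mer) set" where
  "group_mer K = {g. Vector_Spaces.linear scaleC (\<lambda>k. scaleM (ratconst k)) g \<and>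
     (\<forall>z. (\<forall>x. mer_regular (g x) z) \<longrightarrow> (\<lambda>x. mer_eval z (g x)) \<in> K)}"

definition group_mer_one :: "'g::complex_lie_algebra \<Rightarrow> 'g mer" where
  "group_mer_one x = x \<otimes> 1"

definition Ad :: "('g::complex_lie_algebra \<Rightarrow> 'g mer) \<Rightarrow> 'g mer \<Rightarrow> 'g mer" where
  "Ad g u = (\<Sum>b\<in>lie_basis. scaleM (coord u b) (g b))"

text \<open>The coefficient of \<open>dt\<close> in \<open>dg g\<^sup>-\<^sup>1\<close>: an element of the adjoint group is an automorphism of
  the Lie algebra, so that \<open>dg g\<^sup>-\<^sup>1\<close> is the element \<open>u\<close> with \<open>ad u \<circ> g = dg/dt\<close>.\<close>

definition right_log_deriv :: "('g::complex_lie_algebra \<Rightarrow> 'g mer) \<Rightarrow> 'g mer" where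
  "right_log_deriv g = (THE u. \<forall>x. bracketM u (g x) = tensor_map id rat_deriv (g x))"

text \<open>A connection \<open>d + A\<close> is represented by the coefficient of \<open>dt\<close> in \<open>A\<close>.\<close>

definition gauge :: "('g::complex_lie_algebra \<Rightarrow> 'g mer) \<Rightarrow> 'g mer \<Rightarrow> 'g mer" where
  "gauge g A = - right_log_deriv g + Ad g A"

definition gauge_free ::
    "('g::complex_lie_algebra \<Rightarrow> 'g mer) set \<Rightarrow> 'g mer set \<Rightarrow> bool" where
  "gauge_free K X \<longleftrightarrow> (\<forall>g\<in>K. \<forall>A\<in>X. gauge g A = A \<longrightarrow> g = group_mer_one)"

definition gauge_rel ::
    "('g::complex_lie_algebra \<Rightarrow> 'g mer) set \<Rightarrow> 'g mer set \<Rightarrow> ('g mer \<times> 'g mer) set" where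
  "gauge_rel K X = {(A, A'). A \<in> X \<and> A' \<in> X \<and> (\<exists>g\<in>K. A' = gauge g A)}"


section \<open>Cyclotomic invariants\<close>

text \<open>The lift of \<open>\<sigma>\<close> to the adjoint group is conjugation by \<open>\<sigma>\<close>, so the transform of \<open>g\<close> is
  \<open>t \<mapsto> \<sigma> \<circ> g(\<omega>\<^sup>-\<^sup>1 t) \<circ> \<sigma>\<^sup>-\<^sup>1\<close>.\<close>

definition twist_group :: "complex \<Rightarrow> ('g::complex_lie_algebra \<Rightarrow> 'g) \<Rightarrow>
    ('g \<Rightarrow> 'g mer) \<Rightarrow> ('g \<Rightarrow> 'g mer)" where
  "twist_group \<omega> \<sigma> g = (\<lambda>x. tensor_map \<sigma> (rat_dilate (inverse \<omega>)) (g (inv \<sigma> x)))"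

definition twist_form :: "complex \<Rightarrow> ('g::complex_lie_algebra \<Rightarrow> 'g) \<Rightarrow> 'g mer \<Rightarrow> 'g mer" where
  "twist_form \<omega> \<sigma> = tensor_map \<sigma> (form_pullback (inverse \<omega>))"

definition group_mer_inv :: "complex \<Rightarrow> ('g::complex_lie_algebra \<Rightarrow> 'g) \<Rightarrow>
    ('g \<Rightarrow> 'g) set \<Rightarrow> ('g \<Rightarrow> 'g mer) set" where
  "group_mer_inv \<omega> \<sigma> K = {g \<in> group_mer K. twist_group \<omega> \<sigma> g = g}"

definition form_inv :: "complex \<Rightarrow> ('g::complex_lie_algebra \<Rightarrow> 'g) \<Rightarrow> 'g set \<Rightarrow> 'g mer set" where
  "form_inv \<omega> \<sigma> \<pp> = {v \<in> mer_of \<pp>. twist_form \<omega> \<sigma> v = v}"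


section \<open>Opers\<close>

definition op_conn :: "'g::complex_lie_algebra \<Rightarrow> 'g set \<Rightarrow> 'g mer set" where
  "op_conn p \<bb> = {p \<otimes> 1 + v | v. v \<in> mer_of \<bb>}"

definition op_conn_cyc :: "complex \<Rightarrow> ('g::complex_lie_algebra \<Rightarrow> 'g) \<Rightarrow> 'g \<Rightarrow> 'g set \<Rightarrow> 'g mer set"
  where "op_conn_cyc \<omega> \<sigma> p \<bb> = {p \<otimes> 1 + v | v. v \<in> form_inv \<omega> \<sigma> \<bb>}"

definition Opers :: "'g::complex_lie_algebra \<Rightarrow> 'g set \<Rightarrow> 'g set \<Rightarrow> 'g mer set set" where
  "Opers p \<bb> \<nn> =
     op_conn p \<bb> // gauge_rel (group_mer (exp_group \<nn>)) (op_conn p \<bb>)"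

definition Opers_cyc :: "complex \<Rightarrow> ('g::complex_lie_algebra \<Rightarrow> 'g) \<Rightarrow>
    'g \<Rightarrow> 'g set \<Rightarrow> 'g set \<Rightarrow> 'g mer set set" where
  "Opers_cyc \<omega> \<sigma> p \<bb> \<nn> = op_conn_cyc \<omega> \<sigma> p \<bb> //
     gauge_rel (group_mer_inv \<omega> \<sigma> (exp_group \<nn>)) (op_conn_cyc \<omega> \<sigma> p \<bb>)"

end

theory Submission
  imports Defs
begin

text \<open>
  The element \<open>rho\<close> grades the Lie algebra, and \<open>p_minus\<close>, \<open>2 rho\<close>, \<open>p_plus\<close> form an
  \<open>sl\<^sub>2\<close>-triple. Since the grading is inner, a unipotent automorphism (one that is the identity
  modulo higher degree) is determined by the image of \<open>rho\<close>, a derivation raising the degree is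
  inner, and \<open>N\<close>, constant or with rational coefficients, is precisely the group of unipotent
  automorphisms. Thus neither the Baker-Campbell-Hausdorff formula nor the structure theory of
  derivations is needed. If a gauge transformation first differs from the identity in degree \<open>k\<close>, by
  \<open>ad Y\<close>, then it changes the connection in degree \<open>k - 1\<close> by \<open>[Y, p_minus]\<close>. By
  \<open>sl\<^sub>2\<close>-theory \<open>ad p_minus\<close> is injective in positive degrees, with image complementary to \<open>\<aa>\<close>;
  degree by degree this gives freeness, uniqueness and existence. The cyclotomic case follows by
  applying the twist to the canonical form and using its uniqueness.
\<close>

section \<open>Filtered Lie algebras and their unipotent automorphisms\<close>

text \<open>Elements of N with rational coefficients are given only through their values at regular
  points, so no logarithm with rational coefficients is at hand. Being unipotent, in contrast,
  consists of identities and of memberships in subspaces, and both can be tested at all but finitely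
  many points. For this reason the scalars below form any field of characteristic zero:
  \<open>filtered_lie\<close> is used over the complex numbers, where it describes N, and over the
  rational functions, where it carries the gauge argument. A filtration on whose k-th quotient
  \<open>rho\<close> acts as k replaces eigenspaces, since every argument compares leading terms.
  The element \<open>rho\<close> also stands in for logarithms: if \<open>\<Phi> rho - rho\<close>
  starts in degree k, then so does \<open>\<Phi>\<close>, and its leading term divided by -k is that
  of the logarithm. The Cartan subalgebra is only known to be nilpotent and self-normalising, so
  that it lies in degrees at least zero has to be derived as well.\<close>

locale filtered_lie = vector_space scale
  for scale :: "'k::field_char_0 \<Rightarrow> 'a::ab_group_add \<Rightarrow> 'a" (infixr "*s" 75) +
  fixes br :: "'a \<Rightarrow> 'a \<Rightarrow> 'a"
    and rho :: 'a and F :: "int \<Rightarrow> 'a set" and m :: nat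
  assumes br_add_left: "br (x + y) z = br x z + br y z"
    and br_add_right: "br x (y + z) = br x y + br x z"
    and br_scale_left: "br (a *s x) y = a *s br x y"
    and br_scale_right: "br x (a *s y) = a *s br x y"
    and br_self: "br x x = 0"
    and br_jacobi: "br x (br y z) + br y (br z x) + br z (br x y) = 0"
    and F_subspace: "subspace (F k)"
    and F_antimono: "k \<le> l \<Longrightarrow> F l \<subseteq> F k"
    and F_low: "F (- int m) = UNIV"
    and F_high: "F (int m + 1) = {0}"
    and F_br: "x \<in> F i \<Longrightarrow> y \<in> F j \<Longrightarrow> br x y \<in> F (i + j)"
    and F_rho: "x \<in> F k \<Longrightarrow> br rho x - of_int k *s x \<in> F (k + 1)"
    and center_trivial: "(\<And>x. br z x = 0) \<Longrightarrow> z = 0"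
begin

lemmas F_add = subspace_add[OF F_subspace]
  and F_diff = subspace_diff[OF F_subspace]
  and F_neg = subspace_neg[OF F_subspace]
  and F_scale = subspace_scale[OF F_subspace]
  and F_zero = subspace_0[OF F_subspace]

lemma F_mono: "x \<in> F l \<Longrightarrow> k \<le> l \<Longrightarrow> x \<in> F k"
  using F_antimono by blast

lemma br_zero_left [simp]: "br 0 x = 0"
  using br_add_left[of 0 0 x] by simp

lemma br_zero_right [simp]: "br x 0 = 0"
  using br_add_right[of x 0 0] by simp

lemma br_minus_left: "br (- x) y = - br x y"
  using br_add_left[of x "- x" y] by (simp add: eq_neg_iff_add_eq_0 add.commute)

lemma br_minus_right: "br x (- y) = - br x y"
  using br_add_right[of x y "- y"] by (simp add: eq_neg_iff_add_eq_0 add.commute)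

lemma br_diff_left: "br (x - y) z = br x z - br y z"
  using br_add_left[of x "- y" z] by (simp add: br_minus_left)

lemma br_diff_right: "br x (y - z) = br x y - br x z"
  using br_add_right[of x y "- z"] by (simp add: br_minus_right)

lemmas br_linear = br_add_left br_add_right br_diff_left br_diff_right
  br_minus_left br_minus_right br_scale_left br_scale_right

lemma br_sum_left: "br (sum f A) y = (\<Sum>a\<in>A. br (f a) y)"
  by (induct A rule: infinite_finite_induct) (simp_all add: br_add_left)

lemma br_sum_right: "br x (sum f A) = (\<Sum>a\<in>A. br x (f a))"
  by (induct A rule: infinite_finite_induct) (simp_all add: br_add_right)

lemma br_anti: "br x y = - br y x"
proof -
  have "br x y + br y x = 0" using br_self[of "x + y"] unfolding br_add_left br_add_right by (simp add: br_self add.commute)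
  then show ?thesis by (simp add: eq_neg_iff_add_eq_0)
qed

lemma br_leibniz: "br x (br y z) = br (br x y) z + br y (br x z)"
  using br_jacobi[of x y z] unfolding br_anti[of "br x y" z] br_anti[of z x]
  by (simp add: br_linear algebra_simps add_eq_0_iff)

lemma linear_I:
  "(\<And>x y. f (x + y) = f x + f y) \<Longrightarrow> (\<And>a x. f (a *s x) = a *s f x) \<Longrightarrow> Vector_Spaces.linear scale scale f"
  by unfold_locales

lemma F_scale_cancel: "a *s x \<in> F k \<Longrightarrow> a \<noteq> 0 \<Longrightarrow> x \<in> F k"
  using F_scale[of "a *s x" k "inverse a"] by simp

lemma F_climb:
  assumes "x \<in> F i" "i \<le> k" "\<And>l. i \<le> l \<Longrightarrow> l < k \<Longrightarrow> x \<in> F l \<Longrightarrow> x \<in> F (l + 1)"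
  shows "x \<in> F k"
proof -
  have "l \<le> k \<Longrightarrow> x \<in> F l" if "i \<le> l" for l
    using that by (induct l rule: int_ge_induct) (auto intro: assms)
  then show ?thesis using assms(2) by blast
qed

lemma F_high': "x \<in> F k \<Longrightarrow> k > int m \<Longrightarrow> x = 0"
  using F_mono[of x k "int m + 1"] F_high by simp

lemma F_low': "k \<le> - int m \<Longrightarrow> x \<in> F k"
  using F_mono[of x "- int m" k] F_low by simp

lemma F_climb_zero:
  assumes "x \<in> F i" "\<And>l. i \<le> l \<Longrightarrow> x \<in> F l \<Longrightarrow> x \<in> F (l + 1)"
  shows "x = 0"
proof -
  \<comment> \<open>The starting degree may already lie beyond the end of the filtration, hence the
    maximum.\<close>
  have "x \<in> F (max i (int m + 1))"
    by (rule F_climb[OF assms(1)]) (simp_all add: assms(2))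
  then show ?thesis by (rule F_high') simp
qed

text \<open>If \<open>rho\<close> acts on the class of x in the k-th quotient both as k and as c,
  then c - k kills that class and is invertible.\<close>

lemma F_step:
  assumes "x \<in> F k" "br rho x - of_int c *s x \<in> F (k + 1)" "c \<noteq> k"
  shows "x \<in> F (k + 1)"
proof -
  have "(of_int c - of_int k) *s x = (br rho x - of_int k *s x) - (br rho x - of_int c *s x)"
    by (simp add: algebra_simps)
  then have "(of_int c - of_int k) *s x \<in> F (k + 1)"
    using F_diff[OF F_rho[OF assms(1)] assms(2)] by simp
  then show ?thesis
    using assms(3) by (rule_tac F_scale_cancel) auto
qed

text \<open>Below degree k the eigenvalue k differs from the one prescribed by the filtration, so x
  climbs from the bottom, where \<open>F\<close> is everything.\<close>

lemma eigen_F: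
  assumes "br rho x = of_int k *s x"
  shows "x \<in> F k"
proof (cases "k \<le> - int m")
  case False
  have "x \<in> F (l + 1)" if "l < k" "x \<in> F l" for l
    by (rule F_step[OF that(2), of k]) (use that(1) in \<open>simp_all add: assms F_zero\<close>)
  moreover have "x \<in> F (- int m)" by (simp add: F_low)
  ultimately show ?thesis using False F_climb[of x "- int m" k] by simp
qed (rule F_low')

lemma rho_F: "rho \<in> F 0"
  by (rule eigen_F) (simp add: br_self)

text \<open>Commutation with \<open>rho\<close> multiplies the part of an operator that raises the
  degree by l by the factor l. If the commutator with \<open>rho\<close> starts only at shift k, the
  parts of \<open>N\<close> with shifts 1 to k - 1 must vanish, and the second claim describes the
  part with shift k.\<close>

lemma raise:
  assumes lin: "Vector_Spaces.linear scale scale N"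
    and one: "\<And>j x. x \<in> F j \<Longrightarrow> N x \<in> F (j + 1)"
    and comm: "\<And>j x. x \<in> F j \<Longrightarrow> N (br rho x) - br rho (N x) \<in> F (j + k)"
    and k: "1 \<le> k" and x: "x \<in> F j"
  shows "N x \<in> F (j + k)"
    and "br rho (N x) - N (br rho x) - of_int k *s N x \<in> F (j + k + 1)"
proof -
  interpret N: Vector_Spaces.linear scale scale N by (fact lin)
  have key: "br rho (N x) - N (br rho x) - of_int l *s N x \<in> F (j + l + 1)"
    if hyp: "\<And>j x. x \<in> F j \<Longrightarrow> N x \<in> F (j + l)" and x: "x \<in> F j" for l j x
  proof -
    have "br rho (N x) - N (br rho x) - of_int l *s N x
        = (br rho (N x) - of_int (j + l) *s N x) - N (br rho x - of_int j *s x)"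
      by (simp add: N.diff N.scale scale_left_distrib)
    moreover have "N (br rho x - of_int j *s x) \<in> F (j + l + 1)"
      using hyp[OF F_rho[OF x]] by (simp add: algebra_simps)
    ultimately show ?thesis using F_diff[OF F_rho[OF hyp[OF x]]] by metis
  qed
  have main: "l \<le> k \<Longrightarrow> \<forall>j. \<forall>x \<in> F j. N x \<in> F (j + l)" if "1 \<le> l" for l
    using that
  proof (induct l rule: int_ge_induct)
    case base
    then show ?case using one by blast
  next
    case (step l)
    show ?case
    proof (intro allI ballI)
      fix j x assume x: "x \<in> F j"
      have 1: "br rho (N x) - N (br rho x) - of_int l *s N x \<in> F (j + l + 1)"
        using step x by (intro key) auto
      have 2: "N (br rho x) - br rho (N x) \<in> F (j + l + 1)"
        using comm[OF x] by (rule F_mono) (use step in simp)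
      have "- (of_int l *s N x) = (br rho (N x) - N (br rho x) - of_int l *s N x)
          + (N (br rho x) - br rho (N x))"
        by simp
      then have "- (of_int l *s N x) \<in> F (j + l + 1)" using F_add[OF 1 2] by simp
      then have "of_int l *s N x \<in> F (j + l + 1)" using F_neg by fastforce
      then show "N x \<in> F (j + (l + 1))"
        using step(1) by (intro F_scale_cancel[of "of_int l" "N x"]) (auto simp: algebra_simps)
    qed
  qed
  from main k show "N x \<in> F (j + k)" using x by auto
  from main k x show "br rho (N x) - N (br rho x) - of_int k *s N x \<in> F (j + k + 1)"
    by (intro key) auto
qed

text \<open>For the principal filtration these are exactly the elements of N, see
  \<open>exp_group_eq\<close>; unlike membership in a generated group, the three conditions can be
  tested pointwise.\<close>

definition unip :: "('a \<Rightarrow> 'a) \<Rightarrow> bool" where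
  "unip \<Phi> \<longleftrightarrow> Vector_Spaces.linear scale scale \<Phi> \<and> (\<forall>x y. \<Phi> (br x y) = br (\<Phi> x) (\<Phi> y)) \<and>
     (\<forall>j. \<forall>x\<in>F j. \<Phi> x - x \<in> F (j + 1))"

lemma unipD:
  assumes "unip \<Phi>"
  shows "Vector_Spaces.linear scale scale \<Phi>" "\<Phi> (br x y) = br (\<Phi> x) (\<Phi> y)"
    "x \<in> F j \<Longrightarrow> \<Phi> x - x \<in> F (j + 1)"
  using assms by (auto simp: unip_def)

lemma unip_F: "unip \<Phi> \<Longrightarrow> x \<in> F j \<Longrightarrow> \<Phi> x \<in> F j"
  using F_add[of "\<Phi> x - x" j x] F_mono[OF unipD(3), of \<Phi> x j j] by simp

lemma unip_add: "unip \<Phi> \<Longrightarrow> \<Phi> (x + y) = \<Phi> x + \<Phi> y"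
  and unip_scale: "unip \<Phi> \<Longrightarrow> \<Phi> (a *s x) = a *s \<Phi> x"
  and unip_diff: "unip \<Phi> \<Longrightarrow> \<Phi> (x - y) = \<Phi> x - \<Phi> y"
  and unip_zero: "unip \<Phi> \<Longrightarrow> \<Phi> 0 = 0"
proof -
  assume "unip \<Phi>"
  then interpret L: Vector_Spaces.linear scale scale \<Phi> by (rule unipD)
  show "\<Phi> (x + y) = \<Phi> x + \<Phi> y" "\<Phi> (a *s x) = a *s \<Phi> x" "\<Phi> (x - y) = \<Phi> x - \<Phi> y" "\<Phi> 0 = 0"
    by (rule L.add L.scale L.diff L.zero)+
qed

lemma unip_id: "unip id"
  by (simp add: unip_def F_zero module_hom_id)

lemma unip_comp:
  assumes "unip \<Phi>" "unip \<Psi>"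
  shows "unip (\<Phi> \<circ> \<Psi>)"
  unfolding unip_def
proof (intro conjI allI ballI)
  show "Vector_Spaces.linear scale scale (\<Phi> \<circ> \<Psi>)"
    using assms by (intro linear_I) (simp_all add: unip_add unip_scale)
  show "(\<Phi> \<circ> \<Psi>) (br x y) = br ((\<Phi> \<circ> \<Psi>) x) ((\<Phi> \<circ> \<Psi>) y)" for x y
    using assms by (simp add: unipD(2))
  show "(\<Phi> \<circ> \<Psi>) x - x \<in> F (j + 1)" if "x \<in> F j" for j x
    using F_add[OF unipD(3)[OF assms(1) unip_F[OF assms(2) that]] unipD(3)[OF assms(2) that]]
    by simp
qed

lemma unip_bij:
  assumes "unip \<Phi>"
  shows "inj \<Phi>" "y \<in> F j \<Longrightarrow> \<exists>x\<in>F j. \<Phi> x = y" "bij \<Phi>"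
proof -
  interpret L: Vector_Spaces.linear scale scale \<Phi> using assms by (rule unipD)
  show inj: "inj \<Phi>"
    unfolding L.inj_iff_eq_0
  proof (intro allI impI)
    fix x assume "\<Phi> x = 0"
    \<comment> \<open>Here x is minus \<open>\<Phi> x - x\<close>, which lies one degree
      higher.\<close>
    then have "x \<in> F (l + 1)" if "x \<in> F l" for l
      using F_neg[OF unipD(3)[OF assms that]] by simp
    moreover have "x \<in> F (- int m)" by (simp add: F_low)
    ultimately show "x = 0" by (rule_tac F_climb_zero)
  qed
  have surj: "\<forall>y \<in> F j. \<exists>x\<in>F j. \<Phi> x = y" if "j \<le> int m + 1" for j
    using that
  proof (induct j rule: int_le_induct)
    case base
    then show ?case by (simp add: F_high)
  next
    case (step j)
    show ?case
    proof
      fix y assume y: "y \<in> F (j - 1)"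
      \<comment> \<open>The defect of y has higher degree, so it already has a preimage; subtracting
        that preimage from y corrects y.\<close>
      from unipD(3)[OF assms y] step obtain x where x: "x \<in> F j" "\<Phi> x = \<Phi> y - y" by auto
      then have "\<Phi> (y - x) = y" by (simp add: L.diff)
      moreover have "y - x \<in> F (j - 1)" using y x by (intro F_diff) (auto intro: F_mono)
      ultimately show "\<exists>x\<in>F (j - 1). \<Phi> x = y" by blast
    qed
  qed
  show surj': "\<exists>x\<in>F j. \<Phi> x = y" if "y \<in> F j" for y j
  proof (cases "j \<le> int m + 1")
    case False
    then have "y = 0" using that F_high' by auto
    then show ?thesis using F_zero by (intro bexI[of _ 0]) auto
  qed (use surj that in blast)
  show "bij \<Phi>"
  proof -
    have "\<exists>x. \<Phi> x = y" for y using surj'[of y "- int m"] F_low by auto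
    then show ?thesis unfolding bij_def surj_def using inj by metis
  qed
qed

lemma unip_inv:
  assumes "unip \<Phi>"
  shows "unip (inv \<Phi>)"
  unfolding unip_def
proof (intro conjI allI ballI)
  note b = unip_bij(3)[OF assms]
  note simps = surj_f_inv_f[OF bij_is_surj[OF b]] inv_f_f[OF bij_is_inj[OF b]]
  show "Vector_Spaces.linear scale scale (inv \<Phi>)"
  proof (rule linear_I)
    show "inv \<Phi> (x + y) = inv \<Phi> x + inv \<Phi> y" for x y by (metis simps unip_add[OF assms])
    show "inv \<Phi> (a *s x) = a *s inv \<Phi> x" for a x by (metis simps unip_scale[OF assms])
  qed
  show "inv \<Phi> (br x y) = br (inv \<Phi> x) (inv \<Phi> y)" for x y
    by (metis simps unipD(2)[OF assms])
  show "inv \<Phi> y - y \<in> F (j + 1)" if "y \<in> F j" for j y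
  proof -
    from unip_bij(2)[OF assms that] obtain x where x: "x \<in> F j" "\<Phi> x = y" by blast
    from F_neg[OF unipD(3)[OF assms x(1)]] show ?thesis using x(2) simps by auto
  qed
qed

text \<open>Because \<open>\<Phi>\<close> respects brackets, the commutator of
  \<open>\<Phi> - id\<close> with ad \<open>rho\<close> is ad of \<open>\<Phi> rho - rho\<close>,
  composed with \<open>\<Phi>\<close>. Hence \<open>raise\<close> transfers the order of
  \<open>\<Phi> rho - rho\<close> to \<open>\<Phi>\<close> itself.\<close>

lemma unip_order:
  assumes \<Phi>: "unip \<Phi>" and r: "\<Phi> rho - rho \<in> F k" and k: "1 \<le> k" and x: "x \<in> F j"
  shows "\<Phi> x - x \<in> F (j + k)"
    and "of_int k *s (\<Phi> x - x) + br (\<Phi> rho - rho) x \<in> F (j + k + 1)"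
proof -
  define N where "N = (\<lambda>x. \<Phi> x - x)"
  have N: "Vector_Spaces.linear scale scale N"
    unfolding N_def by (intro linear_I) (simp_all add: unip_add[OF \<Phi>] unip_scale[OF \<Phi>] scale_right_diff_distrib)
  have comm: "N (br rho x) - br rho (N x) = br (\<Phi> rho - rho) (\<Phi> x)" for x
    by (simp add: N_def unipD(2)[OF \<Phi>] br_linear)
  have *: "N (br rho x) - br rho (N x) \<in> F (j + k)" if "x \<in> F j" for j x
    using F_br[OF r unip_F[OF \<Phi> that]] comm by (simp add: add.commute)
  note raise = raise[OF N _ * k, OF _ _ x]
  show 1: "\<Phi> x - x \<in> F (j + k)"
    using raise(1) unipD(3)[OF \<Phi>] by (simp add: N_def)
  have 2: "br rho (N x) - N (br rho x) - of_int k *s N x \<in> F (j + k + 1)"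
    using raise(2) unipD(3)[OF \<Phi>] by (simp add: N_def)
  have 3: "br (\<Phi> rho - rho) (\<Phi> x - x) \<in> F (j + k + 1)"
    using F_br[OF r unipD(3)[OF \<Phi> x]] by (simp add: algebra_simps)
  have "of_int k *s (\<Phi> x - x) + br (\<Phi> rho - rho) x
      = - (br rho (N x) - N (br rho x) - of_int k *s N x) - br (\<Phi> rho - rho) (\<Phi> x - x)"
    using comm[of x] by (simp add: br_linear N_def algebra_simps)
  then show "of_int k *s (\<Phi> x - x) + br (\<Phi> rho - rho) x \<in> F (j + k + 1)"
    using F_diff[OF F_neg[OF 2] 3] by simp
qed

lemma unip_eq_id:
  assumes \<Phi>: "unip \<Phi>" and "\<Phi> rho = rho"
  shows "\<Phi> = id"
proof
  fix x
  \<comment> \<open>A shift by 2m + 1 carries the lowest degree -m beyond the highest degree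
    m.\<close>
  have "\<Phi> x - x \<in> F (- int m + (2 * int m + 1))"
    by (rule unip_order(1)[OF \<Phi>]) (auto simp: assms F_zero F_low)
  then show "\<Phi> x = id x" using F_high' by fastforce
qed

section \<open>Exponentials of elements of positive degree\<close>

definition dexp :: "'a \<Rightarrow> nat \<Rightarrow> 'a \<Rightarrow> 'a" where
  "dexp Y n x = (1 / fact n) *s (br Y ^^ n) x"

text \<open>Degrees run from -m to m and ad \<open>Y\<close> raises them by at least one for
  \<open>Y\<close> in \<open>F 1\<close>, so the divided powers beyond 2m vanish.\<close>

definition expo :: "'a \<Rightarrow> 'a \<Rightarrow> 'a" where
  "expo Y x = (\<Sum>n\<le>2 * m. dexp Y n x)"

lemma dexp_0 [simp]: "dexp Y 0 x = x"
  by (simp add: dexp_def)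

lemma dexp_Suc: "of_nat (Suc n) *s dexp Y (Suc n) x = br Y (dexp Y n x)"
proof -
  have "(of_nat (Suc n) :: 'k) * (1 / fact (Suc n)) = 1 / fact n"
    by (simp add: field_simps del: of_nat_Suc)
  then show ?thesis by (simp add: dexp_def br_scale_right del: of_nat_Suc fact_Suc)
qed

lemma dexp_add: "dexp Y n (x + y) = dexp Y n x + dexp Y n y"
  and dexp_scale: "dexp Y n (a *s x) = a *s dexp Y n x"
proof -
  have "(br Y ^^ n) (x + y) = (br Y ^^ n) x + (br Y ^^ n) y"
    "(br Y ^^ n) (a *s x) = a *s (br Y ^^ n) x"
    by (induct n) (simp_all add: br_linear)
  then show "dexp Y n (x + y) = dexp Y n x + dexp Y n y" "dexp Y n (a *s x) = a *s dexp Y n x"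
    by (simp_all add: dexp_def scale_right_distrib mult.commute)
qed

lemma dexp_zero: "dexp Y n 0 = 0"
  using dexp_add[of Y n 0 0] by simp

lemma dexp_sum: "dexp Y n (sum g A) = (\<Sum>a\<in>A. dexp Y n (g a))"
  by (induct A rule: infinite_finite_induct) (simp_all add: dexp_add dexp_zero)

lemma linear_expo: "Vector_Spaces.linear scale scale (expo Y)"
  unfolding expo_def
  by (rule linear_I) (simp_all add: dexp_add dexp_scale sum.distrib scale_sum_right)

lemma dexp_F: "Y \<in> F k \<Longrightarrow> x \<in> F j \<Longrightarrow> dexp Y n x \<in> F (j + int n * k)"
proof -
  assume "Y \<in> F k" "x \<in> F j"
  then have "(br Y ^^ n) x \<in> F (j + int n * k)"
  proof (induct n)
    case (Suc n)
    from F_br[OF Suc(2) Suc(1)[OF Suc(2,3)]] show ?case by (simp add: algebra_simps)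
  qed simp
  then show ?thesis unfolding dexp_def by (rule F_scale)
qed

lemma dexp_high: "Y \<in> F 1 \<Longrightarrow> 2 * m < n \<Longrightarrow> dexp Y n x = 0"
  using dexp_F[of Y 1 x "- int m" n] F_high' by (fastforce simp: F_low)

text \<open>In the induction step, multiplied by n + 1, the terms where ad \<open>Y\<close> hits the
  left factor and those where it hits the right one are collected by the resulting left order i.
  They then carry the weights i and n + 1 - i, which add up to n + 1.\<close>

lemma dexp_br: "dexp Y n (br x y) = (\<Sum>i\<le>n. br (dexp Y i x) (dexp Y (n - i) y))"
proof (induct n)
  case (Suc n)
  let ?f = "\<lambda>i. br (dexp Y i x) (dexp Y (Suc n - i) y)"
  have "of_nat (Suc n) *s dexp Y (Suc n) (br x y)
      = (\<Sum>i\<le>n. br (br Y (dexp Y i x)) (dexp Y (n - i) y) + br (dexp Y i x) (br Y (dexp Y (n - i) y)))"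
    unfolding dexp_Suc Suc by (simp add: br_sum_right br_leibniz[of Y])
  also have "\<dots> = (\<Sum>i\<le>n. of_nat (Suc i) *s ?f (Suc i)) + (\<Sum>i\<le>n. of_nat (Suc n - i) *s ?f i)"
    unfolding sum.distrib
    by (intro arg_cong2[of _ _ _ _ "(+)"] sum.cong refl)
       (simp_all only: dexp_Suc[symmetric] br_linear Suc_diff_le atMost_iff diff_Suc_Suc)
  also have "(\<Sum>i\<le>n. of_nat (Suc i) *s ?f (Suc i)) = (\<Sum>i\<le>Suc n. of_nat i *s ?f i)"
    unfolding sum.atMost_Suc_shift by simp
  also have "(\<Sum>i\<le>n. of_nat (Suc n - i) *s ?f i) = (\<Sum>i\<le>Suc n. of_nat (Suc n - i) *s ?f i)"
    by simp
  also have "(\<Sum>i\<le>Suc n. of_nat i *s ?f i) + (\<Sum>i\<le>Suc n. of_nat (Suc n - i) *s ?f i)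
      = of_nat (Suc n) *s (\<Sum>i\<le>Suc n. ?f i)"
    unfolding sum.distrib[symmetric] scale_sum_right scale_left_distrib[symmetric] of_nat_add[symmetric]
    by (intro sum.cong refl) (simp del: of_nat_Suc)
  finally show ?case by (simp del: of_nat_Suc)
qed simp

text \<open>A Cauchy product of truncated series. The bound 4m makes the triangle of index pairs
  contain the square of side 2m, and a pair outside the square has an index above 2m, hence a
  vanishing factor.\<close>

lemma expo_br:
  assumes Y: "Y \<in> F 1"
  shows "expo Y (br x y) = br (expo Y x) (expo Y y)"
proof -
  let ?f = "\<lambda>i j. br (dexp Y i x) (dexp Y j y)"
  have "expo Y (br x y) = (\<Sum>n\<le>4 * m. dexp Y n (br x y))"
    unfolding expo_def by (rule sum.mono_neutral_left) (auto intro: dexp_high[OF Y])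
  also have "\<dots> = (\<Sum>(i, j)\<in>{(i, j). i + j \<le> 4 * m}. ?f i j)"
    by (simp add: dexp_br sum.triangle_reindex_eq)
  also have "\<dots> = (\<Sum>(i, j)\<in>{..2 * m} \<times> {..2 * m}. ?f i j)"
  proof (rule sum.mono_neutral_right)
    show "finite {(i, j). i + j \<le> 4 * m}"
      by (rule finite_subset[of _ "{..4 * m} \<times> {..4 * m}"]) auto
    show "\<forall>p\<in>{(i, j). i + j \<le> 4 * m} - {..2 * m} \<times> {..2 * m}. (case p of (i, j) \<Rightarrow> ?f i j) = 0"
    proof
      fix p assume "p \<in> {(i, j). i + j \<le> 4 * m} - {..2 * m} \<times> {..2 * m}"
      then have "2 * m < fst p \<or> 2 * m < snd p" by (cases p) auto
      then show "(case p of (i, j) \<Rightarrow> ?f i j) = 0"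
        by (cases p) (auto simp: dexp_high[OF Y])
    qed
  qed auto
  also have "\<dots> = br (expo Y x) (expo Y y)"
    unfolding expo_def br_sum_left unfolding br_sum_right by (simp add: sum.cartesian_product)
  finally show ?thesis .
qed

lemma expo_order:
  assumes "Y \<in> F k" "1 \<le> k" "x \<in> F j"
  shows "expo Y x - x - br Y x \<in> F (j + 2 * k)"
proof -
  have Y: "Y \<in> F 1" using assms F_mono by blast
  \<comment> \<open>The extra zero term makes the index 1 occur even for m = 0.\<close>
  have "expo Y x = (\<Sum>n\<le>2 * m + 1. dexp Y n x)"
    unfolding expo_def by (rule sum.mono_neutral_left) (auto intro: dexp_high[OF Y])
  also have "\<dots> = x + br Y x + (\<Sum>n=2..2 * m + 1. dexp Y n x)"
  proof -
    have "{..2 * m + 1} = insert 0 (insert 1 {2..2 * m + 1})" by auto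
    then show ?thesis using dexp_Suc[of 0 Y x] by (simp add: add.assoc)
  qed
  finally have "expo Y x - x - br Y x = (\<Sum>n=2..2 * m + 1. dexp Y n x)" by simp
  also have "\<dots> \<in> F (j + 2 * k)"
    using assms by (intro subspace_sum F_subspace F_mono[OF dexp_F]) (auto intro: mult_right_mono)
  finally show ?thesis .
qed

lemma unip_expo:
  assumes Y: "Y \<in> F 1"
  shows "unip (expo Y)"
  unfolding unip_def
proof (intro conjI allI ballI linear_expo expo_br[OF Y])
  fix j x assume x: "x \<in> F j"
  have "expo Y x - x - br Y x \<in> F (j + 1)"
    by (rule F_mono[OF expo_order[OF Y _ x]]) auto
  moreover have "br Y x \<in> F (j + 1)" using F_br[OF Y x] by (simp add: add.commute)
  ultimately show "expo Y x - x \<in> F (j + 1)" using F_add by fastforce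
qed

lemma dexp_dexp: "dexp Y i (dexp Y j x) = of_nat ((i + j) choose i) *s dexp Y (i + j) x"
proof -
  have pow: "(br Y ^^ i) (a *s x) = a *s (br Y ^^ i) x" for a x
    by (induct i) (simp_all add: br_linear)
  have "(1 / fact i * (1 / fact j) :: 'k) = of_nat ((i + j) choose i) * (1 / fact (i + j))"
    using binomial_fact[of i "i + j", where ?'a = 'k] by simp
  then show ?thesis by (simp add: dexp_def pow funpow_add)
qed

lemma dexp_minus: "dexp (- Y) n x = (- 1) ^ n *s dexp Y n x"
proof -
  have "(br (- Y) ^^ n) x = (- 1) ^ n *s (br Y ^^ n) x" by (induct n) (simp_all add: br_linear)
  then show ?thesis by (simp add: dexp_def mult.commute)
qed

text \<open>In the product of the two series the divided power of order n has as coefficient the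
  alternating sum of the binomial coefficients of n, which vanishes except for n = 0.\<close>

lemma expo_minus:
  assumes Y: "Y \<in> F 1"
  shows "expo (- Y) (expo Y x) = x"
proof -
  let ?f = "\<lambda>i j. dexp (- Y) i (dexp Y j x)"
  note Y' = F_neg[OF Y]
  have "expo (- Y) (expo Y x) = (\<Sum>(i, j)\<in>{..2 * m} \<times> {..2 * m}. ?f i j)"
    by (simp add: expo_def dexp_sum sum.cartesian_product)
  also have "\<dots> = (\<Sum>(i, j)\<in>{(i, j). i + j \<le> 4 * m}. ?f i j)"
  proof (rule sum.mono_neutral_left)
    show "finite {(i, j). i + j \<le> 4 * m}"
      by (rule finite_subset[of _ "{..4 * m} \<times> {..4 * m}"]) auto
    show "\<forall>p\<in>{(i, j). i + j \<le> 4 * m} - {..2 * m} \<times> {..2 * m}. (case p of (i, j) \<Rightarrow> ?f i j) = 0"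
    proof
      fix p assume "p \<in> {(i, j). i + j \<le> 4 * m} - {..2 * m} \<times> {..2 * m}"
      then have "2 * m < fst p \<or> 2 * m < snd p" by (cases p) auto
      then show "(case p of (i, j) \<Rightarrow> ?f i j) = 0"
        by (cases p) (auto simp: dexp_high[OF Y] dexp_high[OF Y'] dexp_zero)
    qed
  qed auto
  also have "\<dots> = (\<Sum>n\<le>4 * m. \<Sum>i\<le>n. ?f i (n - i))"
    by (simp add: sum.triangle_reindex_eq)
  also have "\<dots> = (\<Sum>n\<le>4 * m. (\<Sum>i\<le>n. (- 1) ^ i * of_nat (n choose i)) *s dexp Y n x)"
    by (intro sum.cong refl) (simp add: dexp_minus dexp_dexp scale_sum_left)
  also have "\<dots> = (\<Sum>n\<in>{0}. (\<Sum>i\<le>n. (- 1) ^ i * of_nat (n choose i)) *s dexp Y n x)"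
    by (rule sum.mono_neutral_right) (auto simp: choose_alternating_sum)
  finally show ?thesis by simp
qed

end

section \<open>Gauge transformations over a filtered Lie algebra\<close>

text \<open>An sl2-triple up to higher order: [e, p] is exact, while the relations of
  \<open>rho\<close> with \<open>e\<close> and \<open>p\<close> are prescribed only modulo the
  filtration.\<close>

locale sl2_filtered_lie = filtered_lie +
  fixes p e :: 'b
  assumes p_F: "p \<in> F (- 1)" and e_F: "e \<in> F 1" and e_p: "br e p = 2 *s rho"
begin

lemma p_e: "br p (br e x) = br e (br p x) - 2 *s br rho x"
  using br_leibniz[of e p x] by (simp add: e_p br_linear)

text \<open>Even the composite of ad p and ad e is injective on the quotients of positive degree.
  Let \<open>Z i\<close> be the i-fold image of \<open>Y\<close> under ad e. Moving p past i + 1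
  copies of e turns \<open>Z (i + 1)\<close> into \<open>- c i\<close> times \<open>Z i\<close>
  modulo higher degree, with \<open>c i\<close> positive. So vanishing of a leading term descends
  from \<open>Z n\<close> to \<open>Y\<close>, and \<open>Z n\<close> is zero once its degree
  exceeds m.\<close>

lemma sl2_inj:
  assumes Y: "Y \<in> F k" and k: "1 \<le> k" and eY: "br e (br p Y) \<in> F (k + 1)"
  shows "Y \<in> F (k + 1)"
proof -
  define Z where "Z = (\<lambda>i. (br e ^^ i) Y)"
  \<comment> \<open>The summand 2(k + b) is the eigenvalue of 2 \<open>rho\<close> on the leading
    term of \<open>Z b\<close>, picked up when p passes one e.\<close>
  define c where "c = (\<lambda>i. \<Sum>b\<le>i. 2 * (k + int b))"
  have Z: "Z i \<in> F (k + int i)" for i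
  proof (induct i)
    case (Suc i)
    then show ?case using F_br[OF e_F Suc] by (simp add: Z_def algebra_simps)
  qed (simp add: Z_def Y)
  have h: "2 *s (br rho (Z i) - of_int (k + int i) *s Z i) \<in> F (k + int i + 1)" for i
    by (intro F_scale F_rho Z)
  have c: "br p (Z (Suc i)) + of_int (c i) *s Z i \<in> F (k + int i + 1)" for i
  proof (induct i)
    case 0
    have "br p (Z (Suc 0)) + of_int (c 0) *s Z 0
        = br e (br p Y) - 2 *s (br rho (Z 0) - of_int (k + int 0) *s Z 0)"
      by (simp add: Z_def c_def p_e scale_right_diff_distrib)
    then show ?case using F_diff[OF eY] h[of 0] by (simp del: of_int_add)
  next
    case (Suc i)
    have "br p (Z (Suc (Suc i))) + of_int (c (Suc i)) *s Z (Suc i)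
        = br e (br p (Z (Suc i)) + of_int (c i) *s Z i)
          - 2 *s (br rho (Z (Suc i)) - of_int (k + int (Suc i)) *s Z (Suc i))"
      by (simp add: Z_def c_def p_e br_linear scale_right_diff_distrib scale_left_distrib
          scale_right_distrib algebra_simps)
    moreover have "br e (br p (Z (Suc i)) + of_int (c i) *s Z i) \<in> F (k + int (Suc i) + 1)"
      using F_br[OF e_F Suc] by (simp add: algebra_simps)
    ultimately show ?case using F_diff h[of "Suc i"] by metis
  qed
  have "Z n \<in> F (k + int n + 1) \<Longrightarrow> Z 0 \<in> F (k + 1)" for n
  proof (induct n)
    case (Suc n)
    have "c n > 0" using k by (simp add: c_def sum_pos)
    have "br p (Z (Suc n)) \<in> F (k + int n + 1)"
      using F_br[OF p_F Suc(2)] by (simp add: algebra_simps)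
    from F_diff[OF c[of n] this] have "of_int (c n) *s Z n \<in> F (k + int n + 1)" by simp
    then have "Z n \<in> F (k + int n + 1)" by (rule F_scale_cancel) (use \<open>c n > 0\<close> in simp)
    then show ?case by (rule Suc)
  qed simp
  moreover have "Z (m + 1) \<in> F (k + int (m + 1) + 1)"
    using F_high'[OF Z[of "m + 1"]] k by (simp add: F_zero)
  ultimately have "Z 0 \<in> F (k + 1)" by blast
  then show ?thesis by (simp add: Z_def)
qed

lemma sl2_inj_zero:
  assumes "Y \<in> F 1" and "br e (br p Y) = 0"
  shows "Y = 0"
  by (rule F_climb_zero[OF assms(1)]) (simp add: sl2_inj assms(2) F_zero)

end

text \<open>\<open>D\<close> stands for differentiation of coefficients, semilinear over the
  derivation \<open>d\<close> of the scalars. The assumption \<open>a_decomp\<close> is the spanning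
  half of the complement property; the sum is direct by \<open>sl2_inj_zero\<close> and
  \<open>a_e\<close>.\<close>

locale oper_setting = sl2_filtered_lie +
  fixes \<aa> :: "'b set" and D :: "'b \<Rightarrow> 'b" and d :: "'a \<Rightarrow> 'a"
  assumes a_F: "\<aa> \<subseteq> F 0" and a_subspace: "subspace \<aa>"
    and a_e: "x \<in> \<aa> \<Longrightarrow> br e x = 0"
    and a_decomp: "1 \<le> k \<Longrightarrow> x \<in> F (k - 1) \<Longrightarrow> \<exists>a\<in>\<aa>. \<exists>Y\<in>F k. x = a + br p Y"
    and D_add: "D (x + y) = D x + D y"
    and D_scale: "D (f *s x) = d f *s x + f *s D x"
    and D_br: "D (br x y) = br (D x) y + br x (D y)"
    and D_F: "x \<in> F k \<Longrightarrow> D x \<in> F k"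
    and D_rho: "D rho = 0"
begin

lemma D_diff: "D (x - y) = D x - D y"
  using D_add[of "x - y" y] by simp

text \<open>In positive degrees the eigenvalues of \<open>rho\<close> are nonzero, so the equation
  is solved in leading degree by division and the error is handed on to the next degree.\<close>

lemma rho_solve:
  assumes "y \<in> F k" "1 \<le> k"
  shows "\<exists>u\<in>F k. br rho u = y"
proof -
  have "1 \<le> k \<Longrightarrow> \<forall>y\<in>F k. \<exists>u\<in>F k. br rho u = y" if "k \<le> int m + 1" for k
    using that
  proof (induct k rule: int_le_induct)
    case base
    then show ?case by (simp add: F_high)
  next
    case (step k)
    show ?case
    proof
      fix y assume y: "y \<in> F (k - 1)"
      define u where "u = (1 / of_int (k - 1)) *s y"
      have u: "u \<in> F (k - 1)" unfolding u_def by (intro F_scale y)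
      have "y = of_int (k - 1) *s u" using step by (simp add: u_def)
      then have "y - br rho u \<in> F k" using F_neg[OF F_rho[OF u]] by simp
      with step obtain w where w: "w \<in> F k" "br rho w = y - br rho u" by auto
      then have "br rho (u + w) = y" by (simp add: br_linear)
      moreover have "u + w \<in> F (k - 1)" using u F_mono[OF w(1)] by (intro F_add) auto
      ultimately show "\<exists>u\<in>F (k - 1). br rho u = y" by blast
    qed
  qed
  note * = this
  show ?thesis
  proof (cases "k \<le> int m + 1")
    case False
    then have "y = 0" using assms F_high' by auto
    then show ?thesis using F_zero by (intro bexI[of _ 0]) auto
  qed (use * assms in blast)
qed

text \<open>Solving [u, rho] = \<open>\<delta> rho\<close> makes \<open>\<delta>\<close> - ad u
  commute with ad \<open>rho\<close>. As it also raises the degree, \<open>raise\<close> applies to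
  it with k as large as desired and shows that it vanishes.\<close>

lemma inner_derivation:
  assumes add: "\<And>x y. \<delta> (x + y) = \<delta> x + \<delta> y" and scale: "\<And>f x. \<delta> (f *s x) = f *s \<delta> x"
    and br: "\<And>x y. \<delta> (br x y) = br (\<delta> x) y + br x (\<delta> y)"
    and F: "\<And>x k. x \<in> F k \<Longrightarrow> \<delta> x \<in> F (k + 1)"
  shows "\<exists>u\<in>F 1. \<forall>x. \<delta> x = br u x"
proof -
  have "\<delta> rho \<in> F 1" using F[OF rho_F] by simp
  from rho_solve[OF this] obtain w where w: "w \<in> F 1" "br rho w = \<delta> rho" by auto
  define u where "u = - w"
  have u: "u \<in> F 1" "br u rho = \<delta> rho"
    using w F_neg br_anti[of rho w] by (auto simp: u_def br_linear)
  define N where "N = (\<lambda>x. \<delta> x - br u x)"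
  have lin: "Vector_Spaces.linear scale scale N"
    by (rule linear_I) (simp_all add: N_def add assms(2) br_linear scale_right_diff_distrib)
  have 1: "N x \<in> F (j + 1)" if "x \<in> F j" for j x
    unfolding N_def using F[OF that] F_br[OF u(1) that] by (intro F_diff) (auto simp: add.commute)
  have 2: "N (br rho x) - br rho (N x) = 0" for x
    using br_leibniz[of u rho x] by (simp add: N_def br u br_linear)
  have "N x = 0" for x
  proof -
    have "N x \<in> F (- int m + (2 * int m + 1))"
      by (rule raise(1)[OF lin]) (auto simp: 1 2 F_zero F_low)
    then show ?thesis by (rule F_high') simp
  qed
  then show ?thesis using u(1) by (auto simp: N_def)
qed

section \<open>Logarithmic derivatives and gauge transformations\<close>

definition log_deriv :: "('b \<Rightarrow> 'b) \<Rightarrow> 'b \<Rightarrow> bool" where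
  "log_deriv \<Phi> u \<longleftrightarrow> (\<forall>y. br u (\<Phi> y) = D (\<Phi> y) - \<Phi> (D y))"

text \<open>The intertwining relation says that \<open>\<Phi>\<close> conjugates the covariant derivative \<open>D + ad A\<close> into
  \<open>D + ad A'\<close>; in this form compositions and inverses of gauge transformations are immediate.\<close>

definition gauged :: "('b \<Rightarrow> 'b) \<Rightarrow> 'b \<Rightarrow> 'b \<Rightarrow> bool" where
  "gauged \<Phi> A A' \<longleftrightarrow> (\<forall>y. D (\<Phi> y) + br A' (\<Phi> y) = \<Phi> (D y + br A y))"

lemma unip_inv_simps:
  assumes "unip \<Phi>"
  shows "\<Phi> (inv \<Phi> x) = x" "inv \<Phi> (\<Phi> x) = x"
  using unip_bij(3)[OF assms] by (auto simp: bij_is_surj surj_f_inv_f bij_is_inj inv_f_f)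

text \<open>D and its conjugate by \<open>\<Phi>\<close> differ by an operator in which the
  derivatives of scalars cancel, so it is a linear derivation. It raises the degree because
  \<open>\<Phi>\<close> is the identity modulo higher degree; hence it is inner.\<close>

lemma log_deriv_exists:
  assumes \<Phi>: "unip \<Phi>"
  shows "\<exists>u\<in>F 1. log_deriv \<Phi> u"
proof -
  note \<Psi> = unip_inv[OF \<Phi>]
  note inv = unip_inv_simps[OF \<Phi>]
  have "\<exists>u\<in>F 1. \<forall>y. D y - \<Phi> (D (inv \<Phi> y)) = br u y"
  proof (rule inner_derivation)
    fix x y f k
    show "D (x + y) - \<Phi> (D (inv \<Phi> (x + y)))
        = (D x - \<Phi> (D (inv \<Phi> x))) + (D y - \<Phi> (D (inv \<Phi> y)))"
      by (simp add: D_add unip_add[OF \<Phi>] unip_add[OF \<Psi>])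
    show "D (f *s x) - \<Phi> (D (inv \<Phi> (f *s x))) = f *s (D x - \<Phi> (D (inv \<Phi> x)))"
      by (simp add: D_scale unip_add[OF \<Phi>] unip_scale[OF \<Phi>] unip_scale[OF \<Psi>] inv
          scale_right_diff_distrib)
    show "D (br x y) - \<Phi> (D (inv \<Phi> (br x y)))
        = br (D x - \<Phi> (D (inv \<Phi> x))) y + br x (D y - \<Phi> (D (inv \<Phi> y)))"
      by (simp add: D_br unipD(2)[OF \<Phi>] unipD(2)[OF \<Psi>] unip_add[OF \<Phi>] inv br_linear)
    assume x: "x \<in> F k"
    have "D x - \<Phi> (D (inv \<Phi> x)) = - D (inv \<Phi> x - x) - (\<Phi> (D (inv \<Phi> x)) - D (inv \<Phi> x))"
      by (simp add: D_diff)
    moreover have "D (inv \<Phi> x - x) \<in> F (k + 1)" by (intro D_F unipD(3)[OF \<Psi> x])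
    moreover have "\<Phi> (D (inv \<Phi> x)) - D (inv \<Phi> x) \<in> F (k + 1)"
      by (intro unipD(3)[OF \<Phi>] D_F unip_F[OF \<Psi>] x)
    ultimately show "D x - \<Phi> (D (inv \<Phi> x)) \<in> F (k + 1)"
      using F_diff F_neg by metis
  qed
  then obtain u where u: "u \<in> F 1" "\<And>y. D y - \<Phi> (D (inv \<Phi> y)) = br u y" by blast
  have "br u (\<Phi> y) = D (\<Phi> y) - \<Phi> (D y)" for y using u(2)[of "\<Phi> y"] by (simp add: inv)
  with u(1) show ?thesis by (auto simp: log_deriv_def)
qed

lemma log_deriv_unique:
  assumes \<Phi>: "unip \<Phi>" and "log_deriv \<Phi> u" "log_deriv \<Phi> u'"
  shows "u = u'"
proof -
  have "br (u - u') x = 0" for x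
    using assms(2,3) unip_inv_simps(1)[OF \<Phi>, of x] unfolding log_deriv_def
    by (metis br_diff_left diff_self)
  then have "u - u' = 0" by (rule center_trivial)
  then show ?thesis by simp
qed

text \<open>The failure of the intertwining relation at y is the bracket of
  \<open>u + A' - \<Phi> A\<close> with \<open>\<Phi> y\<close>. Since \<open>\<Phi>\<close> is
  surjective and the centre trivial, the relation says that this element is zero.\<close>

lemma gauged_iff:
  assumes \<Phi>: "unip \<Phi>" and u: "log_deriv \<Phi> u"
  shows "gauged \<Phi> A A' \<longleftrightarrow> A' = - u + \<Phi> A"
proof -
  have "D (\<Phi> y) + br A' (\<Phi> y) = \<Phi> (D y + br A y) \<longleftrightarrow> br (u + A' - \<Phi> A) (\<Phi> y) = 0" for y
  proof -
    have "br (u + A' - \<Phi> A) (\<Phi> y) = (D (\<Phi> y) + br A' (\<Phi> y)) - \<Phi> (D y + br A y)"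
      using u by (simp add: log_deriv_def br_linear unip_add[OF \<Phi>] unipD(2)[OF \<Phi>])
    then show ?thesis by simp
  qed
  then have "gauged \<Phi> A A' \<longleftrightarrow> (\<forall>y. br (u + A' - \<Phi> A) (\<Phi> y) = 0)"
    by (simp add: gauged_def)
  also have "\<dots> \<longleftrightarrow> (\<forall>y. br (u + A' - \<Phi> A) y = 0)"
  proof
    assume *: "\<forall>y. br (u + A' - \<Phi> A) (\<Phi> y) = 0"
    show "\<forall>y. br (u + A' - \<Phi> A) y = 0"
    proof
      fix y show "br (u + A' - \<Phi> A) y = 0"
        using *[rule_format, of "inv \<Phi> y"] unfolding unip_inv_simps(1)[OF \<Phi>] .
    qed
  qed blast
  also have "\<dots> \<longleftrightarrow> u + A' - \<Phi> A = 0"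
  proof
    assume "\<forall>y. br (u + A' - \<Phi> A) y = 0"
    then show "u + A' - \<Phi> A = 0" by (rule_tac center_trivial) blast
  next
    assume "u + A' - \<Phi> A = 0"
    then show "\<forall>y. br (u + A' - \<Phi> A) y = 0" by (metis br_zero_left)
  qed
  also have "\<dots> \<longleftrightarrow> A' = - u + \<Phi> A"
    by (auto simp: algebra_simps)
  finally show ?thesis .
qed

lemma gauged_comp: "gauged \<Phi> A B \<Longrightarrow> gauged \<Psi> B C \<Longrightarrow> gauged (\<Psi> \<circ> \<Phi>) A C"
  by (simp add: gauged_def)

lemma gauged_inv:
  assumes "unip \<Phi>" "gauged \<Phi> A B"
  shows "gauged (inv \<Phi>) B A"
  unfolding gauged_def
proof
  fix y
  have "\<Phi> (D (inv \<Phi> y) + br A (inv \<Phi> y)) = D y + br B y"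
    using assms(2) unip_inv_simps(1)[OF assms(1)] unfolding gauged_def by metis
  then show "D (inv \<Phi> y) + br A (inv \<Phi> y) = inv \<Phi> (D y + br B y)"
    using unip_inv_simps(2)[OF assms(1)] by metis
qed

text \<open>Evaluated at \<open>rho\<close>, which D kills, the defining relation gives
  [u, \<open>\<Phi> rho\<close>] = D(\<open>\<Phi> rho - rho\<close>), of degree at least k. In a
  degree l below k the left side has leading term -l u, so u has no such component.\<close>

lemma log_deriv_order:
  assumes \<Phi>: "unip \<Phi>" and u: "log_deriv \<Phi> u" and r: "\<Phi> rho - rho \<in> F k" and k: "1 \<le> k"
  shows "u \<in> F k"
proof -
  from log_deriv_exists[OF \<Phi>] log_deriv_unique[OF \<Phi> u] have u1: "u \<in> F 1" by auto
  have *: "br u (\<Phi> rho) \<in> F k"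
    using u D_F[OF r] by (simp add: log_deriv_def D_rho D_diff unip_zero[OF \<Phi>])
  have step: "u \<in> F (l + 1)" if l: "1 \<le> l" "l < k" "u \<in> F l" for l
  proof -
    have "of_int l *s u = - (br rho u - of_int l *s u) + (br u (\<Phi> rho - rho) - br u (\<Phi> rho))"
      using br_anti[of u rho] by (simp add: br_linear)
    moreover have "br u (\<Phi> rho) \<in> F (l + 1)" by (rule F_mono[OF *]) (use l in simp)
    moreover have "br u (\<Phi> rho - rho) \<in> F (l + 1)"
      by (rule F_mono[OF F_br[OF l(3) r]]) (use k in simp)
    ultimately have "of_int l *s u \<in> F (l + 1)"
      using F_neg[OF F_rho[OF l(3)]] F_add F_diff by metis
    then show ?thesis by (rule F_scale_cancel) (use l in simp)
  qed
  show ?thesis by (rule F_climb[OF u1 k step])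
qed

text \<open>If \<open>\<Phi>\<close> differs from the identity first in degree \<open>k\<close>, then in degree \<open>k - 1\<close> the
  difference \<open>A' - A\<close> lies in the image of \<open>ad p\<close>, which meets \<open>\<aa>\<close> trivially.\<close>

lemma gauged_unique:
  assumes \<Phi>: "unip \<Phi>" and g: "gauged \<Phi> A A'" and A: "A - p \<in> F 0" and A': "A' - A \<in> \<aa>"
  shows "\<Phi> = id" "A' = A"
proof -
  define r where "r = \<Phi> rho - rho"
  from log_deriv_exists[OF \<Phi>] obtain u where u: "log_deriv \<Phi> u" by blast
  have eq: "A' = - u + \<Phi> A" using g gauged_iff[OF \<Phi> u] by simp
  have step: "r \<in> F (k + 1)" if k: "1 \<le> k" and r: "r \<in> F k" for k
  proof -
    have r': "\<Phi> rho - rho \<in> F k" using r by (simp add: r_def)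
    have uk: "u \<in> F k" by (rule log_deriv_order[OF \<Phi> u r' k])
    have v: "\<Phi> (A - p) - (A - p) \<in> F k"
      using unip_order(1)[OF \<Phi> r' k A] by simp
    have w: "of_int k *s (\<Phi> p - p) + br r p \<in> F k"
      using unip_order(2)[OF \<Phi> r' k p_F] by (simp add: r_def)
    \<comment> \<open>The leading term of \<open>\<Phi> p - p\<close> is -[r, p]/k = [p, r]/k, of
      degree k - 1; every other contribution to A' - A has degree at least k.\<close>
    have "of_int k *s (A' - A) - br p r = of_int k *s (\<Phi> (A - p) - (A - p) - u)
        + (of_int k *s (\<Phi> p - p) + br r p)"
      using br_anti[of p r]
      by (simp add: eq unip_diff[OF \<Phi>] scale_right_diff_distrib scale_right_distrib)
    then have "of_int k *s (A' - A) - br p r \<in> F k"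
      using F_add[OF F_scale[OF F_diff[OF v uk]] w] by simp
    \<comment> \<open>Applying ad e removes A' - A, which lies in \<aa>, and leaves the hypothesis
      of \<open>sl2_inj\<close>.\<close>
    from F_neg[OF F_br[OF e_F this]] have "br e (br p r) \<in> F (k + 1)"
      by (simp add: br_diff_right[of e _ "br p r"] br_scale_right a_e[OF A'] add.commute)
    then show ?thesis by (rule sl2_inj[OF r k])
  qed
  have "r \<in> F 1" using unipD(3)[OF \<Phi> rho_F] by (simp add: r_def)
  from F_climb_zero[OF this step] have "\<Phi> rho = rho" by (simp add: r_def)
  then show id: "\<Phi> = id" by (rule unip_eq_id[OF \<Phi>])
  then have "br (A' - A) y = 0" for y using g by (simp add: gauged_def br_linear)
  then have "A' - A = 0" by (rule center_trivial)
  then show "A' = A" by simp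
qed

text \<open>The remainder of degree at least k - 1 splits as b + [p, Y]. Gauging by the exponential
  of Y adds [Y, p] = -[p, Y] and otherwise changes only degrees from k on, so b alone survives and
  joins the part already in \<aa>.\<close>

lemma gauged_reduce:
  assumes k: "1 \<le> k" and a: "a \<in> \<aa>" and x: "A - p - a \<in> F (k - 1)"
  shows "\<exists>\<Phi> A' a'. unip \<Phi> \<and> gauged \<Phi> A A' \<and> a' \<in> \<aa> \<and> A' - p - a' \<in> F k"
proof -
  from a_decomp[OF k x] obtain b Y where b: "b \<in> \<aa>" and Y: "Y \<in> F k" and eq: "A - p - a = b + br p Y"
    by blast
  have Y1: "Y \<in> F 1" by (rule F_mono[OF Y k])
  define \<Phi> where "\<Phi> = expo Y"
  have \<Phi>: "unip \<Phi>" unfolding \<Phi>_def by (rule unip_expo[OF Y1])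
  have ab: "a + b \<in> \<aa>" by (rule subspace_add[OF a_subspace a b])
  from log_deriv_exists[OF \<Phi>] obtain u where u: "log_deriv \<Phi> u" by blast
  have "\<Phi> rho - rho - br Y rho \<in> F k"
    unfolding \<Phi>_def by (rule F_mono[OF expo_order[OF Y k rho_F]]) (use k in simp)
  from F_add[OF this, of "br Y rho"] have r: "\<Phi> rho - rho \<in> F k" using F_br[OF Y rho_F] by simp
  have uk: "u \<in> F k" by (rule log_deriv_order[OF \<Phi> u r k])
  have "A - p = a + b + br p Y" using eq by (simp add: algebra_simps)
  moreover have "br p Y \<in> F 0" by (rule F_mono[OF F_br[OF p_F Y]]) (use k in simp)
  ultimately have v: "A - p \<in> F 0" using ab a_F F_add by auto
  have 1: "\<Phi> (A - p) - (A - p) \<in> F k" using unip_order(1)[OF \<Phi> r k v] by simp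
  have 2: "\<Phi> p - p - br Y p \<in> F k"
    unfolding \<Phi>_def by (rule F_mono[OF expo_order[OF Y k p_F]]) (use k in simp)
  have "- u + \<Phi> A - p - (a + b) = (\<Phi> (A - p) - (A - p)) + (\<Phi> p - p - br Y p) - u"
    using br_anti[of p Y] eq by (simp add: unip_diff[OF \<Phi>] algebra_simps)
  then have "- u + \<Phi> A - p - (a + b) \<in> F k" using F_diff[OF F_add[OF 1 2] uk] by metis
  then show ?thesis using \<Phi> ab gauged_iff[OF \<Phi> u] by blast
qed

lemma gauged_exists:
  assumes "A - p \<in> F 0"
  shows "\<exists>\<Phi> a. unip \<Phi> \<and> gauged \<Phi> A (p + a) \<and> a \<in> \<aa>"
proof -
  have "\<exists>\<Phi> A' a'. unip \<Phi> \<and> gauged \<Phi> A A' \<and> a' \<in> \<aa> \<and> A' - p - a' \<in> F k" if "0 \<le> k" for k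
    using that
  proof (induct k rule: int_ge_induct)
    case base
    show ?case
      by (rule exI[of _ id], rule exI[of _ A], rule exI[of _ 0])
         (simp add: gauged_def assms subspace_0[OF a_subspace] unip_id[unfolded id_def])
  next
    case (step k)
    then obtain \<Phi> A' a' where 1: "unip \<Phi>" "gauged \<Phi> A A'" "a' \<in> \<aa>" "A' - p - a' \<in> F k" by blast
    with gauged_reduce[of "k + 1" a' A'] step obtain \<Psi> A'' a'' where
      2: "unip \<Psi>" "gauged \<Psi> A' A''" "a'' \<in> \<aa>" "A'' - p - a'' \<in> F (k + 1)" by auto
    then show ?case using unip_comp[OF 2(1) 1(1)] gauged_comp[OF 1(2) 2(2)] by blast
  qed
  from this[of "int m + 1"] obtain \<Phi> A' a where
    "unip \<Phi>" "gauged \<Phi> A A'" "a \<in> \<aa>" "A' - p - a = 0" by (auto simp: F_high)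
  moreover from this have "A' = p + a" by (simp add: algebra_simps)
  ultimately show ?thesis by blast
qed

end

section \<open>Values of rational functions\<close>

text \<open>Rational functions have to qualify as scalars for the locales above.\<close>

instance fract :: ("{idom, ring_char_0}") ring_char_0
proof
  show "inj (of_nat :: nat \<Rightarrow> 'a fract)"
    by (auto simp: inj_def of_nat_fract eq_fract)
qed

instance fract :: ("{idom, ring_char_0}") field_char_0 ..

text \<open>The reduced denominator divides every other one, so regularity and value can be read off
  from any representation whose denominator does not vanish at z.\<close>

lemma Fract_regular:
  assumes "poly q z \<noteq> 0"
  shows "rat_regular (Fract p q) z" "rat_eval z (Fract p q) = poly p z / poly q z"
proof -
  define r s where "r = ratnum (Fract p q)" and "s = ratden (Fract p q)"
  have q: "q \<noteq> 0" using assms by auto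
  have s: "s \<noteq> 0" and "Fract r s = Fract p q"
    using Fract_quot[of "Fract p q"] by (auto simp: r_def s_def)
  then have e: "r * q = p * s" using q by (simp add: eq_fract)
  have "coprime r s" unfolding r_def s_def by (rule coprime_quot_of_fract)
  then have "s dvd q" using e
    by (metis coprime_commute coprime_dvd_mult_right_iff dvd_triv_right)
  then have sz: "poly s z \<noteq> 0" using assms by (auto elim!: dvdE)
  then show "rat_regular (Fract p q) z" by (simp add: rat_regular_def s_def)
  have "poly r z * poly q z = poly p z * poly s z" using e by (metis poly_mult)
  then show "rat_eval z (Fract p q) = poly p z / poly q z"
    using sz assms by (simp add: rat_eval_def field_simps flip: r_def s_def)
qed

lemma rat_regular_cases:
  assumes "rat_regular f z"
  obtains p q where "f = Fract p q" "poly q z \<noteq> 0"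
  using assms Fract_quot(1)[of f] by (metis rat_regular_def)

lemma rat_regular_const [simp]: "rat_regular (ratconst c) z" "rat_eval z (ratconst c) = c"
  unfolding ratconst_def using Fract_regular[of 1 z "[:c:]"] by auto

lemma rat_regular_add [simp]:
  assumes "rat_regular f z" "rat_regular g z"
  shows "rat_regular (f + g) z" "rat_eval z (f + g) = rat_eval z f + rat_eval z g"
proof -
  obtain p q where f: "f = Fract p q" "poly q z \<noteq> 0" using assms(1) by (rule rat_regular_cases)
  obtain r s where g: "g = Fract r s" "poly s z \<noteq> 0" using assms(2) by (rule rat_regular_cases)
  have nz: "q \<noteq> 0" "s \<noteq> 0" using f g by auto
  show "rat_regular (f + g) z" using f g nz by (simp add: Fract_regular)
  show "rat_eval z (f + g) = rat_eval z f + rat_eval z g"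
    unfolding f(1) g(1) add_fract[OF nz]
    by (simp add: Fract_regular f(2) g(2) add_frac_eq mult.commute)
qed

lemma rat_regular_mult [simp]:
  assumes "rat_regular f z" "rat_regular g z"
  shows "rat_regular (f * g) z" "rat_eval z (f * g) = rat_eval z f * rat_eval z g"
proof -
  obtain p q where f: "f = Fract p q" "poly q z \<noteq> 0" using assms(1) by (rule rat_regular_cases)
  obtain r s where g: "g = Fract r s" "poly s z \<noteq> 0" using assms(2) by (rule rat_regular_cases)
  show "rat_regular (f * g) z" using f g by (simp add: Fract_regular)
  show "rat_eval z (f * g) = rat_eval z f * rat_eval z g"
    using f g by (simp add: Fract_regular)
qed

lemma rat_regular_0 [simp]: "rat_regular 0 z" "rat_eval z 0 = 0"
  using rat_regular_const(1)[of 0 z] rat_regular_const(2)[of z 0] by (simp_all del: rat_regular_const)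

lemma rat_not_regular_finite: "finite {z. \<not> rat_regular f z}"
  using poly_roots_finite[OF Fract_quot(2)[of f]] by (simp add: rat_regular_def)

lemma rat_eval_zero_imp:
  assumes "finite S" "\<And>z. z \<notin> S \<Longrightarrow> rat_eval z f = 0"
  shows "f = 0"
proof (rule ccontr)
  assume "f \<noteq> 0"
  then have "ratnum f \<noteq> 0" by simp
  \<comment> \<open>Poles are excluded too, because there \<open>rat_eval\<close> divides by zero
    and returns 0.\<close>
  then have "finite ({z. poly (ratnum f) z = 0} \<union> {z. \<not> rat_regular f z} \<union> S)"
    using assms(1) rat_not_regular_finite poly_roots_finite by blast
  from ex_new_if_finite[OF infinite_UNIV_char_0 this] obtain z where
    z: "z \<notin> {z. poly (ratnum f) z = 0} \<union> {z. \<not> rat_regular f z} \<union> S" ..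
  then have "rat_eval z f = 0" by (intro assms(2)) simp
  with z show False by (simp add: rat_eval_def rat_regular_def)
qed

lemma ratconst_of_nat [simp]: "ratconst (of_nat n) = of_nat n"
  by (induct n) simp_all

lemma ratconst_minus [simp]: "ratconst (- a) = - ratconst a"
  using ratconst_simps(3)[of a "- a"] by (simp add: eq_neg_iff_add_eq_0 add.commute del: ratconst_simps(3))

lemma ratconst_diff [simp]: "ratconst (a - b) = ratconst a - ratconst b"
  using ratconst_simps(3)[of a "- b"] by (simp del: ratconst_simps(3))

lemma ratconst_of_int [simp]: "ratconst (of_int n) = of_int n"
  by (cases n) simp_all

lemma rat_deriv_const [simp]: "rat_deriv (ratconst c) = 0"
  by (simp add: ratconst_def rat_deriv_Fract fract_collapse)

lemma rat_deriv_add: "rat_deriv (f + g) = rat_deriv f + rat_deriv g"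
  by (cases f; cases g) (simp add: rat_deriv_Fract eq_fract pderiv_mult pderiv_add algebra_simps)

lemma rat_deriv_mult: "rat_deriv (f * g) = rat_deriv f * g + f * rat_deriv g"
  by (cases f; cases g) (simp add: rat_deriv_Fract eq_fract pderiv_mult pderiv_add algebra_simps)

lemma pcompose_dilate_nz: "a \<noteq> 0 \<Longrightarrow> q \<noteq> 0 \<Longrightarrow> pcompose q [:0, a:] \<noteq> (0 :: complex poly)"
  by (simp add: pcompose_eq_0_iff)

context
  fixes a :: complex
  assumes a: "a \<noteq> 0"
begin

lemma rat_dilate_const [simp]: "rat_dilate a (ratconst c) = ratconst c"
  by (simp add: ratconst_def rat_dilate_Fract a pcompose_const pcompose_1)

lemma rat_dilate_add: "rat_dilate a (f + g) = rat_dilate a f + rat_dilate a g"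
  by (cases f; cases g) (simp add: rat_dilate_Fract a pcompose_dilate_nz pcompose_mult pcompose_add)

lemma rat_dilate_mult: "rat_dilate a (f * g) = rat_dilate a f * rat_dilate a g"
  by (cases f; cases g) (simp add: rat_dilate_Fract a pcompose_dilate_nz pcompose_mult)

lemma rat_dilate_inverse: "rat_dilate a (rat_dilate (inverse a) f) = f"
proof (cases f)
  case (Fract p q)
  have "pcompose (pcompose r [:0, inverse a:]) [:0, a:] = r" for r :: "complex poly"
    by (simp add: a flip: pcompose_assoc)
       (simp add: pcompose_pCons a pcompose_idR)
  then show ?thesis using Fract by (simp add: rat_dilate_Fract a pcompose_dilate_nz)
qed

text \<open>The factor a of the chain rule is the one that the pullback of dt produces, which makes
  twisting compatible with d.\<close>

lemma rat_deriv_dilate: "rat_deriv (rat_dilate a f) = ratconst a * rat_dilate a (rat_deriv f)"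
proof (cases f)
  case (Fract p q)
  have "pderiv (pcompose r [:0, a:]) = smult a (pcompose (pderiv r) [:0, a:])" for r
    by (simp add: pderiv_pcompose pderiv_pCons)
  then show ?thesis
    using Fract by (simp add: rat_deriv_Fract rat_dilate_Fract a pcompose_dilate_nz ratconst_def
      eq_fract pcompose_mult pcompose_diff algebra_simps)
qed

end

section \<open>Lie algebra valued rational functions\<close>

abbreviation rep :: "'g::complex_lie_algebra \<Rightarrow> 'g \<Rightarrow> complex" where
  "rep \<equiv> cvec.representation lie_basis"

lemma rep_outside: "b \<notin> lie_basis \<Longrightarrow> rep x b = 0"
  using cvec.representation_ne_zero by blast

lemma rep_add: "rep (x + y) b = rep x b + rep y b"
  by (simp add: cvec.representation_add lie_basis)

lemma rep_scale: "rep (c *\<^sub>C x) b = c * rep x b"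
  by (simp add: cvec.representation_scale lie_basis)

lemma rep_expand: "(\<Sum>b\<in>lie_basis. rep x b *\<^sub>C b) = x"
  by (rule cvec.sum_representation_eq) (simp_all add: lie_basis)

lemma coord_tensor: "coord (x \<otimes> f) b = ratconst (rep x b) * f"
  by (simp add: tensor_def coord_Mer rep_outside)

lemma tensor_add_left: "(x + y) \<otimes> f = x \<otimes> f + y \<otimes> f"
  by (rule mer_eqI) (simp add: coord_tensor rep_add algebra_simps)

lemma tensor_add_right: "x \<otimes> (f + g) = x \<otimes> f + x \<otimes> g"
  by (rule mer_eqI) (simp add: coord_tensor algebra_simps)

lemma scaleM_tensor [simp]: "scaleM f (x \<otimes> g) = x \<otimes> (f * g)"
  by (rule mer_eqI) (simp add: coord_tensor algebra_simps)

lemma tensor_scaleC: "(c *\<^sub>C x) \<otimes> f = x \<otimes> (ratconst c * f)"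
  by (rule mer_eqI) (simp add: coord_tensor rep_scale algebra_simps)

lemma tensor_0_left [simp]: "0 \<otimes> f = 0"
  using tensor_add_left[of 0 0 f] by simp

lemma tensor_0_right [simp]: "x \<otimes> 0 = 0"
  using tensor_add_right[of x 0 0] by simp

lemma tensor_minus_left: "(- x) \<otimes> f = - (x \<otimes> f)"
  using tensor_add_left[of x "- x" f] by (simp add: eq_neg_iff_add_eq_0 add.commute)

lemma tensor_diff_left: "(x - y) \<otimes> f = x \<otimes> f - y \<otimes> f"
  using tensor_add_left[of x "- y" f] by (simp add: tensor_minus_left)

lemma tensor_sum_left: "(\<Sum>a\<in>A. x a) \<otimes> f = (\<Sum>a\<in>A. x a \<otimes> f)"
  by (induct A rule: infinite_finite_induct) (simp_all add: tensor_add_left)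

lemma coord_sum: "coord (sum f A) b = (\<Sum>a\<in>A. coord (f a) b)"
  by (induct A rule: infinite_finite_induct) simp_all

lemma rep_basis: "b \<in> lie_basis \<Longrightarrow> rep b b' = (if b' = b then 1 else 0)"
  by (simp add: cvec.representation_basis lie_basis)

lemma mer_expand: "(\<Sum>b\<in>lie_basis. b \<otimes> coord u b) = u"
proof (rule mer_eqI)
  fix b
  have "coord (\<Sum>b\<in>lie_basis. b \<otimes> coord u b) b = (\<Sum>b'\<in>lie_basis. if b' = b then coord u b' else 0)"
    unfolding coord_sum by (intro sum.cong refl) (auto simp: coord_tensor rep_basis)
  also have "\<dots> = coord u b"
    by (simp add: lie_basis coord_outside)
  finally show "coord (\<Sum>b\<in>lie_basis. b \<otimes> coord u b) b = coord u b" .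
qed

lemma mer_induct [case_names tensor add]:
  assumes "\<And>x f. P (x \<otimes> f)" "\<And>u v. P u \<Longrightarrow> P v \<Longrightarrow> P (u + v)"
  shows "P u"
proof -
  have "P (\<Sum>b\<in>B. b \<otimes> coord u b)" for B
  proof (induct B rule: infinite_finite_induct)
    case (insert b B)
    then show ?case by (simp add: assms)
  qed (use assms(1)[of 0 0] in simp_all)
  from this[of lie_basis] show ?thesis by (simp add: mer_expand)
qed

section \<open>The bracket before and after extension of scalars\<close>

lemma bracket_zero [simp]: "bracket 0 x = 0" "bracket x 0 = 0"
  using bracket_add_left[of 0 0 x] bracket_add_right[of x 0 0] by simp_all

lemma bracket_minus: "bracket (- x) y = - bracket x y" "bracket x (- y) = - bracket x y"
  using bracket_add_left[of x "- x" y] bracket_add_right[of x y "- y"]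
  by (simp_all add: eq_neg_iff_add_eq_0 add.commute)

lemma bracket_diff: "bracket (x - y) z = bracket x z - bracket y z"
  "bracket x (y - z) = bracket x y - bracket x z"
  using bracket_add_left[of x "- y" z] bracket_add_right[of x y "- z"]
  by (simp_all add: bracket_minus)

lemma bracket_sum_left: "bracket (sum f A) y = (\<Sum>a\<in>A. bracket (f a) y)"
  by (induct A rule: infinite_finite_induct) (simp_all add: bracket_add_left)

lemma bracket_sum_right: "bracket x (sum f A) = (\<Sum>a\<in>A. bracket x (f a))"
  by (induct A rule: infinite_finite_induct) (simp_all add: bracket_add_right)

lemma bracket_anti: "bracket x y = - bracket y x"
proof -
  have "bracket x y + bracket y x = 0"
    using bracket_self[of "x + y"] unfolding bracket_add_left bracket_add_right
    by (simp add: bracket_self add.commute)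
  then show ?thesis by (simp add: eq_neg_iff_add_eq_0)
qed

lemma bracketM_add_left: "bracketM (u + v) w = bracketM u w + bracketM v w"
  by (simp add: bracketM_def distrib_right tensor_add_right sum.distrib)

lemma bracketM_add_right: "bracketM u (v + w) = bracketM u v + bracketM u w"
  by (simp add: bracketM_def distrib_left tensor_add_right sum.distrib)

lemma bracketM_scale_left: "bracketM (scaleM f u) v = scaleM f (bracketM u v)"
  by (simp add: bracketM_def mvec.scale_sum_right mult_ac)

lemma bracketM_scale_right: "bracketM u (scaleM f v) = scaleM f (bracketM u v)"
  by (simp add: bracketM_def mvec.scale_sum_right mult_ac)

lemma bracketM_tensor: "bracketM (x \<otimes> f) (y \<otimes> g) = bracket x y \<otimes> (f * g)"
proof -
  have "bracketM (x \<otimes> f) (y \<otimes> g)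
      = (\<Sum>b\<in>lie_basis. \<Sum>b'\<in>lie_basis. bracket (rep x b *\<^sub>C b) (rep y b' *\<^sub>C b') \<otimes> (f * g))"
    by (simp add: bracketM_def coord_tensor bracket_scaleC_left bracket_scaleC_right tensor_scaleC mult_ac)
  also have "\<dots> = (\<Sum>b\<in>lie_basis. bracket (rep x b *\<^sub>C b) y \<otimes> (f * g))"
    by (simp only: tensor_sum_left[symmetric] bracket_sum_right[symmetric] rep_expand)
  also have "\<dots> = bracket x y \<otimes> (f * g)"
    by (simp only: tensor_sum_left[symmetric] bracket_sum_left[symmetric] rep_expand)
  finally show ?thesis .
qed

lemma bracketM_anti: "bracketM u v = - bracketM v u"
proof (induct u rule: mer_induct)
  case (tensor x f)
  show ?case
  proof (induct v rule: mer_induct)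
    case (tensor y g)
    show ?case
      by (subst bracketM_tensor, subst bracketM_tensor, subst bracket_anti)
         (simp add: tensor_minus_left mult.commute)
  qed (simp add: bracketM_add_left bracketM_add_right)
qed (simp add: bracketM_add_left bracketM_add_right)

text \<open>The identity is quadratic in u, so \<open>mer_induct\<close> does not apply directly; it
  follows from antisymmetry by dividing by 2.\<close>

lemma bracketM_self: "bracketM u u = 0"
proof -
  have "scaleM 2 (bracketM u u) = bracketM u u + bracketM u u"
    using mvec.scale_left_distrib[of 1 1 "bracketM u u"] by simp
  also have "\<dots> = 0" using bracketM_anti[of u u] by (metis add.right_inverse)
  finally show ?thesis by simp
qed

lemma bracketM_jacobi:
  "bracketM u (bracketM v w) + bracketM v (bracketM w u) + bracketM w (bracketM u v) = 0"
proof (induct u rule: mer_induct)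
  case (tensor x f)
  show ?case
  proof (induct v rule: mer_induct)
    case (tensor y g)
    show ?case
    proof (induct w rule: mer_induct)
      case (tensor z h)
      have "bracketM (x \<otimes> f) (bracketM (y \<otimes> g) (z \<otimes> h)) + bracketM (y \<otimes> g) (bracketM (z \<otimes> h) (x \<otimes> f))
          + bracketM (z \<otimes> h) (bracketM (x \<otimes> f) (y \<otimes> g))
          = (bracket x (bracket y z) + bracket y (bracket z x) + bracket z (bracket x y)) \<otimes> (f * g * h)"
        by (simp add: bracketM_tensor tensor_add_left mult_ac)
      then show ?case by (simp add: jacobi)
    next
      case (add w w')
      then show ?case
        by (simp add: bracketM_add_left bracketM_add_right add_eq_0_iff algebra_simps)
    qed
  next
    case (add v v')
    then show ?case by (simp add: bracketM_add_left bracketM_add_right add_eq_0_iff algebra_simps)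
  qed
next
  case (add u u')
  then show ?case by (simp add: bracketM_add_left bracketM_add_right add_eq_0_iff algebra_simps)
qed

text \<open>Linearity over the complex numbers only: differentiation, dilation and pullback have it
  without being linear over the rational functions, and it is what frees \<open>tensor_map\<close>
  from the choice of basis in \<open>tensor_map_tensor\<close>.\<close>

definition clin :: "(ratfun \<Rightarrow> ratfun) \<Rightarrow> bool" where
  "clin \<theta> \<longleftrightarrow> (\<forall>f g. \<theta> (f + g) = \<theta> f + \<theta> g) \<and> (\<forall>c f. \<theta> (ratconst c * f) = ratconst c * \<theta> f)"

lemma clin_simps:
  assumes "clin \<theta>"
  shows "\<theta> (f + g) = \<theta> f + \<theta> g" "\<theta> (ratconst c * f) = ratconst c * \<theta> f" "\<theta> 0 = 0"
    "\<theta> (sum h A) = (\<Sum>a\<in>A. \<theta> (h a))"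
proof -
  show 1: "\<theta> (f + g) = \<theta> f + \<theta> g" for f g using assms by (simp add: clin_def)
  show "\<theta> (ratconst c * f) = ratconst c * \<theta> f" using assms by (simp add: clin_def)
  show "\<theta> 0 = 0" using 1[of 0 0] by simp
  then show "\<theta> (sum h A) = (\<Sum>a\<in>A. \<theta> (h a))"
    by (induct A rule: infinite_finite_induct) (simp_all add: 1)
qed

lemma clin_id: "clin id"
  by (simp add: clin_def)

lemma clin_deriv: "clin rat_deriv"
  by (simp add: clin_def rat_deriv_add rat_deriv_mult)

lemma clin_dilate: "a \<noteq> 0 \<Longrightarrow> clin (rat_dilate a)"
  by (simp add: clin_def rat_dilate_add rat_dilate_mult)

lemma clin_pullback: "a \<noteq> 0 \<Longrightarrow> clin (form_pullback a)"
  by (simp add: clin_def form_pullback_def rat_dilate_add rat_dilate_mult algebra_simps)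

lemma tensor_map_tensor:
  assumes \<phi>: "Vector_Spaces.linear scaleC scaleC \<phi>" and \<theta>: "clin \<theta>"
  shows "tensor_map \<phi> \<theta> (x \<otimes> f) = \<phi> x \<otimes> \<theta> f"
proof -
  interpret L: Vector_Spaces.linear scaleC scaleC \<phi> by (fact \<phi>)
  have "tensor_map \<phi> \<theta> (x \<otimes> f) = (\<Sum>b\<in>lie_basis. \<phi> (rep x b *\<^sub>C b)) \<otimes> \<theta> f"
    by (simp add: tensor_map_def coord_tensor clin_simps[OF \<theta>] L.scale tensor_scaleC tensor_sum_left)
  also have "(\<Sum>b\<in>lie_basis. \<phi> (rep x b *\<^sub>C b)) = \<phi> x"
    by (simp only: L.sum[symmetric] rep_expand)
  finally show ?thesis .
qed

lemma tensor_map_add: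
  assumes "clin \<theta>"
  shows "tensor_map \<phi> \<theta> (u + v) = tensor_map \<phi> \<theta> u + tensor_map \<phi> \<theta> v"
  by (simp add: tensor_map_def clin_simps[OF assms] tensor_add_right sum.distrib)

lemma tensor_map_0: "clin \<theta> \<Longrightarrow> tensor_map \<phi> \<theta> 0 = 0"
  by (simp add: tensor_map_def clin_simps)

lemma linear_cid: "Vector_Spaces.linear scaleC scaleC (id :: 'g::complex_lie_algebra \<Rightarrow> 'g)"
  by unfold_locales simp_all

section \<open>Evaluation at regular points\<close>

lemma mer_regular_add [simp]:
  assumes "mer_regular u z" "mer_regular v z"
  shows "mer_regular (u + v) z" "mer_eval z (u + v) = mer_eval z u + mer_eval z v"
  using assms by (simp_all add: mer_regular_def mer_eval_def scaleC_add_left sum.distrib)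

lemma mer_regular_scale:
  assumes "rat_regular f z" "mer_regular v z"
  shows "mer_regular (scaleM f v) z" "mer_eval z (scaleM f v) = rat_eval z f *\<^sub>C mer_eval z v"
  using assms by (simp_all add: mer_regular_def mer_eval_def cvec.scale_sum_right)

lemma mer_regular_0 [simp]: "mer_regular 0 z" "mer_eval z 0 = 0"
  by (simp_all add: mer_regular_def mer_eval_def)

lemma mer_regular_sum:
  assumes "\<And>a. a \<in> A \<Longrightarrow> mer_regular (f a) z"
  shows "mer_regular (sum f A) z" "mer_eval z (sum f A) = (\<Sum>a\<in>A. mer_eval z (f a))"
  using assms by (induct A rule: infinite_finite_induct) simp_all

lemma mer_regular_tensor:
  assumes "rat_regular f z"
  shows "mer_regular (x \<otimes> f) z" "mer_eval z (x \<otimes> f) = rat_eval z f *\<^sub>C x"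
proof -
  show "mer_regular (x \<otimes> f) z" using assms by (simp add: mer_regular_def coord_tensor)
  have "mer_eval z (x \<otimes> f) = rat_eval z f *\<^sub>C (\<Sum>b\<in>lie_basis. rep x b *\<^sub>C b)"
    using assms by (simp add: mer_eval_def coord_tensor cvec.scale_sum_right mult.commute)
  then show "mer_eval z (x \<otimes> f) = rat_eval z f *\<^sub>C x" by (simp add: rep_expand)
qed

lemma mer_regular_tensor_1 [simp]: "mer_regular (x \<otimes> 1) z" "mer_eval z (x \<otimes> 1) = x"
  using mer_regular_tensor[of 1 z x] rat_regular_const(1)[of 1 z] rat_regular_const(2)[of z 1]
  by simp_all

lemma mer_regular_minus [simp]:
  assumes "mer_regular u z"
  shows "mer_regular (- u) z" "mer_eval z (- u) = - mer_eval z u"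
  using mer_regular_scale[OF _ assms, of "- 1"] rat_regular_const(1)[of "- 1" z]
    rat_regular_const(2)[of z "- 1"] by simp_all

lemma mer_regular_diff [simp]:
  assumes "mer_regular u z" "mer_regular v z"
  shows "mer_regular (u - v) z" "mer_eval z (u - v) = mer_eval z u - mer_eval z v"
  using mer_regular_add[OF assms(1) mer_regular_minus(1)[OF assms(2)]] assms by simp_all

lemma mer_regular_bracket:
  assumes "mer_regular u z" "mer_regular v z"
  shows "mer_regular (bracketM u v) z"
    "mer_eval z (bracketM u v) = bracket (mer_eval z u) (mer_eval z v)"
proof -
  have r: "rat_regular (coord u b * coord v b') z"
    "rat_eval z (coord u b * coord v b') = rat_eval z (coord u b) * rat_eval z (coord v b')"
    if "b \<in> lie_basis" "b' \<in> lie_basis" for b b'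
    using that assms by (simp_all add: mer_regular_def)
  show "mer_regular (bracketM u v) z"
    unfolding bracketM_def by (intro mer_regular_sum mer_regular_tensor r)
  have "mer_eval z (bracketM u v) = (\<Sum>b\<in>lie_basis. \<Sum>b'\<in>lie_basis.
      (rat_eval z (coord u b) * rat_eval z (coord v b')) *\<^sub>C bracket b b')"
    unfolding bracketM_def by (simp add: mer_regular_sum mer_regular_tensor r)
  also have "\<dots> = bracket (mer_eval z u) (mer_eval z v)"
    unfolding mer_eval_def bracket_sum_left unfolding bracket_sum_right
    by (simp add: bracket_scaleC_left bracket_scaleC_right mult.commute)
  finally show "mer_eval z (bracketM u v) = bracket (mer_eval z u) (mer_eval z v)" .
qed

lemma mer_regular_map:
  assumes "Vector_Spaces.linear scaleC scaleC \<phi>" "mer_regular u z"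
  shows "mer_regular (tensor_map \<phi> id u) z" "mer_eval z (tensor_map \<phi> id u) = \<phi> (mer_eval z u)"
proof -
  interpret L: Vector_Spaces.linear scaleC scaleC \<phi> by (fact assms)
  have r: "rat_regular (id (coord u b)) z" if "b \<in> lie_basis" for b
    using that assms(2) by (simp add: mer_regular_def)
  show "mer_regular (tensor_map \<phi> id u) z"
    unfolding tensor_map_def by (intro mer_regular_sum mer_regular_tensor r)
  have "mer_eval z (tensor_map \<phi> id u) = (\<Sum>b\<in>lie_basis. rat_eval z (coord u b) *\<^sub>C \<phi> b)"
    unfolding tensor_map_def using r by (simp add: mer_regular_sum mer_regular_tensor)
  also have "\<dots> = \<phi> (mer_eval z u)"
    by (simp add: mer_eval_def L.sum L.scale)
  finally show "mer_eval z (tensor_map \<phi> id u) = \<phi> (mer_eval z u)" .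
qed

lemma mer_not_regular_finite: "finite {z. \<not> mer_regular u z}"
proof -
  have "{z. \<not> mer_regular u z} = (\<Union>b\<in>lie_basis. {z. \<not> rat_regular (coord u b) z})"
    by (auto simp: mer_regular_def)
  then show ?thesis using lie_basis(1) rat_not_regular_finite by auto
qed

lemma mer_eval_zero_imp:
  assumes "finite S" "\<And>z. z \<notin> S \<Longrightarrow> mer_eval z u = 0"
  shows "u = 0"
proof (rule mer_eqI)
  fix b
  show "coord u b = coord 0 b"
  proof (cases "b \<in> lie_basis")
    case True
    have "rat_eval z (coord u b) = 0" if "z \<notin> S" for z
      using cvec.independentD[OF lie_basis(2,1) subset_refl _ True] assms(2)[OF that]
      by (simp add: mer_eval_def)
    from rat_eval_zero_imp[OF assms(1) this] show ?thesis by simp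
  qed (simp add: coord_outside)
qed

text \<open>Regularity of both sides may be assumed because their finitely many poles can be added
  to the exceptional set.\<close>

lemma mer_eval_eqI:
  assumes "finite S" "\<And>z. z \<notin> S \<Longrightarrow> mer_regular u z \<Longrightarrow> mer_regular v z \<Longrightarrow> mer_eval z u = mer_eval z v"
  shows "u = v"
proof -
  have "u - v = 0"
  proof (rule mer_eval_zero_imp)
    show "finite (S \<union> {z. \<not> mer_regular u z} \<union> {z. \<not> mer_regular v z})"
      using assms(1) by (simp add: mer_not_regular_finite)
  qed (auto simp: assms(2))
  then show ?thesis by simp
qed

section \<open>Subspaces with rational coefficients\<close>

lemma mer_of_subspace: "mvec.subspace (mer_of S)"
  by (simp add: mer_of_def)

lemma tensor_mer_of: "x \<in> S \<Longrightarrow> x \<otimes> f \<in> mer_of S"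
  unfolding mer_of_def using mvec.span_scale[OF mvec.span_base, of "x \<otimes> 1" _ f] by simp

lemma mer_of_induct [consumes 1, case_names zero tensor add]:
  assumes "u \<in> mer_of S" "P 0" "\<And>x f. x \<in> S \<Longrightarrow> P (x \<otimes> f)" "\<And>u v. P u \<Longrightarrow> P v \<Longrightarrow> P (u + v)"
  shows "P u"
  using assms(1) unfolding mer_of_def
proof (induct rule: mvec.span_induct_alt)
  case (step f w v)
  then obtain x where x: "x \<in> S" "w = x \<otimes> 1" by blast
  then have "scaleM f w = x \<otimes> f" by simp
  then show ?case using assms(3)[OF x(1), of f] step(2) assms(4) by simp
qed (rule assms)

lemma mer_of_mono: "S \<subseteq> S' \<Longrightarrow> mer_of S \<subseteq> mer_of S'"
  unfolding mer_of_def by (intro mvec.span_mono image_mono)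

lemma mer_of_UNIV: "mer_of UNIV = UNIV"
proof -
  have "u \<in> mer_of UNIV" for u :: "'a mer"
    by (induct u rule: mer_induct)
       (auto intro: tensor_mer_of mvec.subspace_add[OF mer_of_subspace])
  then show ?thesis by blast
qed

lemma mer_of_zero: "mer_of {0} = {0}"
  by (simp add: mer_of_def)

lemma projection_exists:
  fixes S :: "'g::complex_lie_algebra set"
  assumes "cvec.subspace S"
  obtains q where "Vector_Spaces.linear scaleC scaleC q" "\<And>x. q x \<in> S" "\<And>x. x \<in> S \<Longrightarrow> q x = x"
proof -
  interpret vector_space_pair "scaleC :: complex \<Rightarrow> 'g \<Rightarrow> 'g" "scaleC :: complex \<Rightarrow> 'g \<Rightarrow> 'g" ..
  obtain C where C: "C \<subseteq> S" "cvec.independent C" "S \<subseteq> cvec.span C"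
    using cvec.maximal_independent_subset[of S] by blast
  obtain q where q: "Vector_Spaces.linear scaleC scaleC q" "\<forall>x\<in>C. q x = x" "range q = cvec.span C"
    using linear_independent_extend_subspace[OF C(2), of "\<lambda>x. x"] by auto
  have "cvec.span C = S"
    using C assms cvec.span_minimal by blast
  moreover have "q x = x" if "x \<in> cvec.span C" for x
    using that q(1,2) linear_eq_on[OF q(1) cvec.linear_id] by (auto simp: id_def)
  ultimately show ?thesis using q that by blast
qed

text \<open>A projection turns membership in the extension of S into an equation, and equations can
  be checked pointwise; this yields \<open>mer_of_eval\<close> and
  \<open>mer_of_evalI\<close>.\<close>

lemma mer_of_projection:
  assumes q: "Vector_Spaces.linear scaleC scaleC q" "\<And>x. q x \<in> S" "\<And>x. x \<in> S \<Longrightarrow> q x = x"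
  shows "u \<in> mer_of S \<longleftrightarrow> tensor_map q id u = u"
proof
  assume "u \<in> mer_of S"
  then show "tensor_map q id u = u"
  proof (induct rule: mer_of_induct)
    case zero
    show ?case by (rule tensor_map_0[OF clin_id])
  next
    case (tensor x f)
    then show ?case unfolding tensor_map_tensor[OF q(1) clin_id] by (simp add: q(3))
  next
    case (add u v)
    then show ?case unfolding tensor_map_add[OF clin_id] by (rule arg_cong2)
  qed
next
  assume "tensor_map q id u = u"
  moreover have "tensor_map q id u \<in> mer_of S"
    unfolding tensor_map_def by (intro mvec.subspace_sum mer_of_subspace tensor_mer_of q)
  ultimately show "u \<in> mer_of S" by simp
qed

lemma mer_of_eval:
  assumes "cvec.subspace S" "u \<in> mer_of S" "mer_regular u z"
  shows "mer_eval z u \<in> S"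
proof -
  from projection_exists[OF assms(1)] obtain q where q: "Vector_Spaces.linear scaleC scaleC q"
    "\<And>x. q x \<in> S" "\<And>x. x \<in> S \<Longrightarrow> q x = x" by metis
  from mer_of_projection[OF q] assms(2) mer_regular_map(2)[OF q(1) assms(3)]
  have "mer_eval z u = q (mer_eval z u)" by simp
  then show ?thesis using q(2) by metis
qed

lemma mer_of_evalI:
  assumes S: "cvec.subspace S" and fin: "finite Z"
    and ev: "\<And>z. z \<notin> Z \<Longrightarrow> mer_regular u z \<Longrightarrow> mer_eval z u \<in> S"
  shows "u \<in> mer_of S"
proof -
  from projection_exists[OF assms(1)] obtain q where q: "Vector_Spaces.linear scaleC scaleC q"
    "\<And>x. q x \<in> S" "\<And>x. x \<in> S \<Longrightarrow> q x = x" by metis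
  have "tensor_map q id u = u"
    by (rule mer_eval_eqI[OF fin]) (simp add: mer_regular_map q(1) q(3) ev)
  then show ?thesis using mer_of_projection[OF q] by simp
qed

section \<open>Endomorphism valued rational functions\<close>

abbreviation mer_linear :: "('g::complex_lie_algebra \<Rightarrow> 'g mer) \<Rightarrow> bool" where
  "mer_linear g \<equiv> Vector_Spaces.linear scaleC (\<lambda>k. scaleM (ratconst k)) g"

lemma mer_linear_vs: "vector_space (\<lambda>k. scaleM (ratconst k) :: 'g::complex_lie_algebra mer \<Rightarrow> 'g mer)"
  by unfold_locales (simp_all add: mvec.scale_right_distrib mvec.scale_left_distrib)

lemma mer_linearI:
  assumes "\<And>x y. g (x + y) = g x + g y" "\<And>c x. g (c *\<^sub>C x) = scaleM (ratconst c) (g x)"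
  shows "mer_linear g"
proof -
  interpret v: vector_space "\<lambda>k. scaleM (ratconst k) :: 'a mer \<Rightarrow> 'a mer" by (rule mer_linear_vs)
  show ?thesis by unfold_locales (rule assms)+
qed

lemma mer_linearD:
  assumes "mer_linear g"
  shows "g (x + y) = g x + g y" "g (c *\<^sub>C x) = scaleM (ratconst c) (g x)" "g 0 = 0"
    "g (sum f A) = (\<Sum>a\<in>A. g (f a))"
proof -
  interpret L: Vector_Spaces.linear scaleC "\<lambda>k. scaleM (ratconst k)" g by (fact assms)
  show "g (x + y) = g x + g y" "g (c *\<^sub>C x) = scaleM (ratconst c) (g x)" "g 0 = 0"
    "g (sum f A) = (\<Sum>a\<in>A. g (f a))"
    by (rule L.add L.scale L.zero L.sum)+
qed

lemma Ad_tensor: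
  assumes "mer_linear g"
  shows "Ad g (x \<otimes> f) = scaleM f (g x)"
proof -
  have "Ad g (x \<otimes> f) = scaleM f (\<Sum>b\<in>lie_basis. scaleM (ratconst (rep x b)) (g b))"
    by (simp add: Ad_def coord_tensor mvec.scale_sum_right mult.commute)
  also have "(\<Sum>b\<in>lie_basis. scaleM (ratconst (rep x b)) (g b)) = g (\<Sum>b\<in>lie_basis. rep x b *\<^sub>C b)"
    by (simp only: mer_linearD[OF assms])
  finally show ?thesis by (simp only: rep_expand)
qed

lemma Ad_add: "Ad g (u + v) = Ad g u + Ad g v"
  by (simp add: Ad_def mvec.scale_left_distrib sum.distrib)

lemma Ad_scale: "Ad g (scaleM f u) = scaleM f (Ad g u)"
  by (simp add: Ad_def mvec.scale_sum_right)

lemma Ad_restrict: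
  assumes "\<And>u v. \<Phi> (u + v) = \<Phi> u + \<Phi> v" "\<And>f u. \<Phi> (scaleM f u) = scaleM f (\<Phi> u)"
  shows "mer_linear (\<lambda>x. \<Phi> (x \<otimes> 1))" "Ad (\<lambda>x. \<Phi> (x \<otimes> 1)) = \<Phi>"
proof -
  show 1: "mer_linear (\<lambda>x. \<Phi> (x \<otimes> 1))"
    by (rule mer_linearI) (simp_all add: tensor_add_left assms(1) flip: assms(2), simp add: tensor_scaleC)
  show "Ad (\<lambda>x. \<Phi> (x \<otimes> 1)) = \<Phi>"
  proof
    fix u show "Ad (\<lambda>x. \<Phi> (x \<otimes> 1)) u = \<Phi> u"
      by (induct u rule: mer_induct) (simp_all add: Ad_tensor[OF 1] Ad_add assms(1) flip: assms(2))
  qed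
qed

section \<open>The principal grading\<close>

lemma bracket_span:
  assumes "x \<in> cvec.span S" "y \<in> cvec.span S'" "cvec.subspace V"
    and *: "\<And>s s'. s \<in> S \<Longrightarrow> s' \<in> S' \<Longrightarrow> bracket s s' \<in> V"
  shows "bracket x y \<in> V"
proof -
  have 1: "bracket s y \<in> V" if "s \<in> S" for s
    using assms(2)
    by (induct rule: cvec.span_induct_alt)
       (auto simp: bracket_add_right bracket_scaleC_right intro!: that * cvec.subspace_add[OF assms(3)]
          cvec.subspace_scale[OF assms(3)] cvec.subspace_0[OF assms(3)])
  show ?thesis
    using assms(1)
    by (induct rule: cvec.span_induct_alt)
       (auto simp: bracket_add_left bracket_scaleC_left intro!: 1 cvec.subspace_add[OF assms(3)]
          cvec.subspace_scale[OF assms(3)] cvec.subspace_0[OF assms(3)])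
qed

lemma bracket_leibniz: "bracket x (bracket y z) = bracket (bracket x y) z + bracket y (bracket x z)"
  using jacobi[of x y z] unfolding bracket_anti[of "bracket x y" z] bracket_anti[of z x]
  by (simp add: bracket_minus algebra_simps add_eq_0_iff)

lemma lie_generated_subalgebra: "lie_subalgebra (lie_generated X)"
  unfolding lie_generated_def lie_subalgebra_def by (auto intro!: cvec.subspace_Inter)

lemma lie_generated_base: "x \<in> X \<Longrightarrow> x \<in> lie_generated X"
  by (auto simp: lie_generated_def)

lemma lie_generated_least: "lie_subalgebra S \<Longrightarrow> X \<subseteq> S \<Longrightarrow> lie_generated X \<subseteq> S"
  by (auto simp: lie_generated_def)

lemma lie_subalgebraD:
  assumes "lie_subalgebra S"
  shows "cvec.subspace S" "x \<in> S \<Longrightarrow> y \<in> S \<Longrightarrow> x + y \<in> S" "x \<in> S \<Longrightarrow> k *\<^sub>C x \<in> S" "0 \<in> S"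
    "x \<in> S \<Longrightarrow> y \<in> S \<Longrightarrow> bracket x y \<in> S"
  using assms by (auto simp: lie_subalgebra_def cvec.subspace_add cvec.subspace_scale cvec.subspace_0)

text \<open>Stated for general X and Y so that it serves both nilpotent halves, with E and F
  exchanged. By the Leibniz rule, the elements of the generated subalgebra that all
  \<open>Y i\<close> send into its sum with the span of H form a subalgebra, and this contains the
  generators.\<close>

lemma lie_generated_stable:
  assumes YX: "\<And>i j. i \<in> I \<Longrightarrow> j \<in> I \<Longrightarrow> bracket (Y i) (X j) \<in> cvec.span (H ` I)"
    and HX: "\<And>i j. i \<in> I \<Longrightarrow> j \<in> I \<Longrightarrow> \<exists>a. bracket (H i) (X j) = a *\<^sub>C X j"
  shows "h \<in> cvec.span (H ` I) \<Longrightarrow> z \<in> lie_generated (X ` I) \<Longrightarrow> bracket h z \<in> lie_generated (X ` I)"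
    and "i \<in> I \<Longrightarrow> z \<in> lie_generated (X ` I) \<Longrightarrow>
      bracket (Y i) z \<in> cvec.span (cvec.span (H ` I) \<union> lie_generated (X ` I))"
proof -
  let ?n = "lie_generated (X ` I)" and ?h = "cvec.span (H ` I)"
  note n = lie_subalgebraD[OF lie_generated_subalgebra[of "X ` I"]]
  have 1: "?n \<subseteq> {z \<in> ?n. \<forall>i\<in>I. bracket (H i) z \<in> ?n}" (is "_ \<subseteq> ?T")
  proof (rule lie_generated_least)
    show "lie_subalgebra ?T"
      unfolding lie_subalgebra_def
      by (auto intro!: cvec.subspaceI n(2,3,4) intro: n(5) simp: bracket_add_right bracket_scaleC_right
          bracket_leibniz[of "H _"])
    show "X ` I \<subseteq> ?T"
      using HX by (force intro: lie_generated_base n)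
  qed
  show hn: "bracket h z \<in> ?n" if "h \<in> ?h" "z \<in> ?n" for h z
    by (rule bracket_span[OF that(1) cvec.span_base[OF that(2)] n(1)]) (use 1 in blast)
  let ?V = "cvec.span (?h \<union> ?n)"
  have Vn: "bracket v w \<in> ?n" if "v \<in> ?V" "w \<in> ?n" for v w
    by (rule bracket_span[OF that(1) cvec.span_base[OF that(2)] n(1)]) (auto intro: hn n)
  have nV: "?n \<subseteq> ?V" by (auto intro: cvec.span_base)
  have 2: "?n \<subseteq> {z \<in> ?n. \<forall>i\<in>I. bracket (Y i) z \<in> ?V}" (is "_ \<subseteq> ?T")
  proof (rule lie_generated_least)
    have *: "bracket (Y i) (bracket x y) \<in> ?V"
      if "i \<in> I" "x \<in> ?n" "y \<in> ?n" "bracket (Y i) x \<in> ?V" "bracket (Y i) y \<in> ?V" for i x y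
    proof -
      have "bracket (bracket (Y i) x) y \<in> ?n" by (intro Vn that)
      moreover have "bracket x (bracket (Y i) y) \<in> ?n"
        unfolding bracket_anti[of x] using Vn[OF that(5,2)] cvec.subspace_neg[OF n(1)] by blast
      ultimately show ?thesis unfolding bracket_leibniz[of "Y i"] using nV n(2) by blast
    qed
    show "lie_subalgebra ?T"
      unfolding lie_subalgebra_def
      by (auto intro!: cvec.subspaceI * n(2,3,4) intro: n(5) simp: bracket_add_right bracket_scaleC_right
          cvec.span_add cvec.span_scale cvec.span_zero)
    show "X ` I \<subseteq> ?T"
      using YX by (auto intro!: lie_generated_base intro: cvec.span_base)
  qed
  show "bracket (Y i) z \<in> ?V" if "i \<in> I" "z \<in> ?n" for i z
    using 2 that by blast
qed

locale principal_grading =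
  fixes I :: "'i set" and E H F :: "'i \<Rightarrow> 'g::complex_lie_algebra" and C :: "'i \<Rightarrow> 'i \<Rightarrow> complex"
    and rho p e :: 'g and \<hh> :: "'g set"
  assumes center_zero: "(\<And>x. bracket (z :: 'g) x = 0) \<Longrightarrow> z = 0"
    and generated: "lie_generated (E ` I \<union> H ` I \<union> F ` I) = UNIV"
    and rho_E: "i \<in> I \<Longrightarrow> bracket rho (E i) = E i"
    and rho_F: "i \<in> I \<Longrightarrow> bracket rho (F i) = - F i"
    and rho_H: "i \<in> I \<Longrightarrow> bracket rho (H i) = 0"
    and HH: "i \<in> I \<Longrightarrow> j \<in> I \<Longrightarrow> bracket (H i) (H j) = 0"
    and EF: "i \<in> I \<Longrightarrow> j \<in> I \<Longrightarrow> bracket (E i) (F j) = (if i = j then H i else 0)"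
    and HE: "i \<in> I \<Longrightarrow> j \<in> I \<Longrightarrow> bracket (H i) (E j) = C i j *\<^sub>C E j"
    and HF: "i \<in> I \<Longrightarrow> j \<in> I \<Longrightarrow> bracket (H i) (F j) = - (C i j *\<^sub>C F j)"
    and rho_p: "bracket rho p = - p" and rho_e: "bracket rho e = e"
    and e_p: "bracket e p = 2 *\<^sub>C rho"
    and cartan_subspace: "cvec.subspace \<hh>" and cartan_H: "H ` I \<subseteq> \<hh>"
    and cartan_nilpotent: "x \<in> \<hh> \<Longrightarrow> \<exists>k. (bracket rho ^^ k) x = 0"
begin

definition homogeneous :: "int \<Rightarrow> 'g \<Rightarrow> bool" where
  "homogeneous j x \<longleftrightarrow> bracket rho x = of_int j *\<^sub>C x"

lemma homogeneous_bracket: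
  "homogeneous i x \<Longrightarrow> homogeneous j y \<Longrightarrow> homogeneous (i + j) (bracket x y)"
  by (simp add: homogeneous_def bracket_leibniz[of rho] bracket_scaleC_left bracket_scaleC_right
      cvec.scale_left_distrib)

lemma homogeneous_E: "i \<in> I \<Longrightarrow> homogeneous 1 (E i)"
  and homogeneous_F: "i \<in> I \<Longrightarrow> homogeneous (- 1) (F i)"
  and homogeneous_H: "i \<in> I \<Longrightarrow> homogeneous 0 (H i)"
  and homogeneous_p: "homogeneous (- 1) p"
  and homogeneous_e: "homogeneous 1 e"
  by (simp_all add: homogeneous_def rho_E rho_F rho_H rho_p rho_e)

text \<open>Brackets of eigenvectors of ad \<open>rho\<close> are again eigenvectors, and so are the
  generators. Thus ad \<open>rho\<close> is diagonalisable with integer eigenvalues.\<close>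

lemma span_homogeneous: "cvec.span {x. \<exists>j. homogeneous j x} = UNIV" (is "cvec.span ?S = _")
proof -
  have "lie_subalgebra (cvec.span ?S)"
    unfolding lie_subalgebra_def
    by (intro conjI ballI cvec.subspace_span, rule bracket_span[of _ ?S _ ?S])
       (auto intro!: cvec.span_base dest: homogeneous_bracket)
  moreover have "E ` I \<union> H ` I \<union> F ` I \<subseteq> cvec.span ?S"
    using homogeneous_E homogeneous_F homogeneous_H by (blast intro: cvec.span_base)
  ultimately show ?thesis using lie_generated_least generated by blast
qed

definition hbasis :: "'g set" where
  "hbasis = (SOME B. B \<subseteq> {x. \<exists>j. homogeneous j x} \<and> cvec.independent B \<and> cvec.span B = UNIV)"

definition deg :: "'g \<Rightarrow> int" where
  "deg b = (SOME j. homogeneous j b)"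

definition height :: nat where
  "height = (SOME m. \<forall>b\<in>hbasis. \<bar>deg b\<bar> \<le> int m)"

text \<open>The sum of the eigenspaces of ad \<open>rho\<close> with eigenvalue in \<open>K\<close>;
  sets of degrees cover the filtration, the negative half and degree zero at once.\<close>

definition wspace :: "int set \<Rightarrow> 'g set" where
  "wspace K = cvec.span {b \<in> hbasis. deg b \<in> K}"

abbreviation filt :: "int \<Rightarrow> 'g set" where
  "filt k \<equiv> wspace {k..}"

lemma hbasis:
  "hbasis \<subseteq> {x. \<exists>j. homogeneous j x}" "cvec.independent hbasis" "cvec.span hbasis = UNIV"
proof -
  obtain B where B: "B \<subseteq> {x. \<exists>j. homogeneous j x}" "cvec.independent B"
    "{x. \<exists>j. homogeneous j x} \<subseteq> cvec.span B"
    using cvec.maximal_independent_subset by blast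
  then have "cvec.span B = UNIV"
    using span_homogeneous cvec.span_minimal[OF B(3) cvec.subspace_span] by auto
  with B have "\<exists>B. B \<subseteq> {x. \<exists>j. homogeneous j x} \<and> cvec.independent B \<and> cvec.span B = UNIV"
    by blast
  from someI_ex[OF this] show "hbasis \<subseteq> {x. \<exists>j. homogeneous j x}" "cvec.independent hbasis"
    "cvec.span hbasis = UNIV" unfolding hbasis_def by auto
qed

lemma finite_hbasis: "finite hbasis"
  using cvec.independent_span_bound[OF lie_basis(1) hbasis(2)] by (simp add: lie_basis(3))

lemma deg: "b \<in> hbasis \<Longrightarrow> homogeneous (deg b) b"
  unfolding deg_def by (rule someI_ex) (use hbasis(1) in auto)

lemma height: "b \<in> hbasis \<Longrightarrow> \<bar>deg b\<bar> \<le> int height"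
proof -
  have "\<bar>deg b\<bar> \<le> Max ((\<lambda>b. \<bar>deg b\<bar>) ` hbasis)" if "b \<in> hbasis" for b
    using finite_hbasis that by (intro Max_ge) auto
  then have "\<forall>b\<in>hbasis. \<bar>deg b\<bar> \<le> int (nat (Max ((\<lambda>b. \<bar>deg b\<bar>) ` hbasis)))"
    by fastforce
  then have "\<exists>m. \<forall>b\<in>hbasis. \<bar>deg b\<bar> \<le> int m" by blast
  from someI_ex[OF this] show "b \<in> hbasis \<Longrightarrow> \<bar>deg b\<bar> \<le> int height"
    unfolding height_def by blast
qed

lemma wspace_subspace: "cvec.subspace (wspace K)"
  by (simp add: wspace_def)

lemma wspace_mono: "K \<subseteq> K' \<Longrightarrow> wspace K \<subseteq> wspace K'"
  unfolding wspace_def by (intro cvec.span_mono) auto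

lemma wspace_disjoint:
  assumes "K \<inter> K' = {}" "x \<in> wspace K" "x \<in> wspace K'"
  shows "x = 0"
proof -
  let ?r = "cvec.representation hbasis x"
  have "?r b = 0" for b
  proof (rule ccontr)
    assume nz: "?r b \<noteq> 0"
    have "deg b \<in> L" if "x \<in> wspace L" for L
      using nz cvec.representation_extend[OF hbasis(2), of x "{b \<in> hbasis. deg b \<in> L}"] that
        cvec.representation_ne_zero[of "{b \<in> hbasis. deg b \<in> L}" x b]
      by (auto simp: wspace_def)
    with assms show False by blast
  qed
  moreover have "(\<Sum>b\<in>hbasis. ?r b *\<^sub>C b) = x"
    by (rule cvec.sum_representation_eq) (simp_all add: hbasis finite_hbasis)
  ultimately show ?thesis by simp
qed

text \<open>Applying ad \<open>rho\<close> - k to the expansion in \<open>hbasis\<close> multiplies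
  each coefficient by its degree minus k, so by independence only those of degree k are
  nonzero.\<close>

lemma homogeneous_wspace:
  assumes "homogeneous k x"
  shows "x \<in> wspace {k}"
proof -
  obtain r where x: "x = (\<Sum>b\<in>hbasis. r b *\<^sub>C b)"
    using cvec.sum_representation_eq[OF hbasis(2) _ finite_hbasis subset_refl, of x] hbasis(3)
    by (metis UNIV_I)
  have "0 = bracket rho x - of_int k *\<^sub>C x"
    using assms by (simp add: homogeneous_def)
  also have "\<dots> = (\<Sum>b\<in>hbasis. (r b * (of_int (deg b) - of_int k)) *\<^sub>C b)"
    unfolding x bracket_sum_right cvec.scale_sum_right sum_subtractf[symmetric]
  proof (rule sum.cong[OF refl])
    fix b assume "b \<in> hbasis"
    from deg[OF this] show "bracket rho (r b *\<^sub>C b) - of_int k *\<^sub>C r b *\<^sub>C b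
        = (r b * (of_int (deg b) - of_int k)) *\<^sub>C b"
      by (simp add: homogeneous_def bracket_scaleC_right right_diff_distrib cvec.scale_left_diff_distrib
          mult.commute)
  qed
  finally have rz: "r b * (of_int (deg b) - of_int k) = 0" if "b \<in> hbasis" for b
    using cvec.independentD[OF hbasis(2) finite_hbasis subset_refl _ that] by metis
  have "r b *\<^sub>C b \<in> wspace {k}" if "b \<in> hbasis" for b
  proof (cases "deg b = k")
    case True
    then show ?thesis using that unfolding wspace_def by (intro cvec.span_scale cvec.span_base) simp
  next
    case False
    then have "r b = 0" using rz[OF that] by simp
    then show ?thesis by (simp add: cvec.subspace_0[OF wspace_subspace])
  qed
  then show ?thesis unfolding x by (rule cvec.subspace_sum[OF wspace_subspace])
qed

lemma homogeneous_wspace': "homogeneous k x \<Longrightarrow> k \<in> K \<Longrightarrow> x \<in> wspace K"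
  using homogeneous_wspace wspace_mono[of "{k}" K] by auto

lemma wspace_bracket:
  assumes "x \<in> wspace K" "y \<in> wspace K'" "\<And>i j. i \<in> K \<Longrightarrow> j \<in> K' \<Longrightarrow> i + j \<in> L"
  shows "bracket x y \<in> wspace L"
  using assms(1,2) unfolding wspace_def[of K] wspace_def[of K']
  by (rule bracket_span) (auto intro!: wspace_subspace homogeneous_wspace' homogeneous_bracket deg assms(3))

lemma filt_rho:
  assumes "x \<in> filt k"
  shows "bracket rho x - of_int k *\<^sub>C x \<in> filt (k + 1)"
  using assms unfolding wspace_def[of "{k..}"]
proof (induct rule: cvec.span_induct_alt)
  case base
  show ?case by (simp add: cvec.subspace_0[OF wspace_subspace])
next
  case (step a b y)
  then have b: "b \<in> hbasis" "deg b \<ge> k" by auto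
  have "(of_int (deg b) - of_int k) *\<^sub>C b \<in> filt (k + 1)"
  proof (cases "deg b = k")
    case False
    then show ?thesis
      using b unfolding wspace_def by (intro cvec.span_scale cvec.span_base) auto
  qed (simp add: cvec.subspace_0[OF wspace_subspace])
  then have "a *\<^sub>C ((of_int (deg b) - of_int k) *\<^sub>C b) + (bracket rho y - of_int k *\<^sub>C y) \<in> filt (k + 1)"
    by (rule cvec.subspace_add[OF wspace_subspace cvec.subspace_scale[OF wspace_subspace] step(2)])
  moreover have "bracket rho (a *\<^sub>C b + y) - of_int k *\<^sub>C (a *\<^sub>C b + y)
      = a *\<^sub>C ((of_int (deg b) - of_int k) *\<^sub>C b) + (bracket rho y - of_int k *\<^sub>C y)"
    using deg[OF b(1)]
    by (simp add: homogeneous_def bracket_add_right bracket_scaleC_right cvec.scale_right_distrib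
        cvec.scale_left_diff_distrib algebra_simps)
  ultimately show ?case by simp
qed

sublocale g: sl2_filtered_lie "scaleC :: complex \<Rightarrow> 'g \<Rightarrow> 'g" bracket rho filt height p e
proof unfold_locales
  show "filt (- int height) = UNIV"
  proof -
    have "{b \<in> hbasis. deg b \<in> {- int height..}} = hbasis" using height by force
    then show ?thesis by (simp add: wspace_def hbasis(3))
  qed
  show "filt (int height + 1) = {0}"
  proof -
    have *: "{b \<in> hbasis. deg b \<in> {int height + 1..}} = {}" using height by force
    show ?thesis unfolding wspace_def * by simp
  qed
  show "z = 0" if "\<And>x. bracket z x = 0" for z :: 'g by (rule center_zero) (rule that)
qed (auto simp: bracket_add_left bracket_add_right bracket_scaleC_left bracket_scaleC_right
    bracket_self jacobi wspace_subspace e_p filt_rho wspace_mono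
    intro: wspace_bracket homogeneous_wspace'[OF homogeneous_p] homogeneous_wspace'[OF homogeneous_e]
    elim!: wspace_mono[THEN subsetD, rotated])

section \<open>Triangular decomposition, nilradical and Borel subalgebra\<close>

lemma wspace_subalgebra:
  assumes "\<And>i j. i \<in> K \<Longrightarrow> j \<in> K \<Longrightarrow> i + j \<in> K"
  shows "lie_subalgebra (wspace K)"
  unfolding lie_subalgebra_def using wspace_subspace wspace_bracket[OF _ _ assms] by blast

lemma generated_E_wspace: "lie_generated (E ` I) \<subseteq> filt 1"
  by (rule lie_generated_least[OF wspace_subalgebra])
     (auto intro: homogeneous_wspace'[OF homogeneous_E])

lemma generated_F_wspace: "lie_generated (F ` I) \<subseteq> wspace {..- 1}"
  by (rule lie_generated_least[OF wspace_subalgebra])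
     (auto intro: homogeneous_wspace'[OF homogeneous_F])

lemma span_H_wspace: "cvec.span (H ` I) \<subseteq> wspace {0}"
  by (rule cvec.span_minimal[OF _ wspace_subspace])
     (auto intro: homogeneous_wspace'[OF homogeneous_H])

text \<open>The sum of the three pieces is stable under the generators, hence an ideal, hence everything.\<close>

lemma triangular:
  obtains a y z where "x = a + y + z" "a \<in> wspace {..- 1}" "y \<in> cvec.span (H ` I)"
    "z \<in> lie_generated (E ` I)"
proof -
  let ?n = "lie_generated (E ` I)" and ?m = "lie_generated (F ` I)" and ?h = "cvec.span (H ` I)"
  note n = lie_subalgebraD[OF lie_generated_subalgebra[of "E ` I"]]
  note m = lie_subalgebraD[OF lie_generated_subalgebra[of "F ` I"]]
  have FE: "bracket (F i) (E j) \<in> ?h" if "i \<in> I" "j \<in> I" for i j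
    using EF[OF that(2,1)] that unfolding bracket_anti[of "F i"]
    by (auto intro: cvec.span_neg cvec.span_base cvec.span_zero)
  have EF': "bracket (E i) (F j) \<in> ?h" if "i \<in> I" "j \<in> I" for i j
    using EF[OF that] that by (auto intro: cvec.span_base cvec.span_zero)
  have HE': "\<exists>a. bracket (H i) (E j) = a *\<^sub>C E j" if "i \<in> I" "j \<in> I" for i j
    using HE[OF that] by blast
  have HF': "\<exists>a. bracket (H i) (F j) = a *\<^sub>C F j" if "i \<in> I" "j \<in> I" for i j
    using HF[OF that] by (intro exI[of _ "- C i j"]) simp
  note sn = lie_generated_stable[of I F E H, OF FE HE', simplified]
  note sm = lie_generated_stable[of I E F H, OF EF' HF', simplified]
  let ?S = "cvec.span ((?m \<union> ?h) \<union> ?n)"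
  have sub: "cvec.subspace ?S" by simp
  have mS: "?m \<subseteq> ?S" and hS: "?h \<subseteq> ?S" and nS: "?n \<subseteq> ?S"
    using cvec.span_superset[of "(?m \<union> ?h) \<union> ?n"] by blast+
  have hn: "cvec.span (?h \<union> ?n) \<subseteq> ?S" and hm: "cvec.span (?h \<union> ?m) \<subseteq> ?S"
    by (rule cvec.span_mono, blast)+
  have st: "bracket g s \<in> ?S" if "s \<in> ?S" and *: "\<And>t. t \<in> ?m \<union> ?h \<union> ?n \<Longrightarrow> bracket g t \<in> ?S" for g s
    by (rule bracket_span[OF cvec.span_base[of g "{g}"] that(1) sub]) (use * in auto)
  have h0: "bracket (H i) y = 0" if "i \<in> I" "y \<in> ?h" for i y
  proof -
    have "bracket (H i) y \<in> {0}"
      by (rule bracket_span[OF cvec.span_base[of _ "{H i}"] that(2)]) (use that in \<open>auto simp: HH\<close>)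
    then show ?thesis by simp
  qed
  have stE: "bracket (E i) s \<in> ?S" if i: "i \<in> I" and s: "s \<in> ?S" for i s
  proof (rule st[OF s])
    fix t assume "t \<in> ?m \<union> ?h \<union> ?n"
    moreover have "bracket (E i) t \<in> ?S" if "t \<in> ?m" using sm(2)[OF i that] hm by blast
    moreover have "bracket (E i) t \<in> ?S" if "t \<in> ?h"
      using sn(1)[OF that lie_generated_base[of "E i"]] i nS cvec.subspace_neg[OF n(1)]
      unfolding bracket_anti[of "E i"] by blast
    moreover have "bracket (E i) t \<in> ?S" if "t \<in> ?n"
      using n(5)[OF lie_generated_base[of "E i"] that] i nS by blast
    ultimately show "bracket (E i) t \<in> ?S" by blast
  qed
  have stF: "bracket (F i) s \<in> ?S" if i: "i \<in> I" and s: "s \<in> ?S" for i s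
  proof (rule st[OF s])
    fix t assume "t \<in> ?m \<union> ?h \<union> ?n"
    moreover have "bracket (F i) t \<in> ?S" if "t \<in> ?n" using sn(2)[OF i that] hn by blast
    moreover have "bracket (F i) t \<in> ?S" if "t \<in> ?h"
      using sm(1)[OF that lie_generated_base[of "F i"]] i mS cvec.subspace_neg[OF m(1)]
      unfolding bracket_anti[of "F i"] by blast
    moreover have "bracket (F i) t \<in> ?S" if "t \<in> ?m"
      using m(5)[OF lie_generated_base[of "F i"] that] i mS by blast
    ultimately show "bracket (F i) t \<in> ?S" by blast
  qed
  have stH: "bracket (H i) s \<in> ?S" if i: "i \<in> I" and s: "s \<in> ?S" for i s
  proof (rule st[OF s])
    have Hi: "H i \<in> ?h" using i by (auto intro: cvec.span_base)
    fix t assume "t \<in> ?m \<union> ?h \<union> ?n"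
    moreover have "bracket (H i) t \<in> ?S" if "t \<in> ?n" using sn(1)[OF Hi that] nS by blast
    moreover have "bracket (H i) t \<in> ?S" if "t \<in> ?h" using h0[OF i that] by (simp add: cvec.span_zero)
    moreover have "bracket (H i) t \<in> ?S" if "t \<in> ?m" using sm(1)[OF Hi that] mS by blast
    ultimately show "bracket (H i) t \<in> ?S" by blast
  qed
  \<comment> \<open>The stabiliser of the sum is a subalgebra containing the generators, so it is
    the whole algebra.\<close>
  have "lie_subalgebra {g. \<forall>s\<in>?S. bracket g s \<in> ?S}"
    unfolding lie_subalgebra_def
  proof (intro conjI ballI)
    show "cvec.subspace {g. \<forall>s\<in>?S. bracket g s \<in> ?S}"
      by (rule cvec.subspaceI) (auto simp: bracket_add_left bracket_scaleC_left cvec.span_zero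
          intro: cvec.span_add cvec.span_scale)
    fix x y assume *: "x \<in> {g. \<forall>s\<in>?S. bracket g s \<in> ?S}" "y \<in> {g. \<forall>s\<in>?S. bracket g s \<in> ?S}"
    have "bracket (bracket x y) s \<in> ?S" if "s \<in> ?S" for s
    proof -
      have "bracket (bracket x y) s = bracket x (bracket y s) - bracket y (bracket x s)"
        by (simp add: bracket_leibniz[of x y])
      moreover have "bracket x (bracket y s) \<in> ?S" "bracket y (bracket x s) \<in> ?S"
        using * that by blast+
      ultimately show ?thesis by (simp only: cvec.span_diff)
    qed
    then show "bracket x y \<in> {g. \<forall>s\<in>?S. bracket g s \<in> ?S}" by blast
  qed
  then have "lie_generated (E ` I \<union> H ` I \<union> F ` I) \<subseteq> {g. \<forall>s\<in>?S. bracket g s \<in> ?S}"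
    by (rule lie_generated_least) (use stE stF stH in blast)
  \<comment> \<open>Being stable under everything, the sum is in particular closed under its own
    bracket.\<close>
  then have "lie_subalgebra ?S"
    unfolding lie_subalgebra_def generated by auto
  then have "lie_generated (E ` I \<union> H ` I \<union> F ` I) \<subseteq> ?S"
  proof (rule lie_generated_least)
    have "E ` I \<subseteq> ?n" "F ` I \<subseteq> ?m" "H ` I \<subseteq> ?h"
      by (auto intro: lie_generated_base cvec.span_base)
    then show "E ` I \<union> H ` I \<union> F ` I \<subseteq> ?S" using nS mS hS by blast
  qed
  then have "x \<in> ?S" unfolding generated by (rule subsetD) (rule UNIV_I)
  then obtain w z where wz: "x = w + z" "w \<in> cvec.span (?m \<union> ?h)" "z \<in> ?n"
    unfolding cvec.span_Un[of "?m \<union> ?h"] cvec.span_eq_iff[THEN iffD2, OF n(1)] by auto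
  then obtain a y where "w = a + y" "a \<in> ?m" "y \<in> ?h"
    unfolding cvec.span_Un[of ?m] cvec.span_eq_iff[THEN iffD2, OF m(1)] cvec.span_span by blast
  with wz generated_F_wspace that show ?thesis by blast
qed

text \<open>Removing from an element of positive degree its component in the generated subalgebra
  leaves something of both positive and nonpositive degree, hence zero.\<close>

lemma generated_E_eq: "lie_generated (E ` I) = filt 1"
proof
  show "filt 1 \<subseteq> lie_generated (E ` I)"
  proof
    fix x assume x: "x \<in> filt 1"
    obtain a y z where *: "x = a + y + z" "a \<in> wspace {..- 1}" "y \<in> cvec.span (H ` I)"
      "z \<in> lie_generated (E ` I)" by (rule triangular)
    have "a \<in> wspace {..0}" using *(2) wspace_mono[of "{..- 1}" "{..0}"] by auto
    moreover have "y \<in> wspace {..0}" using *(3) span_H_wspace wspace_mono[of "{0}" "{..0}"] by auto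
    ultimately have "a + y \<in> wspace {..0}" by (rule cvec.subspace_add[OF wspace_subspace])
    moreover have "x - z \<in> filt 1"
      using *(4) generated_E_wspace x by (blast intro: cvec.subspace_diff[OF wspace_subspace])
    then have "a + y \<in> filt 1" using *(1) by simp
    ultimately have "a + y = 0" by (rule_tac wspace_disjoint[of "{..0}" "{1..}"]) auto
    then show "x \<in> lie_generated (E ` I)" using * by simp
  qed
qed (rule generated_E_wspace)

text \<open>On the quotient of negative degree l, ad \<open>rho\<close> acts as the nonzero number
  l, whereas some power of it kills a given element of \<hh>; so that element has no component of
  negative degree.\<close>

lemma cartan_filt: "\<hh> \<subseteq> filt 0"
proof
  fix x assume "x \<in> \<hh>"
  then obtain k where k: "(bracket rho ^^ k) x = 0" using cartan_nilpotent by blast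
  have pow: "(bracket rho ^^ k) x - of_int (l ^ k) *\<^sub>C x \<in> filt (l + 1)" if "x \<in> filt l" for l k
  proof (induct k)
    case 0
    show ?case by (simp add: cvec.subspace_0[OF wspace_subspace])
  next
    case (Suc k)
    have "(bracket rho ^^ Suc k) x - of_int (l ^ Suc k) *\<^sub>C x
        = bracket rho ((bracket rho ^^ k) x - of_int (l ^ k) *\<^sub>C x)
          + of_int (l ^ k) *\<^sub>C (bracket rho x - of_int l *\<^sub>C x)"
      by (simp add: bracket_diff bracket_scaleC_right cvec.scale_right_diff_distrib mult.commute)
    moreover have "bracket rho ((bracket rho ^^ k) x - of_int (l ^ k) *\<^sub>C x) \<in> filt (l + 1)"
      using g.F_br[OF g.rho_F Suc] by simp
    ultimately show ?case using g.F_add g.F_scale filt_rho[OF that] by metis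
  qed
  have step: "x \<in> filt (l + 1)" if "l < 0" "x \<in> filt l" for l
  proof (rule g.F_scale_cancel)
    show "of_int (l ^ k) *\<^sub>C x \<in> filt (l + 1)" using g.F_neg[OF pow[OF that(2), of k]] k by simp
    show "of_int (l ^ k) \<noteq> (0 :: complex)" using that(1) by simp
  qed
  have "x \<in> filt (- int height)" unfolding g.F_low by simp
  then show "x \<in> filt 0" by (rule g.F_climb) (use step in auto)
qed

lemma borel_eq: "{x + y | x y. x \<in> \<hh> \<and> y \<in> lie_generated (E ` I)} = filt 0"
proof (intro equalityI subsetI)
  fix x assume x: "x \<in> filt 0"
  obtain a y z where *: "x = a + y + z" "a \<in> wspace {..- 1}" "y \<in> cvec.span (H ` I)"
    "z \<in> lie_generated (E ` I)" by (rule triangular)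
  have y: "y \<in> \<hh>" using *(3) cvec.span_minimal[OF cartan_H cartan_subspace] by blast
  have "z \<in> filt 0" using *(4) generated_E_wspace wspace_mono[of "{1..}" "{0..}"] by auto
  then have "x - y - z \<in> filt 0"
    using x y cartan_filt by (blast intro: cvec.subspace_diff[OF wspace_subspace])
  then have "a = 0" using *(1,2) by (intro wspace_disjoint[of "{..- 1}" "{0..}"]) auto
  with * y show "x \<in> {x + y | x y. x \<in> \<hh> \<and> y \<in> lie_generated (E ` I)}" by auto
next
  fix x assume "x \<in> {x + y | x y. x \<in> \<hh> \<and> y \<in> lie_generated (E ` I)}"
  then show "x \<in> filt 0"
    using cartan_filt generated_E_wspace wspace_mono[of "{1..}" "{0..}"] cvec.subspace_add[OF wspace_subspace]
    by fastforce
qed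

section \<open>The group N as the group of unipotent automorphisms\<close>

lemma power_bracket_high:
  assumes "x \<in> filt 1" "2 * height < n"
  shows "(bracket x ^^ n) y = 0"
  using g.dexp_high[OF assms, of y] by (simp add: g.dexp_def)

lemma exp_ad_eq:
  assumes "x \<in> filt 1"
  shows "exp_ad x = g.expo x" "ad_nilpotent x"
proof -
  have *: "bracket x ^^ n = (\<lambda>_. 0)" if "2 * height < n" for n
    using power_bracket_high[OF assms that] by blast
  then show "ad_nilpotent x" unfolding ad_nilpotent_def by blast
  show "exp_ad x = g.expo x"
  proof
    fix y
    have "exp_ad x y = (\<Sum>n\<le>2 * height. (1 / fact n) *\<^sub>C (bracket x ^^ n) y)"
      unfolding exp_ad_def
    proof (rule sum.mono_neutral_left)
      show "{k. bracket x ^^ k \<noteq> (\<lambda>_. 0)} \<subseteq> {..2 * height}" using * by force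
    qed auto
    then show "exp_ad x y = g.expo x y" by (simp add: g.expo_def g.dexp_def)
  qed
qed

text \<open>For the harder inclusion, exponentials are peeled off: composing with a suitable one
  removes the leading term of \<open>\<phi> rho - rho\<close>. After finitely many steps
  \<open>rho\<close> is fixed, and \<open>unip_eq_id\<close> applies.\<close>

lemma exp_group_eq: "exp_group (filt 1) = {\<phi>. g.unip \<phi>}"
proof (intro equalityI subsetI CollectI; (elim CollectE)?)
  fix \<phi> assume "\<phi> \<in> exp_group (filt 1)"
  then show "g.unip \<phi>"
  proof induct
    case (exp x \<psi>)
    show ?case
      unfolding exp_ad_eq(1)[OF exp(1)] by (rule g.unip_comp[OF g.unip_expo[OF exp(1)] exp(4)])
  qed (rule g.unip_id)
next
  have main: "\<forall>\<phi>. g.unip \<phi> \<and> \<phi> rho - rho \<in> filt k \<longrightarrow> 1 \<le> k \<longrightarrow> \<phi> \<in> exp_group (filt 1)"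
    if "k \<le> int height + 1" for k
    using that
  proof (induct k rule: int_le_induct)
    case base
    show ?case
    proof (intro allI impI; elim conjE)
      fix \<phi> assume "g.unip \<phi>" "\<phi> rho - rho \<in> filt (int height + 1)"
      then have "\<phi> = id" unfolding g.F_high by (intro g.unip_eq_id) auto
      then show "\<phi> \<in> exp_group (filt 1)" by (simp add: exp_group.id)
    qed
  next
    case (step k)
    show ?case
    proof (intro allI impI; elim conjE)
      fix \<phi> assume \<phi>: "g.unip \<phi>" and r: "\<phi> rho - rho \<in> filt (k - 1)" and k: "1 \<le> k - 1"
      define r where "r = \<phi> rho - rho"
      \<comment> \<open>Modulo \<open>filt k\<close>, [y, rho] = -(k - 1) y = -r, so the first-order
        effect of \<open>expo y\<close> on \<open>rho\<close> cancels \<open>r\<close>. The degree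
        is k - 1 because the induction runs downwards.\<close>
      define y where "y = (1 / of_int (k - 1)) *\<^sub>C r"
      have r: "r \<in> filt (k - 1)" using r by (simp add: r_def)
      have yk: "y \<in> filt (k - 1)" unfolding y_def by (rule g.F_scale[OF r])
      have y1: "y \<in> filt 1" by (rule g.F_mono[OF yk k])
      have ry: "r = of_int (k - 1) *\<^sub>C y" using k by (simp add: y_def)
      have 1: "g.expo y rho - rho - bracket y rho \<in> filt k"
        by (rule g.F_mono[OF g.expo_order[OF yk k g.rho_F]]) (use k in simp)
      have 2: "g.expo y r - r \<in> filt k"
        using g.unipD(3)[OF g.unip_expo[OF y1] r] by simp
      have 3: "bracket rho y - of_int (k - 1) *\<^sub>C y \<in> filt k"
        using filt_rho[OF yk] by simp
      have "(g.expo y \<circ> \<phi>) rho = g.expo y (rho + r)" by (simp add: r_def)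
      then have *: "(g.expo y \<circ> \<phi>) rho - rho
          = (g.expo y rho - rho - bracket y rho) + (g.expo y r - r) - (bracket rho y - of_int (k - 1) *\<^sub>C y)"
        using bracket_anti[of y rho] ry by (simp add: g.unip_add[OF g.unip_expo[OF y1]])
      have "(g.expo y \<circ> \<phi>) rho - rho \<in> filt k"
        unfolding * by (rule g.F_diff[OF g.F_add[OF 1 2] 3])
      with step(2) k g.unip_comp[OF g.unip_expo[OF y1] \<phi>]
      have "g.expo y \<circ> \<phi> \<in> exp_group (filt 1)" by auto
      from exp_group.exp[OF g.F_neg[OF y1] exp_ad_eq(2)[OF g.F_neg[OF y1]] this]
      have "g.expo (- y) \<circ> (g.expo y \<circ> \<phi>) \<in> exp_group (filt 1)"
        by (simp add: exp_ad_eq(1)[OF g.F_neg[OF y1]])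
      moreover have "g.expo (- y) \<circ> (g.expo y \<circ> \<phi>) = \<phi>"
        using g.expo_minus[OF y1] by auto
      ultimately show "\<phi> \<in> exp_group (filt 1)" by simp
    qed
  qed
  fix \<phi> assume \<phi>: "g.unip \<phi>"
  have "\<phi> rho - rho \<in> filt 1" using g.unipD(3)[OF \<phi> g.rho_F] by simp
  then show "\<phi> \<in> exp_group (filt 1)" using main[of 1] \<phi> by simp
qed

text \<open>The composite of ad p and ad e maps \<open>filt k\<close> injectively to itself, hence
  onto by finite dimension. Solving [e, x] = [e, [p, Y]] puts x - [p, Y] into the kernel of ad e.
  The dimension count is made over the complex numbers; pure tensors carry the result to rational
  coefficients.\<close>

lemma centralizer_complement:
  assumes k: "1 \<le> k" and x: "x \<in> filt (k - 1)"
  shows "\<exists>a\<in>{a \<in> filt 0. bracket e a = 0}. \<exists>Y\<in>filt k. x = a + bracket p Y"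
proof -
  interpret fd: finite_dimensional_vector_space_pair_1 "scaleC :: complex \<Rightarrow> 'g \<Rightarrow> 'g"
    "lie_basis :: 'g set" "scaleC :: complex \<Rightarrow> 'g \<Rightarrow> 'g"
    by unfold_locales (rule lie_basis)+
  define \<tau> where "\<tau> = (\<lambda>Y. bracket e (bracket p Y))"
  have lin: "Vector_Spaces.linear scaleC scaleC \<tau>"
    unfolding \<tau>_def by (rule g.linear_I) (simp_all add: bracket_add_right bracket_scaleC_right)
  then interpret L: Vector_Spaces.linear scaleC scaleC \<tau> .
  have into: "\<tau> ` filt k \<subseteq> filt k"
  proof
    fix z assume "z \<in> \<tau> ` filt k"
    then obtain Y where "z = \<tau> Y" "Y \<in> filt k" by blast
    then show "z \<in> filt k" using g.F_br[OF g.e_F g.F_br[OF g.p_F, of Y k]] by (simp add: \<tau>_def)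
  qed
  have "Y = 0" if "Y \<in> filt k" "\<tau> Y = 0" for Y
    using that g.sl2_inj_zero[of Y] g.F_mono[OF that(1) k] by (simp add: \<tau>_def)
  then have inj: "inj_on \<tau> (cvec.span (filt k))"
    unfolding L.inj_on_iff_eq_0[OF wspace_subspace] cvec.span_eq_iff[THEN iffD2, OF wspace_subspace] by blast
  have "cvec.dim (\<tau> ` filt k) = cvec.dim (filt k)"
    by (rule fd.dim_image_eq[OF lin inj])
  then have "\<tau> ` filt k = filt k"
    using fd.vs1.subspace_dim_equal[OF L.subspace_image[OF wspace_subspace] wspace_subspace into] by simp
  moreover have "bracket e x \<in> filt k" using g.F_br[OF g.e_F x] by simp
  ultimately obtain Y where Y: "Y \<in> filt k" "bracket e x = bracket e (bracket p Y)"
    unfolding \<tau>_def by (metis imageE)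
  have "bracket p Y \<in> filt (k - 1)" using g.F_br[OF g.p_F Y(1)] by simp
  then have "x - bracket p Y \<in> filt 0" using g.F_mono[OF g.F_diff[OF x]] k by simp
  then show ?thesis
    using Y by (intro bexI[of _ "x - bracket p Y"] bexI[of _ Y]) (auto simp: bracket_diff)
qed

end

section \<open>Opers\<close>

lemma ratconst_numeral [simp]: "ratconst (numeral n) = numeral n"
  using ratconst_of_nat[of "numeral n"] by simp

lemma tensor_map_id_tensor: "clin \<theta> \<Longrightarrow> tensor_map id \<theta> (x \<otimes> f) = x \<otimes> \<theta> f"
  using tensor_map_tensor[OF linear_cid] by simp

lemma bracketM_mer_of:
  assumes u: "u \<in> mer_of S" and v: "v \<in> mer_of T"
    and *: "\<And>x y. x \<in> S \<Longrightarrow> y \<in> T \<Longrightarrow> bracket x y \<in> V"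
  shows "bracketM u v \<in> mer_of V"
proof -
  note V = mvec.subspace_add[OF mer_of_subspace, of _ V] mvec.subspace_0[OF mer_of_subspace, of V]
  have z: "bracketM 0 w = 0" "bracketM w 0 = 0" for w :: "'a mer"
    using bracketM_add_left[of 0 0 w] bracketM_add_right[of w 0 0] by simp_all
  have 1: "bracketM (x \<otimes> f) v \<in> mer_of V" if "x \<in> S" for x f
    using v by (induct rule: mer_of_induct)
      (simp_all add: z V bracketM_tensor bracketM_add_right tensor_mer_of * that)
  show ?thesis
    using u by (induct rule: mer_of_induct) (simp_all add: z V bracketM_add_left 1)
qed

section \<open>Differentiation of Lie algebra valued functions\<close>

definition deriv_mer :: "'g::complex_lie_algebra mer \<Rightarrow> 'g mer" where
  "deriv_mer = tensor_map id rat_deriv"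

lemma deriv_mer_tensor: "deriv_mer (x \<otimes> f) = x \<otimes> rat_deriv f"
  unfolding deriv_mer_def by (rule tensor_map_id_tensor[OF clin_deriv])

lemma deriv_mer_add: "deriv_mer (u + v) = deriv_mer u + deriv_mer v"
  unfolding deriv_mer_def by (rule tensor_map_add[OF clin_deriv])

lemma deriv_mer_0: "deriv_mer 0 = 0"
  using deriv_mer_add[of 0 0] by simp

lemma deriv_mer_scale: "deriv_mer (scaleM f u) = scaleM (rat_deriv f) u + scaleM f (deriv_mer u)"
  by (induct u rule: mer_induct)
     (simp_all add: deriv_mer_tensor deriv_mer_add rat_deriv_mult tensor_add_right mvec.scale_right_distrib)

lemma deriv_mer_bracket: "deriv_mer (bracketM u v) = bracketM (deriv_mer u) v + bracketM u (deriv_mer v)"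
proof (induct u rule: mer_induct)
  case (tensor x f)
  show ?case
    by (induct v rule: mer_induct)
       (simp_all add: deriv_mer_tensor deriv_mer_add bracketM_tensor rat_deriv_mult tensor_add_right
         bracketM_add_right)
qed (simp add: deriv_mer_add bracketM_add_left)

lemma deriv_mer_1: "deriv_mer (x \<otimes> 1) = 0"
  using rat_deriv_const[of 1] by (simp add: deriv_mer_tensor)

lemma mer_linear_regular:
  assumes g: "mer_linear g" and z: "\<And>b. b \<in> lie_basis \<Longrightarrow> mer_regular (g b) z"
  shows "mer_regular (g x) z"
proof -
  have "g x = (\<Sum>b\<in>lie_basis. scaleM (ratconst (rep x b)) (g b))"
    using mer_linearD(4)[OF g, of "\<lambda>b. rep x b *\<^sub>C b" lie_basis]
    by (simp add: mer_linearD(2)[OF g] rep_expand)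
  also have "mer_regular \<dots> z"
    by (intro mer_regular_sum mer_regular_scale rat_regular_const z)
  finally show ?thesis .
qed

lemma Ad_one: "mer_linear g \<Longrightarrow> Ad g (x \<otimes> 1) = g x"
  by (simp add: Ad_tensor)

context principal_grading
begin

abbreviation "centralizer \<equiv> {a \<in> filt 0. bracket e a = 0}"

lemma centralizer_subspace: "cvec.subspace centralizer"
  by (rule cvec.subspaceI)
     (auto simp: bracket_add_right bracket_scaleC_right intro: g.F_add g.F_scale g.F_zero)

sublocale M: oper_setting "scaleM :: ratfun \<Rightarrow> 'g mer \<Rightarrow> 'g mer" bracketM "rho \<otimes> 1"
  "\<lambda>k. mer_of (filt k)" height "p \<otimes> 1" "e \<otimes> 1" "mer_of centralizer" deriv_mer rat_deriv
proof unfold_locales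
  fix u v w z :: "'g mer" and f :: ratfun and i j k l :: int
  show "bracketM (u + v) w = bracketM u w + bracketM v w" by (rule bracketM_add_left)
  show "bracketM u (v + w) = bracketM u v + bracketM u w" by (rule bracketM_add_right)
  show "bracketM (scaleM f u) v = scaleM f (bracketM u v)" by (rule bracketM_scale_left)
  show "bracketM u (scaleM f v) = scaleM f (bracketM u v)" by (rule bracketM_scale_right)
  show "bracketM u u = 0" by (rule bracketM_self)
  show "bracketM u (bracketM v w) + bracketM v (bracketM w u) + bracketM w (bracketM u v) = 0"
    by (rule bracketM_jacobi)
  show "mvec.subspace (mer_of (filt k))" by (rule mer_of_subspace)
  show "mer_of (filt l) \<subseteq> mer_of (filt k)" if "k \<le> l"
    using that by (intro mer_of_mono g.F_antimono)
  show "mer_of (filt (- int height)) = UNIV" unfolding g.F_low by (rule mer_of_UNIV)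
  show "mer_of (filt (int height + 1)) = {0}" unfolding g.F_high by (rule mer_of_zero)
  show "bracketM u v \<in> mer_of (filt (i + j))" if "u \<in> mer_of (filt i)" "v \<in> mer_of (filt j)"
    using that by (rule bracketM_mer_of) (rule g.F_br)
  show "bracketM (rho \<otimes> 1) u - scaleM (of_int k) u \<in> mer_of (filt (k + 1))" if "u \<in> mer_of (filt k)"
    using that
  proof (induct rule: mer_of_induct)
    case zero
    show ?case
      using bracketM_add_right[of "rho \<otimes> 1" 0 0] mvec.subspace_0[OF mer_of_subspace] by simp
  next
    case (tensor x f)
    have "bracketM (rho \<otimes> 1) (x \<otimes> f) - scaleM (of_int k) (x \<otimes> f)
        = (bracket rho x - of_int k *\<^sub>C x) \<otimes> f"
      by (simp add: bracketM_tensor tensor_diff_left tensor_scaleC)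
    then show ?case using tensor_mer_of[OF filt_rho[OF tensor], of f] by simp
  next
    case (add u v)
    from mvec.subspace_add[OF mer_of_subspace this] show ?case
      by (simp add: bracketM_add_right mvec.scale_right_distrib algebra_simps)
  qed
  \<comment> \<open>An element commuting with all constants has central, hence zero, values at its
    regular points.\<close>
  show "z = 0" if z: "\<And>u. bracketM z u = 0"
  proof (rule mer_eval_eqI[of "{}"])
    fix t assume t: "mer_regular z t"
    have "bracket (mer_eval t z) x = 0" for x
      using mer_regular_bracket(2)[OF t mer_regular_tensor_1(1), of x] z by simp
    then show "mer_eval t z = mer_eval t 0" using center_zero[of "mer_eval t z"] by simp
  qed simp
  show "p \<otimes> 1 \<in> mer_of (filt (- 1))" by (rule tensor_mer_of[OF g.p_F])
  show "e \<otimes> 1 \<in> mer_of (filt 1)" by (rule tensor_mer_of[OF g.e_F])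
  show "bracketM (e \<otimes> 1) (p \<otimes> 1) = scaleM 2 (rho \<otimes> 1)"
    by (simp add: bracketM_tensor e_p tensor_scaleC)
  show "mer_of centralizer \<subseteq> mer_of (filt 0)" by (rule mer_of_mono) blast
  show "mvec.subspace (mer_of centralizer)" by (rule mer_of_subspace)
  show "bracketM (e \<otimes> 1) u = 0" if "u \<in> mer_of centralizer"
    using that bracketM_add_right[of "e \<otimes> 1" 0 0]
    by (induct rule: mer_of_induct) (auto simp: bracketM_tensor bracketM_add_right)
  show "\<exists>a\<in>mer_of centralizer. \<exists>Y\<in>mer_of (filt k). u = a + bracketM (p \<otimes> 1) Y"
    if k: "1 \<le> k" and "u \<in> mer_of (filt (k - 1))"
    using that(2)
  proof (induct rule: mer_of_induct)
    case zero
    show ?case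
      using bracketM_add_right[of "p \<otimes> 1" 0 0] mvec.subspace_0[OF mer_of_subspace]
      by (intro bexI[of _ 0]) auto
  next
    case (tensor x f)
    from centralizer_complement[OF k tensor] obtain a Y where
      "a \<in> centralizer" "Y \<in> filt k" "x = a + bracket p Y" by blast
    then show ?case
      by (intro bexI[of _ "a \<otimes> f"] bexI[of _ "Y \<otimes> f"])
         (auto simp: bracketM_tensor tensor_add_left intro!: tensor_mer_of)
  next
    case (add u v)
    then obtain a Y b Z where "a \<in> mer_of centralizer" "Y \<in> mer_of (filt k)" "u = a + bracketM (p \<otimes> 1) Y"
      "b \<in> mer_of centralizer" "Z \<in> mer_of (filt k)" "v = b + bracketM (p \<otimes> 1) Z" by blast
    then show ?case
      by (intro bexI[of _ "a + b"] bexI[of _ "Y + Z"])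
         (auto simp: bracketM_add_right intro: mvec.subspace_add[OF mer_of_subspace])
  qed
  show "deriv_mer (u + v) = deriv_mer u + deriv_mer v" by (rule deriv_mer_add)
  show "deriv_mer (scaleM f u) = scaleM (rat_deriv f) u + scaleM f (deriv_mer u)" by (rule deriv_mer_scale)
  show "deriv_mer (bracketM u v) = bracketM (deriv_mer u) v + bracketM u (deriv_mer v)"
    by (rule deriv_mer_bracket)
  show "deriv_mer u \<in> mer_of (filt k)" if "u \<in> mer_of (filt k)"
    using that
    by (induct rule: mer_of_induct)
       (auto simp: deriv_mer_0 deriv_mer_tensor deriv_mer_add
          intro: tensor_mer_of mvec.subspace_add[OF mer_of_subspace] mvec.subspace_0[OF mer_of_subspace])
  show "deriv_mer (rho \<otimes> 1) = 0" by (rule deriv_mer_1)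
qed

text \<open>Forwards, the values are unipotent outside finitely many points, so the identities and
  memberships hold over the rational functions. Backwards, they can be evaluated at every point
  where all \<open>g x\<close> are regular.\<close>

lemma group_mer_iff:
  "g \<in> group_mer (exp_group (filt 1)) \<longleftrightarrow> mer_linear g \<and> M.unip (Ad g)"
proof
  assume "g \<in> group_mer (exp_group (filt 1))"
  then have lin: "mer_linear g"
    and grp: "\<And>z. (\<And>x. mer_regular (g x) z) \<Longrightarrow> g.unip (\<lambda>x. mer_eval z (g x))"
    unfolding group_mer_def exp_group_eq by auto
  \<comment> \<open>Regularity on a basis forces regularity of every \<open>g x\<close>, so one
    finite exceptional set serves all x.\<close>
  define R where "R = (\<Union>b\<in>lie_basis. {z. \<not> mer_regular (g b) z})"
  have R: "finite R" unfolding R_def using lie_basis(1) mer_not_regular_finite by blast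
  have reg: "mer_regular (g x) z" if "z \<notin> R" for x z
    by (rule mer_linear_regular[OF lin]) (use that in \<open>auto simp: R_def\<close>)
  have br: "g (bracket x y) = bracketM (g x) (g y)" for x y
    using g.unipD(2)[OF grp[OF reg]]
    by (intro mer_eval_eqI[OF R]) (simp add: mer_regular_bracket(2) reg)
  have f: "g x - x \<otimes> 1 \<in> mer_of (filt (j + 1))" if "x \<in> filt j" for x j
    using g.unipD(3)[OF grp[OF reg] that]
    by (intro mer_of_evalI[OF wspace_subspace R]) (simp add: reg)
  have "M.unip (Ad g)"
    unfolding M.unip_def
  proof (intro conjI allI ballI)
    show "Vector_Spaces.linear scaleM scaleM (Ad g)"
      by (rule M.linear_I) (simp_all add: Ad_add Ad_scale)
    show "Ad g (bracketM u v) = bracketM (Ad g u) (Ad g v)" for u v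
    proof (induct u rule: mer_induct)
      case (tensor x f)
      show ?case
        by (induct v rule: mer_induct)
           (simp_all add: Ad_tensor[OF lin] Ad_add bracketM_tensor bracketM_add_right br
              bracketM_scale_left bracketM_scale_right)
    qed (simp add: Ad_add bracketM_add_left)
    show "Ad g u - u \<in> mer_of (filt (j + 1))" if "u \<in> mer_of (filt j)" for u j
      using that
    proof (induct rule: mer_of_induct)
      case zero
      show ?case using Ad_add[of g 0 0] M.F_zero by simp
    next
      case (tensor x h)
      have "Ad g (x \<otimes> h) - x \<otimes> h = scaleM h (g x - x \<otimes> 1)"
        by (simp add: Ad_tensor[OF lin] mvec.scale_right_diff_distrib)
      then show ?case using M.F_scale[OF f[OF tensor]] by simp
    next
      case (add u v)
      from M.F_add[OF this] show ?case by (simp add: Ad_add algebra_simps)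
    qed
  qed
  with lin show "mer_linear g \<and> M.unip (Ad g)" by blast
next
  assume *: "mer_linear g \<and> M.unip (Ad g)"
  then have lin: "mer_linear g" and un: "M.unip (Ad g)" by auto
  have "g.unip (\<lambda>x. mer_eval z (g x))" if reg: "\<And>x. mer_regular (g x) z" for z
    unfolding g.unip_def
  proof (intro conjI allI ballI)
    show "Vector_Spaces.linear scaleC scaleC (\<lambda>x. mer_eval z (g x))"
      by (rule g.linear_I) (simp_all add: mer_linearD[OF lin] reg mer_regular_scale)
    show "mer_eval z (g (bracket x y)) = bracket (mer_eval z (g x)) (mer_eval z (g y))" for x y
    proof -
      have "g (bracket x y) = bracketM (g x) (g y)"
        using M.unipD(2)[OF un, of "x \<otimes> 1" "y \<otimes> 1"] by (simp add: bracketM_tensor Ad_one[OF lin])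
      then show ?thesis by (simp add: mer_regular_bracket reg)
    qed
    show "mer_eval z (g x) - x \<in> filt (j + 1)" if "x \<in> filt j" for x j
    proof -
      have "g x - x \<otimes> 1 \<in> mer_of (filt (j + 1))"
        using M.unipD(3)[OF un tensor_mer_of[OF that], of 1] by (simp add: Ad_one[OF lin])
      from mer_of_eval[OF wspace_subspace this, of z] show ?thesis by (simp add: reg)
    qed
  qed
  with lin show "g \<in> group_mer (exp_group (filt 1))"
    unfolding group_mer_def exp_group_eq by blast
qed

text \<open>Existence and uniqueness of the logarithmic derivative ensure that the description
  operator in \<open>right_log_deriv\<close> picks the expected element.\<close>

lemma gauge_iff:
  assumes g: "g \<in> group_mer (exp_group (filt 1))"
  shows "A' = gauge g A \<longleftrightarrow> M.gauged (Ad g) A A'"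
proof -
  have lin: "mer_linear g" and un: "M.unip (Ad g)" using g group_mer_iff by auto
  from M.log_deriv_exists[OF un] obtain u where u: "M.log_deriv (Ad g) u" by blast
  have "right_log_deriv g = u"
    unfolding right_log_deriv_def deriv_mer_def[symmetric]
  proof (rule the_equality)
    show "\<forall>x. bracketM u (g x) = deriv_mer (g x)"
    proof
      fix x
      from u[unfolded M.log_deriv_def, rule_format, of "x \<otimes> 1"]
      show "bracketM u (g x) = deriv_mer (g x)"
        using Ad_add[of g 0 0] by (simp add: Ad_one[OF lin] deriv_mer_1)
    qed
    fix w assume w: "\<forall>x. bracketM w (g x) = deriv_mer (g x)"
    \<comment> \<open>The description tests only constants, whose derivative is zero; the product
      rule extends the relation to all y.\<close>
    have "bracketM w (Ad g y) = deriv_mer (Ad g y) - Ad g (deriv_mer y)" for y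
      by (induct y rule: mer_induct)
         (simp_all add: Ad_tensor[OF lin] Ad_add w bracketM_scale_right bracketM_add_right
            deriv_mer_scale deriv_mer_tensor deriv_mer_add)
    then have "M.log_deriv (Ad g) w" unfolding M.log_deriv_def by blast
    then show "w = u" using M.log_deriv_unique[OF un _ u] by blast
  qed
  then show ?thesis using M.gauged_iff[OF un u] by (simp add: gauge_def)
qed

lemma unip_restrict:
  assumes "M.unip \<Phi>"
  shows "(\<lambda>x. \<Phi> (x \<otimes> 1)) \<in> group_mer (exp_group (filt 1))" "Ad (\<lambda>x. \<Phi> (x \<otimes> 1)) = \<Phi>"
proof -
  note * = Ad_restrict[OF M.unip_add[OF assms] M.unip_scale[OF assms]]
  show "Ad (\<lambda>x. \<Phi> (x \<otimes> 1)) = \<Phi>" by (rule *(2))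
  then show "(\<lambda>x. \<Phi> (x \<otimes> 1)) \<in> group_mer (exp_group (filt 1))"
    using * assms group_mer_iff by simp
qed

lemma group_mer_ext:
  assumes "g \<in> group_mer (exp_group (filt 1))" "g' \<in> group_mer (exp_group (filt 1))" "Ad g = Ad g'"
  shows "g = g'"
  using assms group_mer_iff Ad_one by (metis ext)

lemma op_conn_iff: "A \<in> op_conn p (filt 0) \<longleftrightarrow> A - p \<otimes> 1 \<in> mer_of (filt 0)"
  by (force simp: op_conn_def)

text \<open>Membership in each subspace is tested pointwise, so intersecting commutes with extension
  of scalars. This leads from the full kernel of ad e to its part in the Borel subalgebra, where
  oper coefficients live.\<close>

lemma mer_of_centralizer:
  assumes "v \<in> mer_of {x. bracket e x = 0}" "v \<in> mer_of (filt 0)"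
  shows "v \<in> mer_of centralizer"
proof -
  have "cvec.subspace {x. bracket e x = 0}"
    by (rule cvec.subspaceI) (simp_all add: bracket_add_right bracket_scaleC_right)
  note ev = mer_of_eval[OF this assms(1)] mer_of_eval[OF wspace_subspace assms(2)]
  show ?thesis
    by (rule mer_of_evalI[OF centralizer_subspace finite.emptyI]) (use ev in blast)
qed

lemma gauge_free: "gauge_free (group_mer (exp_group (filt 1))) (op_conn p (filt 0))"
  unfolding gauge_free_def
proof (intro ballI impI)
  fix g A assume g: "g \<in> group_mer (exp_group (filt 1))" and A: "A \<in> op_conn p (filt 0)"
    and "gauge g A = A"
  then have "M.gauged (Ad g) A A" using gauge_iff[OF g, of A A] by simp
  then have "Ad g = id"
    using A M.gauged_unique(1)[of "Ad g" A A] g mvec.subspace_0[OF M.a_subspace]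
    by (simp add: group_mer_iff op_conn_iff)
  then show "g = group_mer_one"
    using g group_mer_iff Ad_one by (fastforce simp: group_mer_one_def)
qed

text \<open>Composing g' with the inverse of g carries one canonical form to the other, so
  \<open>gauged_unique\<close> makes it the identity. That the transformation is unique, and not
  only the form, is what yields its invariance in the cyclotomic case.\<close>

lemma gauge_canonical_unique:
  assumes "g \<in> group_mer (exp_group (filt 1))" "g' \<in> group_mer (exp_group (filt 1))"
    and "p \<otimes> 1 + v = gauge g A" "p \<otimes> 1 + v' = gauge g' A"
    and "v \<in> mer_of centralizer" "v' \<in> mer_of centralizer"
  shows "g = g'" "v = v'"
proof -
  have un: "M.unip (Ad g)" "M.unip (Ad g')" using assms group_mer_iff by auto
  have "M.gauged (Ad g) A (p \<otimes> 1 + v)" "M.gauged (Ad g') A (p \<otimes> 1 + v')"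
    using assms gauge_iff by auto
  then have gd: "M.gauged (Ad g' \<circ> inv (Ad g)) (p \<otimes> 1 + v) (p \<otimes> 1 + v')"
    using M.gauged_comp M.gauged_inv[OF un(1)] by blast
  have "p \<otimes> 1 + v - p \<otimes> 1 \<in> mer_of (filt 0)" using assms(5) M.a_F by auto
  moreover have "p \<otimes> 1 + v' - (p \<otimes> 1 + v) \<in> mer_of centralizer"
    using mvec.subspace_diff[OF M.a_subspace assms(6,5)] by simp
  ultimately have *: "Ad g' \<circ> inv (Ad g) = id" "p \<otimes> 1 + v' = p \<otimes> 1 + v"
    using M.gauged_unique[OF M.unip_comp[OF un(2) M.unip_inv[OF un(1)]] gd] by blast+
  show "v = v'" using *(2) by simp
  have "Ad g' u = Ad g u" for u
    using fun_cong[OF *(1), of "Ad g u"] M.unip_inv_simps(2)[OF un(1)] by simp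
  then show "g = g'" using group_mer_ext assms by blast
qed

lemma gauge_canonical_exists:
  assumes "A \<in> op_conn p (filt 0)"
  obtains g v where "g \<in> group_mer (exp_group (filt 1))" "p \<otimes> 1 + v = gauge g A"
    "v \<in> mer_of centralizer"
proof -
  from M.gauged_exists[of A] assms obtain \<Phi> a where
    \<Phi>: "M.unip \<Phi>" "M.gauged \<Phi> A (p \<otimes> 1 + a)" "a \<in> mer_of centralizer" by (auto simp: op_conn_iff)
  show ?thesis
    by (rule that[OF unip_restrict(1)[OF \<Phi>(1)] _ \<Phi>(3)])
       (use gauge_iff[OF unip_restrict(1)[OF \<Phi>(1)]] \<Phi>(2) unip_restrict(2)[OF \<Phi>(1)] in simp)
qed

lemma Opers_canonical:
  assumes "X \<in> Opers p (filt 0) (filt 1)"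
  shows "\<exists>!v. v \<in> mer_of {x. bracket e x = 0} \<and> p \<otimes> 1 + v \<in> X"
proof -
  let ?K = "group_mer (exp_group (filt 1))"
  from assms obtain A where A: "A \<in> op_conn p (filt 0)"
    and X: "X = gauge_rel ?K (op_conn p (filt 0)) `` {A}"
    unfolding Opers_def by (rule quotientE)
  have XD: "p \<otimes> 1 + v \<in> X \<longleftrightarrow> v \<in> mer_of (filt 0) \<and> (\<exists>g\<in>?K. p \<otimes> 1 + v = gauge g A)" for v
    using A by (simp add: X gauge_rel_def op_conn_iff)
  from gauge_canonical_exists[OF A] obtain g v where
    g: "g \<in> ?K" "p \<otimes> 1 + v = gauge g A" "v \<in> mer_of centralizer" by blast
  show ?thesis
  proof (rule ex1I[of _ v])
    show "v \<in> mer_of {x. bracket e x = 0} \<and> p \<otimes> 1 + v \<in> X"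
      unfolding XD using g M.a_F mer_of_mono[of centralizer "{x. bracket e x = 0}"] by blast
    fix v' assume v': "v' \<in> mer_of {x. bracket e x = 0} \<and> p \<otimes> 1 + v' \<in> X"
    then obtain g' where g': "g' \<in> ?K" "p \<otimes> 1 + v' = gauge g' A" unfolding XD by blast
    show "v' = v"
      using gauge_canonical_unique(2)[OF g'(1) g(1) g'(2) g(2) _ g(3)] v' mer_of_centralizer XD by blast
  qed
qed

end

section \<open>Cyclotomic opers\<close>

lemma lie_automorphism_inv:
  assumes "lie_automorphism \<sigma>"
  shows "Vector_Spaces.linear scaleC scaleC (inv \<sigma>)" "inv \<sigma> (\<sigma> x) = x" "\<sigma> (inv \<sigma> x) = x"
    "inv \<sigma> (bracket x y) = bracket (inv \<sigma> x) (inv \<sigma> y)"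
proof -
  have b: "bij \<sigma>" and lin: "Vector_Spaces.linear scaleC scaleC \<sigma>"
    and br: "\<And>x y. \<sigma> (bracket x y) = bracket (\<sigma> x) (\<sigma> y)"
    using assms by (auto simp: lie_automorphism_def)
  interpret L: Vector_Spaces.linear scaleC scaleC \<sigma> by (rule lin)
  show inv: "inv \<sigma> (\<sigma> x) = x" "\<sigma> (inv \<sigma> x) = x" for x
    using b by (auto simp: bij_is_inj inv_f_f bij_is_surj surj_f_inv_f)
  show "Vector_Spaces.linear scaleC scaleC (inv \<sigma>)"
  proof unfold_locales
    show "inv \<sigma> (x + y) = inv \<sigma> x + inv \<sigma> y" for x y by (metis inv L.add)
    show "inv \<sigma> (k *\<^sub>C x) = k *\<^sub>C inv \<sigma> x" for k x by (metis inv L.scale)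
  qed
  show "inv \<sigma> (bracket x y) = bracket (inv \<sigma> x) (inv \<sigma> y)" by (metis inv br)
qed

locale twisted_grading = principal_grading I E H F C rho p e \<hh>
  for I :: "'i set" and E H F :: "'i \<Rightarrow> 'g::complex_lie_algebra" and C :: "'i \<Rightarrow> 'i \<Rightarrow> complex"
    and rho p e :: 'g and \<hh> :: "'g set" +
  fixes \<sigma> :: "'g \<Rightarrow> 'g" and \<omega> :: complex
  assumes automorphism: "lie_automorphism \<sigma>" and omega: "\<omega> \<noteq> 0"
    and sigma_rho: "\<sigma> rho = rho" and sigma_p: "\<sigma> p = \<omega> *\<^sub>C p"
begin

lemma linear_sigma: "Vector_Spaces.linear scaleC scaleC \<sigma>"
  and sigma_bracket: "\<sigma> (bracket x y) = bracket (\<sigma> x) (\<sigma> y)"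
  using automorphism by (auto simp: lie_automorphism_def)

lemmas inv_sigma = lie_automorphism_inv[OF automorphism]

sublocale s: Vector_Spaces.linear scaleC scaleC \<sigma> by (rule linear_sigma)
sublocale si: Vector_Spaces.linear scaleC scaleC "inv \<sigma>" by (rule inv_sigma)

lemma inv_sigma_rho: "inv \<sigma> rho = rho"
  using inv_sigma(2)[of rho] by (simp add: sigma_rho)

text \<open>A homomorphism fixing \<open>rho\<close> sends eigenvectors of ad \<open>rho\<close> to
  eigenvectors with the same eigenvalue, or to zero.\<close>

lemma filt_stable:
  assumes \<phi>: "Vector_Spaces.linear scaleC scaleC \<phi>" "\<And>x y. \<phi> (bracket x y) = bracket (\<phi> x) (\<phi> y)"
    "\<phi> rho = rho" and x: "x \<in> filt k"
  shows "\<phi> x \<in> filt k"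
proof -
  interpret L: Vector_Spaces.linear scaleC scaleC \<phi> by (rule \<phi>)
  have hom: "homogeneous j (\<phi> x)" if "homogeneous j x" for j x
    using \<phi>(2)[of rho x] that by (simp add: homogeneous_def \<phi>(3) L.scale)
  from x show ?thesis unfolding wspace_def[of "{k..}"]
  proof (induct rule: cvec.span_induct_alt)
    case base
    show ?case using g.F_zero[of k] by (simp add: wspace_def)
  next
    case (step c b y)
    then have "\<phi> b \<in> filt k" by (intro homogeneous_wspace'[OF hom[OF deg]]) auto
    with step(2) show ?case by (simp add: L.add L.scale wspace_def cvec.span_add cvec.span_scale)
  qed
qed

lemma sigma_filt: "x \<in> filt k \<Longrightarrow> \<sigma> x \<in> filt k"
  by (rule filt_stable[OF linear_sigma sigma_bracket sigma_rho])

lemma inv_sigma_filt: "x \<in> filt k \<Longrightarrow> inv \<sigma> x \<in> filt k"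
  by (rule filt_stable[OF inv_sigma(1) inv_sigma(4) inv_sigma_rho])

text \<open>Since \<open>e\<close> is determined by \<open>[e, p] = 2 rho\<close> in degree one, it is an eigenvector of \<open>\<sigma>\<close>.\<close>

lemma sigma_e: "\<omega> *\<^sub>C \<sigma> e = e"
proof -
  define d where "d = \<omega> *\<^sub>C \<sigma> e - e"
  have d: "d \<in> filt 1" unfolding d_def by (intro g.F_diff g.F_scale sigma_filt g.e_F)
  have "\<omega> *\<^sub>C bracket (\<sigma> e) p = bracket (\<sigma> e) (\<sigma> p)"
    by (simp add: sigma_p bracket_scaleC_right)
  also have "\<dots> = 2 *\<^sub>C rho" by (simp add: e_p s.scale sigma_rho flip: sigma_bracket)
  finally have "bracket d p = 0" by (simp add: d_def bracket_diff bracket_scaleC_left e_p)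
  then have "bracket p d = 0" using bracket_anti[of p d] by simp
  then have "d = 0" using g.sl2_inj_zero[OF d] by simp
  then show ?thesis by (simp add: d_def)
qed

lemma sigma_centralizer:
  assumes "x \<in> centralizer"
  shows "\<sigma> x \<in> centralizer"
proof -
  have "bracket e (\<sigma> x) = \<omega> *\<^sub>C \<sigma> (bracket e x)"
    by (subst sigma_e[symmetric]) (simp add: bracket_scaleC_left sigma_bracket)
  then show ?thesis using assms sigma_filt by (simp add: s.zero)
qed

text \<open>The twist of functions, semilinear over the dilation; \<open>twist_form\<close> differs
  from it by the factor 1/\<omega> stemming from dt.\<close>

definition tw :: "'g mer \<Rightarrow> 'g mer" where
  "tw = tensor_map \<sigma> (rat_dilate (inverse \<omega>))"

definition tw_inv :: "'g mer \<Rightarrow> 'g mer" where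
  "tw_inv = tensor_map (inv \<sigma>) (rat_dilate \<omega>)"

lemma clin_tw: "clin (rat_dilate (inverse \<omega>))" "clin (rat_dilate \<omega>)" "clin (form_pullback (inverse \<omega>))"
  using omega by (simp_all add: clin_dilate clin_pullback)

lemma tw_tensor: "tw (x \<otimes> f) = \<sigma> x \<otimes> rat_dilate (inverse \<omega>) f"
  unfolding tw_def by (rule tensor_map_tensor[OF linear_sigma clin_tw(1)])

lemma tw_add: "tw (u + v) = tw u + tw v"
  unfolding tw_def by (rule tensor_map_add[OF clin_tw(1)])

lemma tw_inv_tensor: "tw_inv (x \<otimes> f) = inv \<sigma> x \<otimes> rat_dilate \<omega> f"
  unfolding tw_inv_def by (rule tensor_map_tensor[OF inv_sigma(1) clin_tw(2)])

lemma tw_inv_add: "tw_inv (u + v) = tw_inv u + tw_inv v"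
  unfolding tw_inv_def by (rule tensor_map_add[OF clin_tw(2)])

lemma tw_zero: "tw 0 = 0" "tw_inv 0 = 0"
  using tw_add[of 0 0] tw_inv_add[of 0 0] by simp_all

lemma tw_diff: "tw (u - v) = tw u - tw v"
  using tw_add[of "u - v" v] by (simp add: algebra_simps)

lemma tw_tw_inv: "tw (tw_inv u) = u"
  by (induct u rule: mer_induct)
     (use rat_dilate_inverse[of "inverse \<omega>"] omega in
      \<open>simp_all add: tw_tensor tw_inv_tensor tw_add tw_inv_add inv_sigma\<close>)

lemma tw_inv_tw: "tw_inv (tw u) = u"
  by (induct u rule: mer_induct)
     (use rat_dilate_inverse[of \<omega>] omega in
      \<open>simp_all add: tw_tensor tw_inv_tensor tw_add tw_inv_add inv_sigma\<close>)

lemma tw_scale: "tw (scaleM f u) = scaleM (rat_dilate (inverse \<omega>) f) (tw u)"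
  by (induct u rule: mer_induct)
     (use omega in \<open>simp_all add: tw_tensor tw_add rat_dilate_mult mvec.scale_right_distrib\<close>)

lemma tw_inv_scale: "tw_inv (scaleM f u) = scaleM (rat_dilate \<omega> f) (tw_inv u)"
  by (induct u rule: mer_induct)
     (use omega in \<open>simp_all add: tw_inv_tensor tw_inv_add rat_dilate_mult mvec.scale_right_distrib\<close>)

lemma tw_bracket: "tw (bracketM u v) = bracketM (tw u) (tw v)"
proof (induct u rule: mer_induct)
  case (tensor x f)
  show ?case
    by (induct v rule: mer_induct)
       (use omega in \<open>simp_all add: tw_tensor tw_add bracketM_tensor bracketM_add_right rat_dilate_mult
          sigma_bracket\<close>)
qed (simp add: tw_add bracketM_add_left)

lemma tw_inv_bracket: "tw_inv (bracketM u v) = bracketM (tw_inv u) (tw_inv v)"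
  by (metis tw_bracket tw_tw_inv tw_inv_tw)

lemma tw_mer_of:
  assumes "u \<in> mer_of S" "\<And>x. x \<in> S \<Longrightarrow> \<sigma> x \<in> S'"
  shows "tw u \<in> mer_of S'"
  using assms(1)
  by (induct rule: mer_of_induct)
     (auto simp: tw_zero tw_tensor tw_add intro: tensor_mer_of assms(2)
        mvec.subspace_add[OF mer_of_subspace] mvec.subspace_0[OF mer_of_subspace])

lemma tw_inv_mer_of:
  assumes "u \<in> mer_of S" "\<And>x. x \<in> S \<Longrightarrow> inv \<sigma> x \<in> S'"
  shows "tw_inv u \<in> mer_of S'"
  using assms(1)
  by (induct rule: mer_of_induct)
     (auto simp: tw_zero tw_inv_tensor tw_inv_add intro: tensor_mer_of assms(2)
        mvec.subspace_add[OF mer_of_subspace] mvec.subspace_0[OF mer_of_subspace])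

abbreviation scal :: "'g mer \<Rightarrow> 'g mer" where
  "scal \<equiv> scaleM (ratconst (inverse \<omega>))"

lemma twist_form_eq: "twist_form \<omega> \<sigma> u = scal (tw u)"
proof (induct u rule: mer_induct)
  case (tensor x f)
  show ?case unfolding twist_form_def tensor_map_tensor[OF linear_sigma clin_tw(3)]
    by (simp add: tw_tensor form_pullback_def)
next
  case (add u v)
  then show ?case unfolding twist_form_def tensor_map_add[OF clin_tw(3)]
    by (simp add: tw_add mvec.scale_right_distrib)
qed

lemma deriv_tw: "deriv_mer (tw u) = scal (tw (deriv_mer u))"
proof (induct u rule: mer_induct)
  case (tensor x f)
  show ?case using rat_deriv_dilate[of "inverse \<omega>"] omega by (simp add: tw_tensor deriv_mer_tensor)
qed (simp add: tw_add deriv_mer_add mvec.scale_right_distrib)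

text \<open>Conjugation by \<open>tw\<close>; the two semilinearities cancel, so linearity over the
  rational functions is preserved.\<close>

definition twist :: "('g mer \<Rightarrow> 'g mer) \<Rightarrow> 'g mer \<Rightarrow> 'g mer" where
  "twist \<Phi> u = tw (\<Phi> (tw_inv u))"

lemma unip_twist:
  assumes \<Phi>: "M.unip \<Phi>"
  shows "M.unip (twist \<Phi>)"
  unfolding M.unip_def
proof (intro conjI allI ballI)
  show "Vector_Spaces.linear scaleM scaleM (twist \<Phi>)"
  proof (rule M.linear_I)
    show "twist \<Phi> (u + v) = twist \<Phi> u + twist \<Phi> v" for u v
      by (simp add: twist_def tw_inv_add M.unip_add[OF \<Phi>] tw_add)
    fix f u
    have "twist \<Phi> (scaleM f u) = scaleM (rat_dilate (inverse \<omega>) (rat_dilate \<omega> f)) (twist \<Phi> u)"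
      by (simp add: twist_def tw_inv_scale M.unip_scale[OF \<Phi>] tw_scale)
    then show "twist \<Phi> (scaleM f u) = scaleM f (twist \<Phi> u)"
      using rat_dilate_inverse[of "inverse \<omega>" f] omega by simp
  qed
  show "twist \<Phi> (bracketM u v) = bracketM (twist \<Phi> u) (twist \<Phi> v)" for u v
    by (simp add: twist_def tw_inv_bracket M.unipD(2)[OF \<Phi>] tw_bracket)
  show "twist \<Phi> u - u \<in> mer_of (filt (j + 1))" if "u \<in> mer_of (filt j)" for u j
  proof -
    have "twist \<Phi> u - u = tw (\<Phi> (tw_inv u) - tw_inv u)"
      by (simp add: twist_def tw_diff tw_tw_inv)
    moreover have "\<Phi> (tw_inv u) - tw_inv u \<in> mer_of (filt (j + 1))"
      by (rule M.unipD(3)[OF \<Phi> tw_inv_mer_of[OF that inv_sigma_filt]])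
    ultimately show ?thesis using tw_mer_of[OF _ sigma_filt] by simp
  qed
qed

text \<open>Conjugating the intertwining relation with \<open>tw\<close> and multiplying by
  1/\<omega> turns D into itself, by \<open>deriv_tw\<close>, and the connection forms into their
  twists.\<close>

lemma gauged_twist:
  assumes \<Phi>: "M.unip \<Phi>" and g: "M.gauged \<Phi> A A'"
  shows "M.gauged (twist \<Phi>) (twist_form \<omega> \<sigma> A) (twist_form \<omega> \<sigma> A')"
  unfolding M.gauged_def
proof
  fix y
  have "deriv_mer (twist \<Phi> y) + bracketM (twist_form \<omega> \<sigma> A') (twist \<Phi> y)
      = scal (tw (deriv_mer (\<Phi> (tw_inv y)) + bracketM A' (\<Phi> (tw_inv y))))"
    by (simp add: twist_def twist_form_eq deriv_tw bracketM_scale_left tw_add tw_bracket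
        mvec.scale_right_distrib)
  also have "\<dots> = scal (tw (\<Phi> (deriv_mer (tw_inv y) + bracketM A (tw_inv y))))"
    using g by (simp add: M.gauged_def)
  also have "\<dots> = scal (twist \<Phi> (tw (deriv_mer (tw_inv y) + bracketM A (tw_inv y))))"
    by (simp add: twist_def tw_inv_tw)
  also have "\<dots> = twist \<Phi> (scal (tw (deriv_mer (tw_inv y) + bracketM A (tw_inv y))))"
    by (simp only: M.unip_scale[OF unip_twist[OF \<Phi>]])
  also have "scal (tw (deriv_mer (tw_inv y) + bracketM A (tw_inv y)))
      = deriv_mer y + bracketM (twist_form \<omega> \<sigma> A) y"
    using deriv_tw[of "tw_inv y"]
    by (simp add: twist_form_eq bracketM_scale_left tw_add tw_bracket tw_tw_inv mvec.scale_right_distrib)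
  finally show "deriv_mer (twist \<Phi> y) + bracketM (twist_form \<omega> \<sigma> A') (twist \<Phi> y)
      = twist \<Phi> (deriv_mer y + bracketM (twist_form \<omega> \<sigma> A) y)" .
qed

lemma twist_group_eq:
  assumes lin: "mer_linear g"
  shows "mer_linear (twist_group \<omega> \<sigma> g)" "Ad (twist_group \<omega> \<sigma> g) = twist (Ad g)"
proof -
  have eq: "twist_group \<omega> \<sigma> g x = tw (g (inv \<sigma> x))" for x
    by (simp add: twist_group_def tw_def)
  show 1: "mer_linear (twist_group \<omega> \<sigma> g)"
  proof (rule mer_linearI)
    show "twist_group \<omega> \<sigma> g (x + y) = twist_group \<omega> \<sigma> g x + twist_group \<omega> \<sigma> g y" for x y
      by (simp add: eq si.add mer_linearD[OF lin] tw_add)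
    show "twist_group \<omega> \<sigma> g (k *\<^sub>C x) = scaleM (ratconst k) (twist_group \<omega> \<sigma> g x)" for k x
      using omega by (simp add: eq si.scale mer_linearD[OF lin] tw_scale)
  qed
  show "Ad (twist_group \<omega> \<sigma> g) = twist (Ad g)"
  proof
    fix u show "Ad (twist_group \<omega> \<sigma> g) u = twist (Ad g) u"
    proof (induct u rule: mer_induct)
      case (tensor x f)
      show ?case
        using rat_dilate_inverse[of "inverse \<omega>" f] omega
        unfolding Ad_tensor[OF 1] unfolding eq twist_def tw_inv_tensor Ad_tensor[OF lin] tw_scale by simp
    qed (simp add: twist_def Ad_add tw_add tw_inv_add)
  qed
qed

lemma twist_group_mer:
  assumes "g \<in> group_mer (exp_group (filt 1))"
  shows "twist_group \<omega> \<sigma> g \<in> group_mer (exp_group (filt 1))"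
  using assms twist_group_eq unip_twist unfolding group_mer_iff by metis

lemma gauge_twist:
  assumes g: "g \<in> group_mer (exp_group (filt 1))" and "A' = gauge g A"
  shows "twist_form \<omega> \<sigma> A' = gauge (twist_group \<omega> \<sigma> g) (twist_form \<omega> \<sigma> A)"
proof -
  have "M.unip (Ad g)" "mer_linear g" using g group_mer_iff by auto
  then show ?thesis
    using gauged_twist[of "Ad g" A A'] assms gauge_iff[OF g] gauge_iff[OF twist_group_mer[OF g]]
      twist_group_eq(2)[of g] by metis
qed

text \<open>The factor \<omega> by which \<sigma> scales p cancels the factor 1/\<omega> from
  dt.\<close>

lemma twist_form_p: "twist_form \<omega> \<sigma> (p \<otimes> 1) = p \<otimes> 1"
proof -
  have "ratconst (inverse \<omega>) * ratconst \<omega> = 1"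
    using omega by (simp flip: ratconst_simps(4))
  moreover have "rat_dilate (inverse \<omega>) 1 = 1"
    using rat_dilate_const[of "inverse \<omega>" 1] omega by simp
  ultimately show ?thesis
    by (simp add: twist_form_eq tw_tensor sigma_p tensor_scaleC)
qed

lemma twist_form_add: "twist_form \<omega> \<sigma> (u + v) = twist_form \<omega> \<sigma> u + twist_form \<omega> \<sigma> v"
  by (simp add: twist_form_eq tw_add mvec.scale_right_distrib)

lemma op_conn_cyc_iff:
  "p \<otimes> 1 + v \<in> op_conn_cyc \<omega> \<sigma> p (filt 0) \<longleftrightarrow> v \<in> mer_of (filt 0) \<and> twist_form \<omega> \<sigma> v = v"
  by (auto simp: op_conn_cyc_def form_inv_def)

lemma op_conn_cycD:
  assumes "A \<in> op_conn_cyc \<omega> \<sigma> p (filt 0)"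
  shows "A \<in> op_conn p (filt 0)" "twist_form \<omega> \<sigma> A = A"
  using assms by (auto simp: op_conn_cyc_def op_conn_def form_inv_def twist_form_add twist_form_p)

lemma gauge_free_cyc:
  "gauge_free (group_mer_inv \<omega> \<sigma> (exp_group (filt 1))) (op_conn_cyc \<omega> \<sigma> p (filt 0))"
  using gauge_free op_conn_cycD(1) by (auto simp: gauge_free_def group_mer_inv_def)

text \<open>By uniqueness, the canonical representative of an invariant connection and the gauge
  transformation leading to it are themselves invariant.\<close>

lemma Opers_cyc_canonical:
  assumes "X \<in> Opers_cyc \<omega> \<sigma> p (filt 0) (filt 1)"
  shows "\<exists>!v. v \<in> form_inv \<omega> \<sigma> {x. bracket e x = 0} \<and> p \<otimes> 1 + v \<in> X"
proof -
  let ?G = "group_mer (exp_group (filt 1))"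
  let ?K = "group_mer_inv \<omega> \<sigma> (exp_group (filt 1))" and ?X = "op_conn_cyc \<omega> \<sigma> p (filt 0)"
  from assms obtain A where A: "A \<in> ?X" and X: "X = gauge_rel ?K ?X `` {A}"
    unfolding Opers_cyc_def by (rule quotientE)
  have XD: "p \<otimes> 1 + v \<in> X \<longleftrightarrow> v \<in> mer_of (filt 0) \<and> twist_form \<omega> \<sigma> v = v \<and>
      (\<exists>g\<in>?K. p \<otimes> 1 + v = gauge g A)" for v
    using A op_conn_cyc_iff by (simp add: X gauge_rel_def)
  have KG: "g \<in> ?G" if "g \<in> ?K" for g using that by (simp add: group_mer_inv_def)
  from gauge_canonical_exists[OF op_conn_cycD(1)[OF A]] obtain g v where
    g: "g \<in> ?G" "p \<otimes> 1 + v = gauge g A" "v \<in> mer_of centralizer" by blast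
  have tv: "twist_form \<omega> \<sigma> v \<in> mer_of centralizer"
    unfolding twist_form_eq by (intro mvec.subspace_scale[OF M.a_subspace] tw_mer_of[OF g(3) sigma_centralizer])
  \<comment> \<open>As A is invariant, twisting its reduction gives a second reduction of the same A
    to canonical form.\<close>
  have "p \<otimes> 1 + twist_form \<omega> \<sigma> v = gauge (twist_group \<omega> \<sigma> g) A"
    using gauge_twist[OF g(1,2)] by (simp add: twist_form_add twist_form_p op_conn_cycD(2)[OF A])
  from gauge_canonical_unique[OF twist_group_mer[OF g(1)] g(1) this g(2) tv g(3)]
  have inv: "twist_group \<omega> \<sigma> g = g" "twist_form \<omega> \<sigma> v = v" .
  then have gK: "g \<in> ?K" using g(1) by (simp add: group_mer_inv_def)
  show ?thesis
  proof (rule ex1I[of _ v])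
    have "v \<in> mer_of {x. bracket e x = 0}" "v \<in> mer_of (filt 0)"
      using g(3) M.a_F mer_of_mono[of centralizer "{x. bracket e x = 0}"] by blast+
    then show "v \<in> form_inv \<omega> \<sigma> {x. bracket e x = 0} \<and> p \<otimes> 1 + v \<in> X"
      unfolding XD form_inv_def using gK g(2) inv(2) by blast
    fix v' assume v': "v' \<in> form_inv \<omega> \<sigma> {x. bracket e x = 0} \<and> p \<otimes> 1 + v' \<in> X"
    then obtain g' where g': "g' \<in> ?G" "p \<otimes> 1 + v' = gauge g' A" unfolding XD using KG by blast
    have "v' \<in> mer_of centralizer"
      using v' mer_of_centralizer unfolding XD form_inv_def by blast
    from gauge_canonical_unique(2)[OF g'(1) g(1) g'(2) g(2) this g(3)] show "v' = v" .
  qed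
qed

end

theorem theorem4p5:
  fixes \<hh> \<nn> \<bb> \<aa> :: "'g::complex_lie_algebra set"
    and I :: "'i set" and \<alpha> :: "'i \<Rightarrow> 'g \<Rightarrow> complex" and A :: "'i \<Rightarrow> 'i \<Rightarrow> int"
    and E H F :: "'i \<Rightarrow> 'g" and rho p_minus p_plus :: 'g and c :: "'i \<Rightarrow> complex"
    and \<nu> :: "'i \<Rightarrow> 'i" and T :: nat and \<omega> :: complex and \<sigma> :: "'g \<Rightarrow> 'g"
  assumes "semisimple TYPE('g)"
    and "cartan_subalgebra \<hh>"
    and "chevalley_serre_generators \<hh> I \<alpha> A E H F"
    and "\<nn> = lie_generated (E ` I)"
    and "\<bb> = {x + y | x y. x \<in> \<hh> \<and> y \<in> \<nn>}"
    and "rho \<in> \<hh>" and "\<And>i. i \<in> I \<Longrightarrow> \<alpha> i rho = 1"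
    and "2 *\<^sub>C rho = (\<Sum>i\<in>I. c i *\<^sub>C H i)"
    and "p_minus = (\<Sum>i\<in>I. F i)"
    and "p_plus = (\<Sum>i\<in>I. c i *\<^sub>C E i)"
    and "\<aa> = {x. bracket p_plus x = 0}"
    and "\<nu> permutes I"
    and "\<And>i j. i \<in> I \<Longrightarrow> j \<in> I \<Longrightarrow> A (\<nu> i) (\<nu> j) = A i j"
    and "T \<ge> 1" and "\<nu> ^^ T = id"
    and "primitive_root_of_unity T \<omega>"
    and "lie_automorphism \<sigma>"
    and "\<And>i. i \<in> I \<Longrightarrow> \<sigma> (E i) = inverse \<omega> *\<^sub>C E (\<nu> i)"
    and "\<And>i. i \<in> I \<Longrightarrow> \<sigma> (H i) = H (\<nu> i)"
    and "\<And>i. i \<in> I \<Longrightarrow> \<sigma> (F i) = \<omega> *\<^sub>C F (\<nu> i)"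
  shows "gauge_free (group_mer_inv \<omega> \<sigma> (exp_group \<nn>)) (op_conn_cyc \<omega> \<sigma> p_minus \<bb>)
    \<and> gauge_free (group_mer (exp_group \<nn>)) (op_conn p_minus \<bb>)
    \<and> (\<forall>X\<in>Opers_cyc \<omega> \<sigma> p_minus \<bb> \<nn>. \<exists>!v. v \<in> form_inv \<omega> \<sigma> \<aa> \<and> p_minus \<otimes> 1 + v \<in> X)
    \<and> (\<forall>X\<in>Opers p_minus \<bb> \<nn>. \<exists>!v. v \<in> mer_of \<aa> \<and> p_minus \<otimes> 1 + v \<in> X)"
proof -
  from assms(3) have simple: "simple_roots \<hh> I \<alpha>"
    and gen: "\<And>i. i \<in> I \<Longrightarrow> H i \<in> \<hh>" "\<And>i. i \<in> I \<Longrightarrow> E i \<in> root_space \<hh> (\<alpha> i)"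
      "\<And>i. i \<in> I \<Longrightarrow> F i \<in> root_space \<hh> (\<lambda>x. - \<alpha> i x)"
    and alpha_H: "\<And>i j. i \<in> I \<Longrightarrow> j \<in> I \<Longrightarrow> \<alpha> j (H i) = of_int (A i j)"
    and HH: "\<And>i j. i \<in> I \<Longrightarrow> j \<in> I \<Longrightarrow> bracket (H i) (H j) = 0"
    and EF: "\<And>i j. i \<in> I \<Longrightarrow> j \<in> I \<Longrightarrow> bracket (E i) (F j) = (if i = j then H i else 0)"
    and generated: "lie_generated (E ` I \<union> H ` I \<union> F ` I) = UNIV"
    unfolding chevalley_serre_generators_def by blast+
  have fin: "finite I" using simple by (simp add: simple_roots_def)
  have hE: "bracket y (E i) = \<alpha> i y *\<^sub>C E i" if "i \<in> I" "y \<in> \<hh>" for i y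
    using gen(2)[OF that(1)] that(2) by (simp add: root_space_def)
  have hF: "bracket y (F i) = - (\<alpha> i y *\<^sub>C F i)" if "i \<in> I" "y \<in> \<hh>" for i y
    using gen(3)[OF that(1)] that(2) by (simp add: root_space_def)
  have rho_E: "bracket rho (E i) = E i" if "i \<in> I" for i
    using hE[OF that assms(6)] assms(7)[OF that] by simp
  have rho_F: "bracket rho (F i) = - F i" if "i \<in> I" for i
    using hF[OF that assms(6)] assms(7)[OF that] by simp
  \<comment> \<open>Here \<open>rho\<close> is expressed through the coroots, which commute with
    each other; \<hh> itself is only known to be nilpotent.\<close>
  have rho_H: "bracket rho (H i) = 0" if "i \<in> I" for i
  proof -
    have "2 *\<^sub>C bracket rho (H i) = (\<Sum>j\<in>I. c j *\<^sub>C bracket (H j) (H i))"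
      using assms(8) by (simp add: bracket_sum_left bracket_scaleC_left flip: bracket_scaleC_left[of 2])
    also have "\<dots> = 0" using HH that by (intro sum.neutral) simp
    finally show ?thesis by simp
  qed
  have ep: "bracket p_plus p_minus = 2 *\<^sub>C rho"
  proof -
    have "bracket p_plus p_minus = (\<Sum>i\<in>I. \<Sum>j\<in>I. if j = i then c i *\<^sub>C H i else 0)"
      unfolding assms(9,10) bracket_sum_left unfolding bracket_sum_right
      by (intro sum.cong refl) (auto simp: bracket_scaleC_left EF)
    then show ?thesis using fin by (simp add: assms(8))
  qed
  \<comment> \<open>The centre is an abelian, hence solvable, ideal.\<close>
  have center: "z = 0" if z: "\<And>x. bracket z x = 0" for z :: 'g
  proof -
    define Z :: "'g set" where "Z = {z. \<forall>x. bracket z x = 0}"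
    have "bracket x y = 0" if "y \<in> Z" for x y
      using that bracket_anti[of x y] by (simp add: Z_def)
    moreover have sub: "cvec.subspace Z"
      by (rule cvec.subspaceI) (auto simp: Z_def bracket_add_left bracket_scaleC_left)
    ultimately have ideal: "lie_ideal Z"
      by (simp add: lie_ideal_def cvec.subspace_0)
    have "bracket_space Z Z \<subseteq> {0}"
      unfolding bracket_space_def by (rule cvec.span_minimal) (auto simp: Z_def)
    moreover have "0 \<in> bracket_space Z Z" by (simp add: bracket_space_def cvec.span_zero)
    ultimately have "lie_solvable Z"
      unfolding lie_solvable_def by (intro exI[of _ 1]) auto
    with ideal assms(1) have "Z = {0}" by (simp add: semisimple_def)
    with z show "z = 0" unfolding Z_def by blast
  qed
  have cartan: "cvec.subspace \<hh>" "lie_nilpotent \<hh>"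
    using assms(2) by (auto simp: cartan_subalgebra_def lie_subalgebra_def)
  \<comment> \<open>As \<open>rho\<close> lies in \<hh>, the iterates of ad \<open>rho\<close>
    descend along the lower central series of \<hh>.\<close>
  have nil: "\<exists>k. (bracket rho ^^ k) x = 0" if "x \<in> \<hh>" for x
  proof -
    have "(bracket rho ^^ k) x \<in> (bracket_space \<hh> ^^ k) \<hh>" for k
      by (induct k) (use that assms(6) in \<open>auto simp: bracket_space_def intro!: cvec.span_base\<close>)
    then show ?thesis using cartan(2) unfolding lie_nilpotent_def by blast
  qed
  interpret principal_grading I E H F "\<lambda>i j. of_int (A i j)" rho p_minus p_plus \<hh>
  proof unfold_locales
    show "z = 0" if "\<And>x. bracket z x = 0" for z :: 'g by (rule center) (rule that)
    show "bracket rho p_minus = - p_minus"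
      by (simp add: assms(9) bracket_sum_right rho_F sum_negf)
    show "bracket rho p_plus = p_plus"
      by (simp add: assms(10) bracket_sum_right bracket_scaleC_right rho_E)
    show "bracket (H i) (E j) = of_int (A i j) *\<^sub>C E j" if "i \<in> I" "j \<in> I" for i j
      using hE[OF that(2) gen(1)[OF that(1)]] alpha_H[OF that] by simp
    show "bracket (H i) (F j) = - (of_int (A i j) *\<^sub>C F j)" if "i \<in> I" "j \<in> I" for i j
      using hF[OF that(2) gen(1)[OF that(1)]] alpha_H[OF that] by simp
  qed (use generated rho_E rho_F rho_H HH EF ep cartan gen(1) nil in auto)
  have sigma_br: "\<sigma> (bracket x y) = bracket (\<sigma> x) (\<sigma> y)" for x y
    using assms(17) by (simp add: lie_automorphism_def)
  have lin: "Vector_Spaces.linear scaleC scaleC \<sigma>" using assms(17) by (simp add: lie_automorphism_def)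
  interpret L: Vector_Spaces.linear scaleC scaleC \<sigma> by (rule lin)
  have omega: "\<omega> \<noteq> 0"
    using assms(14,16) by (auto simp: primitive_root_of_unity_def power_0_left)
  have nu: "\<exists>i\<in>I. j = \<nu> i" if "j \<in> I" for j
    using permutes_image[OF assms(12)] that by blast
  have nu_in: "\<nu> i \<in> I" if "i \<in> I" for i
    using permutes_in_image[OF assms(12)] that by simp
  \<comment> \<open>Every index is some \<nu> i, so applying \<sigma> to the relations of
    \<open>rho\<close> with the generators gives the same relations for \<sigma>
    \<open>rho\<close>.\<close>
  have sigma_E: "bracket (\<sigma> rho) (E j) = E j" if "j \<in> I" for j
  proof -
    from nu[OF that] obtain i where i: "i \<in> I" "j = \<nu> i" by blast
    have "inverse \<omega> *\<^sub>C bracket (\<sigma> rho) (E j) = inverse \<omega> *\<^sub>C E j"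
      using arg_cong[OF rho_E[OF i(1)], of \<sigma>] by (simp add: sigma_br assms(18) i bracket_scaleC_right)
    then show ?thesis using omega by simp
  qed
  have sigma_F: "bracket (\<sigma> rho) (F j) = - F j" if "j \<in> I" for j
  proof -
    from nu[OF that] obtain i where i: "i \<in> I" "j = \<nu> i" by blast
    have "\<omega> *\<^sub>C bracket (\<sigma> rho) (F j) = \<omega> *\<^sub>C (- F j)"
      using arg_cong[OF rho_F[OF i(1)], of \<sigma>]
      by (simp add: sigma_br assms(20) i bracket_scaleC_right L.neg)
    then show ?thesis using omega by (simp only: cvec.scale_cancel_left) simp
  qed
  have sigma_H: "bracket (\<sigma> rho) (H j) = 0" if "j \<in> I" for j
  proof -
    from nu[OF that] obtain i where i: "i \<in> I" "j = \<nu> i" by blast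
    show ?thesis using arg_cong[OF rho_H[OF i(1)], of \<sigma>] by (simp add: sigma_br assms(19) i L.zero)
  qed
  have "\<sigma> rho = rho"
  proof -
    \<comment> \<open>The difference commutes with all generators, so it is central.\<close>
    let ?z = "\<sigma> rho - rho"
    have "lie_subalgebra {x. bracket ?z x = 0}"
      unfolding lie_subalgebra_def
      by (auto intro!: cvec.subspaceI simp: bracket_add_right bracket_scaleC_right bracket_leibniz[of ?z])
    then have "lie_generated (E ` I \<union> H ` I \<union> F ` I) \<subseteq> {x. bracket ?z x = 0}"
      by (rule lie_generated_least)
         (auto simp: bracket_diff sigma_E sigma_F sigma_H rho_E rho_F rho_H)
    then have "bracket ?z x = 0" for x unfolding generated by blast
    then have "?z = 0" by (rule center)
    then show ?thesis by simp
  qed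
  moreover have "\<sigma> p_minus = \<omega> *\<^sub>C p_minus"
  proof -
    have "\<sigma> p_minus = (\<Sum>i\<in>I. \<omega> *\<^sub>C F (\<nu> i))" by (simp add: assms(9) L.sum assms(20))
    also have "\<dots> = (\<Sum>i\<in>I. \<omega> *\<^sub>C F i)"
      by (rule sum.reindex_bij_betw[OF permutes_imp_bij[OF assms(12)], of "\<lambda>i. \<omega> *\<^sub>C F i"])
    finally show ?thesis by (simp add: assms(9) cvec.scale_sum_right)
  qed
  ultimately interpret twisted_grading I E H F "\<lambda>i j. of_int (A i j)" rho p_minus p_plus \<hh> \<sigma> \<omega>
    by unfold_locales (rule assms(17) omega | assumption)+
  have n: "\<nn> = filt 1" using assms(4) generated_E_eq by simp
  have b: "\<bb> = filt 0" using assms(4,5) borel_eq by simp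
  show ?thesis
    unfolding n b assms(11)
    using gauge_free_cyc gauge_free Opers_cyc_canonical Opers_canonical by blast
qed

end
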